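(* Let $G$ be a finite simple connected graph satisfying condition $(\sharp)$, and suppose that $I_{\mathcal{A}_G}$ has no minimal binomial of the form $B_w=B_w^{(+)}-B_w^{(-)}$ where $B_w$ is a circuit and $B_w^{(+)},B_w^{(-)}$ are squarefree monomials that are not indispensable monomials of $I_{\mathcal{A}_G}$. Then $\mathrm{bar}(I_{\mathcal{A}_G})=\mu(I_{\mathcal{A}_G})$.
   Context: $G$ has vertices $v_1,\ldots,v_n$ and edges $e_1,\ldots,e_m$. For an edge $e_i=\{v_j,v_k\}$ let $\mathbf a_i\in\mathbb{Z}^n$ have $1$ in positions $j,k$ and $0$ elsewhere; $\mathcal{A}_G=\{\mathbf a_1,\ldots,\mathbf a_m\}$, and $I_{\mathcal{A}_G}\subset K[x_1,\ldots,x_m]$ ($K$ a field) is the kernel of the $K$-algebra map $x_i\mapsto \mathbf t^{\mathbf a_i}$. Condition $(\sharp)$: there is no induced subgraph of $G$ consisting of two vertex-disjoint odd cycles joined by a path of length $\ge1$. For an even closed walk $w=(e_{i_1},\ldots,e_{i_{2s}})$, $B_w^{(+)}=\prod_{k=1}^s x_{i_{2k-1}}$, $B_w^{(-)}=\prod_{k=1}^s x_{i_{2k}}$, $B_w=B_w^{(+)}-B_w^{(-)}\in I_{\mathcal{A}_G}$. A circuit is a binomial $\mathbf x^{\mathbf u_+}-\mathbf x^{\mathbf u_-}$ with $\mathbf u$ a nonzero vector of $\ker_{\mathbb{Z}}(\mathcal{A}_G)$ of inclusion-minimal support and relatively prime coordinates. A binomial is minimal if it belongs to some minimal system of binomial generators.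 A monomial $M$ is indispensable if every system of binomial generators of $I_{\mathcal{A}_G}$ contains a binomial with $M$ as one of its monomials. $\mu$ is the cardinality of a minimal binomial generating set; $\mathrm{bar}(I)$ is the least number of binomials in $I$ generating $I$ up to radical. *)

theory Defs
  imports Main "HOL-Library.Poly_Mapping"
begin

section \<open>Graphs\<close>

text \<open>A finite simple graph G with vertices 0,...,n-1 (standing for v_1..v_n) and
edges E 0, ..., E (m-1) (standing for e_1..e_m).\<close>

definition simple_graph :: "nat \<Rightarrow> nat \<Rightarrow> (nat \<Rightarrow> nat set) \<Rightarrow> bool" where
  "simple_graph n m E \<longleftrightarrow>
     (\<forall>i<m. E i \<subseteq> {..<n} \<and> card (E i) = 2) \<and> inj_on E {..<m}"

definition adj :: "nat \<Rightarrow> (nat \<Rightarrow> nat set) \<Rightarrow> nat \<Rightarrow> nat \<Rightarrow> bool" where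
  "adj m E x y \<longleftrightarrow> (\<exists>i<m. E i = {x, y})"

definition connected_graph :: "nat \<Rightarrow> nat \<Rightarrow> (nat \<Rightarrow> nat set) \<Rightarrow> bool" where
  "connected_graph n m E \<longleftrightarrow>
     (\<forall>x<n. \<forall>y<n. (x, y) \<in> {(a, b). adj m E a b}\<^sup>*)"

text \<open>A cycle given as a list of distinct vertices c_0,...,c_(k-1), k \<ge> 3, with c_j adjacent
to c_(j+1 mod k).\<close>
definition is_cycle :: "nat \<Rightarrow> (nat \<Rightarrow> nat set) \<Rightarrow> nat list \<Rightarrow> bool" where
  "is_cycle m E c \<longleftrightarrow> distinct c \<and> length c \<ge> 3 \<and>
     (\<forall>k<length c. adj m E (c ! k) (c ! ((k + 1) mod length c)))"

definition cycle_edges :: "nat list \<Rightarrow> nat set set" where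
  "cycle_edges c = {{c ! k, c ! ((k + 1) mod length c)} | k. k < length c}"

text \<open>A path given as a list of distinct vertices p_0,...,p_l; its length is l.\<close>
definition is_path :: "nat \<Rightarrow> (nat \<Rightarrow> nat set) \<Rightarrow> nat list \<Rightarrow> bool" where
  "is_path m E p \<longleftrightarrow> distinct p \<and> p \<noteq> [] \<and>
     (\<forall>k. k + 1 < length p \<longrightarrow> adj m E (p ! k) (p ! (k + 1)))"

definition path_edges :: "nat list \<Rightarrow> nat set set" where
  "path_edges p = {{p ! k, p ! (k + 1)} | k. k + 1 < length p}"

text \<open>Condition (sharp): no induced subgraph consisting of two vertex-disjoint odd cycles
joined by a path of length at least 1.\<close>
definition sharp_condition :: "nat \<Rightarrow> nat \<Rightarrow> (nat \<Rightarrow> nat set) \<Rightarrow> bool" where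
  "sharp_condition n m E \<longleftrightarrow>
     \<not> (\<exists>c1 c2 p.
          is_cycle m E c1 \<and> odd (length c1) \<and>
          is_cycle m E c2 \<and> odd (length c2) \<and>
          set c1 \<inter> set c2 = {} \<and>
          is_path m E p \<and> length p \<ge> 2 \<and>
          hd p \<in> set c1 \<and> last p \<in> set c2 \<and>
          set p \<inter> (set c1 \<union> set c2) = {hd p, last p} \<and>
          (\<forall>x \<in> set c1 \<union> set c2 \<union> set p. \<forall>y \<in> set c1 \<union> set c2 \<union> set p.
              adj m E x y \<longleftrightarrow> {x, y} \<in> cycle_edges c1 \<union> cycle_edges c2 \<union> path_edges p))"

section \<open>The polynomial ring K[x_1,...,x_m] and the toric ideal\<close>

text \<open>Polynomials are finitely supported maps from exponent vectors exponent vectors to the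
field; variable x_(i+1) corresponds to index i. The ring K[x_1..x_m] is the set of polynomials
only involving the variables with index < m.\<close>

type_synonym 'k mpoly = "(nat \<Rightarrow>\<^sub>0 nat) \<Rightarrow>\<^sub>0 'k"

definition polyring :: "nat \<Rightarrow> ('k::field) mpoly set" where
  "polyring m = {f. \<forall>u \<in> Poly_Mapping.keys f. Poly_Mapping.keys u \<subseteq> {..<m}}"

definition xmono :: "(nat \<Rightarrow>\<^sub>0 nat) \<Rightarrow> ('k::field) mpoly" where
  "xmono u = Poly_Mapping.single u 1"

definition ideal_gen :: "nat \<Rightarrow> ('k::field) mpoly set \<Rightarrow> 'k mpoly set" where
  "ideal_gen m S = {(\<Sum>s\<in>F. c s * s) | F c. finite F \<and> F \<subseteq> S \<and> (\<forall>s\<in>F. c s \<in> polyring m)}"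

definition radical :: "nat \<Rightarrow> ('k::field) mpoly set \<Rightarrow> 'k mpoly set" where
  "radical m J = {f \<in> polyring m. \<exists>k. f ^ k \<in> J}"

text \<open>Image of the monomial x^u under x_i \<mapsto> t^(a_i): the exponent vector \<Sum> u_i a_i.\<close>
definition edge_image :: "(nat \<Rightarrow> nat set) \<Rightarrow> (nat \<Rightarrow>\<^sub>0 nat) \<Rightarrow> (nat \<Rightarrow>\<^sub>0 nat)" where
  "edge_image E u = (\<Sum>i\<in>Poly_Mapping.keys u. \<Sum>j\<in>E i. Poly_Mapping.single j (Poly_Mapping.lookup u i))"

text \<open>The K-algebra map K[x_1..x_m] \<rightarrow> K[t_1..t_n], x_i \<mapsto> t^(a_i).\<close>
definition toric_map :: "(nat \<Rightarrow> nat set) \<Rightarrow> ('k::field) mpoly \<Rightarrow> 'k mpoly" where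
  "toric_map E f = (\<Sum>u\<in>Poly_Mapping.keys f. Poly_Mapping.single (edge_image E u) (Poly_Mapping.lookup f u))"

definition toric_ideal :: "nat \<Rightarrow> (nat \<Rightarrow> nat set) \<Rightarrow> ('k::field) mpoly set" where
  "toric_ideal m E = {f \<in> polyring m. toric_map E f = 0}"

definition is_binomial :: "nat \<Rightarrow> ('k::field) mpoly \<Rightarrow> bool" where
  "is_binomial m b \<longleftrightarrow> (\<exists>u v. Poly_Mapping.keys u \<subseteq> {..<m} \<and> Poly_Mapping.keys v \<subseteq> {..<m} \<and> b = xmono u - xmono v)"

definition binomial_gen_set :: "nat \<Rightarrow> ('k::field) mpoly set \<Rightarrow> 'k mpoly set \<Rightarrow> bool" where
  "binomial_gen_set m I S \<longleftrightarrow> S \<subseteq> I \<and> (\<forall>b\<in>S. is_binomial m b) \<and> ideal_gen m S = I"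

definition minimal_binomial_gen_set :: "nat \<Rightarrow> ('k::field) mpoly set \<Rightarrow> 'k mpoly set \<Rightarrow> bool" where
  "minimal_binomial_gen_set m I S \<longleftrightarrow>
     binomial_gen_set m I S \<and> (\<forall>S'. S' \<subset> S \<longrightarrow> ideal_gen m S' \<noteq> I)"

definition minimal_binomial :: "nat \<Rightarrow> ('k::field) mpoly set \<Rightarrow> 'k mpoly \<Rightarrow> bool" where
  "minimal_binomial m I b \<longleftrightarrow> (\<exists>S. minimal_binomial_gen_set m I S \<and> b \<in> S)"

text \<open>The monomial x^w is indispensable: every binomial generating system contains a binomial
having x^w as one of its monomials.\<close>
definition indispensable_monomial :: "nat \<Rightarrow> ('k::field) mpoly set \<Rightarrow> (nat \<Rightarrow>\<^sub>0 nat) \<Rightarrow> bool" where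
  "indispensable_monomial m I w \<longleftrightarrow>
     (\<forall>S. binomial_gen_set m I S \<longrightarrow> (\<exists>b\<in>S. w \<in> Poly_Mapping.keys b))"

definition mu :: "nat \<Rightarrow> ('k::field) mpoly set \<Rightarrow> nat" where
  "mu m I = card (SOME S. minimal_binomial_gen_set m I S)"

definition bar :: "nat \<Rightarrow> ('k::field) mpoly set \<Rightarrow> nat" where
  "bar m I = (LEAST s. \<exists>S. finite S \<and> card S = s \<and> S \<subseteq> I \<and> (\<forall>b\<in>S. is_binomial m b) \<and>
                              radical m (ideal_gen m S) = radical m I)"

section \<open>Circuits and even closed walks\<close>

text \<open>Integer vectors u (indexed by edges 0..m-1) in ker_Z(A_G).\<close>
definition in_int_kernel :: "nat \<Rightarrow> nat \<Rightarrow> (nat \<Rightarrow> nat set) \<Rightarrow> (nat \<Rightarrow> int) \<Rightarrow> bool" where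
  "in_int_kernel n m E u \<longleftrightarrow> (\<forall>i. i \<ge> m \<longrightarrow> u i = 0) \<and>
     (\<forall>j<n. (\<Sum>i<m. (if j \<in> E i then u i else 0)) = 0)"

definition supp :: "(nat \<Rightarrow> int) \<Rightarrow> nat set" where
  "supp u = {i. u i \<noteq> 0}"

definition circuit_vector :: "nat \<Rightarrow> nat \<Rightarrow> (nat \<Rightarrow> nat set) \<Rightarrow> (nat \<Rightarrow> int) \<Rightarrow> bool" where
  "circuit_vector n m E u \<longleftrightarrow> in_int_kernel n m E u \<and> supp u \<noteq> {} \<and>
     \<not> (\<exists>u'. in_int_kernel n m E u' \<and> supp u' \<noteq> {} \<and> supp u' \<subset> supp u) \<and>
     Gcd (u ` {..<m}) = 1"

definition pos_part :: "nat \<Rightarrow> (nat \<Rightarrow> int) \<Rightarrow> (nat \<Rightarrow>\<^sub>0 nat)" where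
  "pos_part m u = (\<Sum>i<m. Poly_Mapping.single i (nat (u i)))"

definition neg_part :: "nat \<Rightarrow> (nat \<Rightarrow> int) \<Rightarrow> (nat \<Rightarrow>\<^sub>0 nat)" where
  "neg_part m u = (\<Sum>i<m. Poly_Mapping.single i (nat (- u i)))"

definition is_circuit :: "nat \<Rightarrow> nat \<Rightarrow> (nat \<Rightarrow> nat set) \<Rightarrow> ('k::field) mpoly \<Rightarrow> bool" where
  "is_circuit n m E b \<longleftrightarrow>
     (\<exists>u. circuit_vector n m E u \<and> b = xmono (pos_part m u) - xmono (neg_part m u))"

text \<open>An even closed walk: edge index list ws = (e_(i_1),...,e_(i_2s)) with s \<ge> 1 and a vertex
list vs = (w_0,...,w_2s), w_2s = w_0, with e_(i_k) = {w_(k-1), w_k}.\<close>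
definition even_closed_walk :: "nat \<Rightarrow> (nat \<Rightarrow> nat set) \<Rightarrow> nat list \<Rightarrow> bool" where
  "even_closed_walk m E ws \<longleftrightarrow> ws \<noteq> [] \<and> even (length ws) \<and> set ws \<subseteq> {..<m} \<and>
     (\<exists>vs. length vs = length ws + 1 \<and> vs ! 0 = vs ! length ws \<and>
           (\<forall>k<length ws. E (ws ! k) = {vs ! k, vs ! (k + 1)}))"

text \<open>Exponent vectors of B_w^(+) (odd positions 1,3,..) and B_w^(-) (even positions).\<close>
definition walk_plus :: "nat list \<Rightarrow> (nat \<Rightarrow>\<^sub>0 nat)" where
  "walk_plus ws = (\<Sum>k<length ws div 2. Poly_Mapping.single (ws ! (2 * k)) 1)"

definition walk_minus :: "nat list \<Rightarrow> (nat \<Rightarrow>\<^sub>0 nat)" where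
  "walk_minus ws = (\<Sum>k<length ws div 2. Poly_Mapping.single (ws ! (2 * k + 1)) 1)"

definition walk_binomial :: "nat list \<Rightarrow> ('k::field) mpoly" where
  "walk_binomial ws = xmono (walk_plus ws) - xmono (walk_minus ws)"

definition squarefree_mono :: "(nat \<Rightarrow>\<^sub>0 nat) \<Rightarrow> bool" where
  "squarefree_mono u \<longleftrightarrow> (\<forall>i. Poly_Mapping.lookup u i \<le> 1)"

end

theory Submission
  imports Defs
begin

text \<open>Two monomials lie in the same fibre if they have the same image, that is, the same vertex
degrees; two monomials of a fibre that share a variable are congruent modulo generators of smaller
degree. So the minimal binomial generators join the classes of the relation generated by sharing a
variable in those fibres that have more than one class.

If u and v lie in different classes, then u - v is an alternating closed walk. Exchanging part of
this walk against chords would connect u to v, so almost all chords and repetitions of vertices are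
excluded. Two repeated vertices would be cut vertices of the subgraph induced on the walk and
produce two induced odd cycles joined by an induced path, against condition (sharp). Hence the walk
is an even cycle, or two odd cycles with one common vertex; in particular all monomials of such a
fibre are squarefree and u - v is a circuit, so by hypothesis u or v is indispensable, which means
that it forms a class of its own. Moreover the fibre is determined by the vertices of the walk, and
it has two classes, or else consists of the three perfect matchings of a complete graph on four
vertices.

Let T be a set of binomials that generates the ideal up to radical, and let u be an indispensable
monomial. The point with coordinate 1 at the variables of u and 0 elsewhere shows that some binomial
in T has a monomial with the same variables as u. Two fibres with more than one class cannot share
such a binomial, as they have different vertex sets, and in the fibre with three classes one
binomial is not enough for all three. So T is at least as large as a minimal generating set.\<close>

section \<open>Monomials and vertex degrees\<close>

text \<open>Exclusions come from one move, \<open>switch\<close>: if parts u1 of u and v1 of v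
  satisfy deg u1 = deg v1 + deg f, then v1 + f + u2 shares u2 with u and v1 with v, so it connects
  them unless u2 = 0 or v1 = 0. Along an alternating walk the degree difference of an arc telescopes
  to its two ends, so one or two arcs, with f empty, a chord or two chords, are mostly enough; the
  rest is parity bookkeeping, which leaves exceptions such as length 4. Membership in an ideal is
  refuted with one family of linear functionals, \<open>lsum Q\<close>: the sum of the coefficients
  over a set Q of monomials that the generators respect. Fibres, classes and the monomials in given
  variables are choices of Q. Generation up to radical sees a monomial only through its support,
  hence a fibre only through its vertices. So fibres must be told apart by vertices alone, and the
  repeated vertex has to be recovered as a cut vertex. That u is alone in its class excludes that T
  meets only a proper divisor of u.\<close>

abbreviation "lkp \<equiv> Poly_Mapping.lookup"
abbreviation "sg \<equiv> Poly_Mapping.single"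
abbreviation "ks \<equiv> Poly_Mapping.keys"

type_synonym expo = "nat \<Rightarrow>\<^sub>0 nat"

lemma keys_add_nat: "ks (u + v) = ks u \<union> ks (v :: 'a \<Rightarrow>\<^sub>0 nat)"
  by (auto simp: in_keys_iff lookup_add)

lemma keys_sum_nat: "finite A \<Longrightarrow> ks (sum f A) = (\<Union>a\<in>A. ks (f a :: 'a \<Rightarrow>\<^sub>0 nat))"
  by (induction A rule: finite_induct) (auto simp: keys_add_nat)

lemma split_variable: "i \<in> ks u \<Longrightarrow> \<exists>u'. u = u' + sg i (Suc 0)"
  by (intro exI [of _ "u - sg i (Suc 0)"])
     (auto simp: poly_mapping_eq_iff fun_eq_iff lookup_add lookup_minus lookup_single when_def in_keys_iff)

lemma lookup_le_split: "(\<And>i. lkp w i \<le> lkp u i) \<Longrightarrow> \<exists>d. u = w + (d :: expo)"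
  by (intro exI [of _ "u - w"])
     (auto simp: poly_mapping_eq_iff fun_eq_iff lookup_add lookup_minus)

locale fin_graph =
  fixes n m :: nat and E :: "nat \<Rightarrow> nat set"
  assumes simple: "simple_graph n m E"
begin

lemma edge_subset: "i < m \<Longrightarrow> E i \<subseteq> {..<n}"
  and edge_card: "i < m \<Longrightarrow> card (E i) = 2"
  and edge_inj: "inj_on E {..<m}"
  using simple by (auto simp: simple_graph_def)

lemma edge_finite: "i < m \<Longrightarrow> finite (E i)"
  using edge_subset finite_subset by blast

definition mon :: "expo \<Rightarrow> bool" where "mon u \<longleftrightarrow> ks u \<subseteq> {..<m}"

text \<open>The exponent of t_y in the image of x^u. Summing over all \<open>i < m\<close> instead
  of the support makes additivity a termwise fact.\<close>

definition vdeg :: "expo \<Rightarrow> nat \<Rightarrow> nat" where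
  "vdeg u y = (\<Sum>i<m. if y \<in> E i then lkp u i else 0)"

definition sz :: "expo \<Rightarrow> nat" where "sz u = (\<Sum>i<m. lkp u i)"

lemma mon_add [simp]: "mon (u + v) \<longleftrightarrow> mon u \<and> mon v"
  by (auto simp: mon_def keys_add_nat)

lemma mon_zero [simp]: "mon 0"
  by (simp add: mon_def)

lemma mon_single [simp]: "mon (sg i (Suc c)) \<longleftrightarrow> i < m"
  by (simp add: mon_def)

lemma mon_sum: "finite A \<Longrightarrow> (\<And>a. a \<in> A \<Longrightarrow> mon (f a)) \<Longrightarrow> mon (sum f A)"
  by (induction A rule: finite_induct) auto

lemma vdeg_zero [simp]: "vdeg 0 y = 0"
  by (simp add: vdeg_def)

lemma vdeg_add: "vdeg (u + v) y = vdeg u y + vdeg v y"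
  unfolding vdeg_def sum.distrib [symmetric] by (rule sum.cong) (auto simp: lookup_add)

lemma vdeg_sum: "vdeg (sum f A) y = (\<Sum>a\<in>A. vdeg (f a) y)"
  by (induction A rule: infinite_finite_induct) (auto simp: vdeg_add)

lemma vdeg_single: "i < m \<Longrightarrow> vdeg (sg i c) y = (if y \<in> E i then c else 0)"
proof -
  assume i: "i < m"
  have "vdeg (sg i c) y = (\<Sum>k<m. if k = i then (if y \<in> E i then c else 0) else 0)"
    unfolding vdeg_def by (rule sum.cong) (auto simp: lookup_single when_def)
  then show ?thesis using i by simp
qed

lemma vdeg_out: "y \<ge> n \<Longrightarrow> vdeg u y = 0"
  unfolding vdeg_def using edge_subset by (intro sum.neutral) force

lemma sz_add: "sz (u + v) = sz u + sz v"
  by (simp add: sz_def lookup_add sum.distrib)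

lemma sz_eq_0: "mon u \<Longrightarrow> sz u = 0 \<longleftrightarrow> u = 0"
  by (auto simp: sz_def mon_def poly_mapping_eq_iff fun_eq_iff)
     (metis in_keys_iff lessThan_iff subsetD)

text \<open>Handshake identity. It makes \<open>sz\<close> constant on fibres, which the inductions
  on degree rely on.\<close>

lemma sum_vdeg: "(\<Sum>y<n. vdeg u y) = 2 * sz u"
proof -
  have "(\<Sum>y<n. vdeg u y) = (\<Sum>i<m. \<Sum>y<n. if y \<in> E i then lkp u i else 0)"
    unfolding vdeg_def by (rule sum.swap)
  also have "\<dots> = (\<Sum>i<m. 2 * lkp u i)"
  proof (rule sum.cong)
    fix i assume i: "i \<in> {..<m}"
    have "(\<Sum>y<n. if y \<in> E i then lkp u i else 0) = (\<Sum>y\<in>{..<n} \<inter> E i. lkp u i)"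
      by (rule sum.inter_restrict [symmetric]) simp
    also have "{..<n} \<inter> E i = E i" using i edge_subset by auto
    finally show "(\<Sum>y<n. if y \<in> E i then lkp u i else 0) = 2 * lkp u i"
      using i edge_card by simp
  qed simp
  finally show ?thesis by (simp add: sz_def sum_distrib_left)
qed

lemma vdeg_pos_iff: "vdeg u y > 0 \<longleftrightarrow> (\<exists>i<m. y \<in> E i \<and> i \<in> ks u)"
proof -
  have "vdeg u y = 0 \<longleftrightarrow> (\<forall>i<m. y \<in> E i \<longrightarrow> lkp u i = 0)"
    by (auto simp: vdeg_def)
  then show ?thesis by (auto simp: in_keys_iff)
qed

lemma lkp_le_vdeg: "i < m \<Longrightarrow> y \<in> E i \<Longrightarrow> lkp u i \<le> vdeg u y"
  unfolding vdeg_def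
  using member_le_sum [of i "{..<m}" "\<lambda>i. if y \<in> E i then lkp u i else 0"] by auto

lemma lookup_edge_image: "mon u \<Longrightarrow> lkp (edge_image E u) y = vdeg u y"
proof -
  assume u: "mon u"
  have "lkp (edge_image E u) y = (\<Sum>i\<in>ks u. \<Sum>j\<in>E i. if j = y then lkp u i else 0)"
    by (simp add: edge_image_def lookup_sum lookup_single when_def)
  also have "\<dots> = (\<Sum>i\<in>ks u. if y \<in> E i then lkp u i else 0)"
    using u by (intro sum.cong) (auto simp: mon_def edge_finite subset_iff)
  also have "\<dots> = vdeg u y"
    unfolding vdeg_def using u
    by (intro sum.mono_neutral_left) (auto simp: mon_def in_keys_iff)
  finally show ?thesis .
qed

section \<open>Fibres of the monomial map and their classes\<close>

definition fib :: "expo \<Rightarrow> expo \<Rightarrow> bool" where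
  "fib u v \<longleftrightarrow> mon u \<and> mon v \<and> vdeg u = vdeg v"

lemma fib_edge_image: "mon u \<Longrightarrow> mon v \<Longrightarrow> fib u v \<longleftrightarrow> edge_image E u = edge_image E v"
  by (auto simp: fib_def fun_eq_iff poly_mapping_eq_iff lookup_edge_image)

lemma fib_refl: "mon u \<Longrightarrow> fib u u"
  and fib_sym: "fib u v \<Longrightarrow> fib v u"
  and fib_trans: "fib u v \<Longrightarrow> fib v w \<Longrightarrow> fib u w"
  by (auto simp: fib_def)

lemma fib_add: "mon g \<Longrightarrow> fib u v \<Longrightarrow> fib (u + g) (v + g)"
  by (auto simp: fib_def vdeg_add fun_eq_iff)

lemma fib_cancel: "fib (u + g) (v + g) \<Longrightarrow> fib u v"
  by (auto simp: fib_def vdeg_add fun_eq_iff)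

lemma fib_sz: "fib u v \<Longrightarrow> sz u = sz v"
  using sum_vdeg [of u] sum_vdeg [of v] by (simp add: fib_def)

definition step :: "expo \<Rightarrow> expo \<Rightarrow> bool" where
  "step u v \<longleftrightarrow> fib u v \<and> ks u \<inter> ks v \<noteq> {}"

definition conn :: "expo \<Rightarrow> expo \<Rightarrow> bool" where "conn = step\<^sup>*\<^sup>*"

lemma step_sym: "step u v \<Longrightarrow> step v u"
  by (auto simp: step_def fib_sym)

lemma conn_refl [simp]: "conn u u"
  by (simp add: conn_def)

lemma conn_trans: "conn u v \<Longrightarrow> conn v w \<Longrightarrow> conn u w"
  by (simp add: conn_def)

lemma conn_sym: "conn u v \<Longrightarrow> conn v u"
  unfolding conn_def using step_sym by (metis sympD sympI symp_rtranclp)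

lemma step_conn: "step u v \<Longrightarrow> conn u v"
  by (auto simp: conn_def)

lemma conn_fib: "conn u v \<Longrightarrow> mon u \<Longrightarrow> fib u v"
  unfolding conn_def
  by (induction rule: rtranclp_induct) (auto simp: fib_refl step_def intro: fib_trans)

lemma keys_ne: "u \<noteq> 0 \<Longrightarrow> \<exists>i. i \<in> ks u"
  by (metis ex_in_conv keys_eq_empty)

lemma step_common:
  assumes "fib (g + a) (g + b)" "g \<noteq> 0"
  shows "step (g + a) (g + b)"
  using assms keys_ne [of g] by (auto simp: step_def keys_add_nat)

lemma switch1:
  assumes "fib (u1 + u2) v" "mon z1" "vdeg u1 = vdeg z1" "u2 \<noteq> 0"
  shows "conn (u1 + u2) (z1 + u2)" "fib (u1 + u2) (z1 + u2)"
proof -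
  show "fib (u1 + u2) (z1 + u2)"
    using assms by (auto simp: fib_def vdeg_add fun_eq_iff)
  then show "conn (u1 + u2) (z1 + u2)"
    using step_common [of u2 u1 z1] assms(4) by (simp add: add.commute step_conn)
qed

text \<open>The intermediate monomial v1 + f + u2 has u2 in common with u1 + u2 and v1 in common
  with v1 + v2.\<close>

lemma switch:
  assumes "fib (u1 + u2) (v1 + v2)" "\<not> conn (u1 + u2) (v1 + v2)"
    and "mon f" "vdeg u1 = vdeg (v1 + f)"
  shows "u2 = 0 \<or> v1 = 0"
proof (rule ccontr)
  assume ne: "\<not> (u2 = 0 \<or> v1 = 0)"
  have mv: "mon v1" "mon v2" using assms(1) by (auto simp: fib_def)
  have 1: "conn (u1 + u2) ((v1 + f) + u2)" and 2: "fib (u1 + u2) ((v1 + f) + u2)"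
    using switch1 [OF assms(1), of "v1 + f"] assms ne mv by auto
  have "fib (v1 + (f + u2)) (v1 + v2)"
    using 2 assms(1) by (metis fib_sym fib_trans add.assoc)
  then have "conn (v1 + (f + u2)) (v1 + v2)"
    using step_common ne step_conn by blast
  then show False using 1 assms(2) conn_trans by (metis add.assoc)
qed

text \<open>Marks the fibres that need generators; by \<open>crit_fib\<close> it does not depend on
  the chosen monomial.\<close>

definition crit :: "expo \<Rightarrow> bool" where
  "crit u \<longleftrightarrow> (\<exists>v. fib u v \<and> \<not> conn u v)"

lemma critI: "fib u v \<Longrightarrow> \<not> conn u v \<Longrightarrow> crit u"
  and critI': "fib u v \<Longrightarrow> \<not> conn u v \<Longrightarrow> crit v"
  by (auto simp: crit_def intro: fib_sym conn_sym)

lemma crit_fib: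
  assumes "crit u" "fib u v"
  shows "crit v"
proof -
  obtain w where w: "fib u w" "\<not> conn u w" using assms by (auto simp: crit_def)
  show ?thesis
  proof (cases "conn u v")
    case True
    then have "\<not> conn v w" using w conn_trans by blast
    then show ?thesis using w assms fib_sym fib_trans critI by blast
  next
    case False
    then show ?thesis using assms critI' by blast
  qed
qed

definition single :: "expo \<Rightarrow> bool" where
  "single u \<longleftrightarrow> (\<forall>v. step u v \<longrightarrow> v = u)"

lemma single_conn: "single u \<Longrightarrow> conn u v \<Longrightarrow> v = u"
  unfolding conn_def by (rotate_tac, induction rule: rtranclp_induct) (auto simp: single_def)

text \<open>Determined by the fibre of u and also by the support of u: the link between generators
  up to radical, known by supports, and fibres.\<close>

definition VS :: "expo \<Rightarrow> nat set" where "VS u = {y. vdeg u y > 0}"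

lemma VS_fib: "fib u v \<Longrightarrow> VS u = VS v"
  by (simp add: VS_def fib_def)

lemma VS_keys: "ks u = ks v \<Longrightarrow> VS u = VS v"
  by (auto simp: VS_def vdeg_pos_iff)

end

section \<open>Ideals generated by binomials\<close>

lemma polyring_zero [simp]: "0 \<in> polyring m"
  by (simp add: polyring_def)

lemma polyring_one [simp]: "1 \<in> polyring m"
  by (simp add: polyring_def)

lemma polyring_add: "f \<in> polyring m \<Longrightarrow> g \<in> polyring m \<Longrightarrow> f + g \<in> polyring m"
  using keys_add [of f g] by (fastforce simp: polyring_def)

lemma polyring_uminus: "f \<in> polyring m \<Longrightarrow> - f \<in> polyring m"
  by (auto simp: polyring_def in_keys_iff)

lemma polyring_diff: "f \<in> polyring m \<Longrightarrow> g \<in> polyring m \<Longrightarrow> f - g \<in> polyring m"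
  using polyring_add [of f m "- g"] polyring_uminus [of g m] by simp

lemma polyring_mult: "f \<in> polyring m \<Longrightarrow> g \<in> polyring m \<Longrightarrow> f * g \<in> polyring m"
  using keys_mult [of f g] by (fastforce simp: polyring_def keys_add_nat)

lemma polyring_single: "ks u \<subseteq> {..<m} \<Longrightarrow> sg u c \<in> polyring m"
  by (simp add: polyring_def)

lemma xmono_mult: "xmono u * xmono v = (xmono (u + v) :: 'k::field mpoly)"
  by (simp add: xmono_def mult_single)

lemma ideal_gen_zero: "0 \<in> ideal_gen m S"
  unfolding ideal_gen_def by (auto intro!: exI [of _ "{}"])

lemma ideal_gen_base: "s \<in> S \<Longrightarrow> s \<in> ideal_gen m S"
  unfolding ideal_gen_def by (auto intro!: exI [of _ "{s}"] exI [of _ "\<lambda>_. 1"])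

lemma ideal_gen_mono: "S \<subseteq> S' \<Longrightarrow> ideal_gen m S \<subseteq> ideal_gen m S'"
  unfolding ideal_gen_def by blast

lemma ideal_gen_mult:
  assumes "p \<in> polyring m" "f \<in> ideal_gen m S"
  shows "p * f \<in> ideal_gen m S"
proof -
  obtain F c where F: "f = (\<Sum>s\<in>F. c s * s)" "finite F" "F \<subseteq> S" "\<forall>s\<in>F. c s \<in> polyring m"
    using assms(2) unfolding ideal_gen_def by blast
  have "p * f = (\<Sum>s\<in>F. (p * c s) * s)"
    by (simp add: F(1) sum_distrib_left mult.assoc)
  moreover have "\<forall>s\<in>F. p * c s \<in> polyring m"
    using F assms(1) polyring_mult by blast
  ultimately show ?thesis unfolding ideal_gen_def using F(2,3)
    by (intro CollectI exI [of _ F] exI [of _ "\<lambda>s. p * c s"]) auto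
qed

lemma ideal_gen_add:
  assumes "f \<in> ideal_gen m S" "g \<in> ideal_gen m S"
  shows "f + g \<in> ideal_gen m S"
proof -
  obtain F c where F: "f = (\<Sum>s\<in>F. c s * s)" "finite F" "F \<subseteq> S" "\<forall>s\<in>F. c s \<in> polyring m"
    using assms(1) unfolding ideal_gen_def by blast
  obtain G d where G: "g = (\<Sum>s\<in>G. d s * s)" "finite G" "G \<subseteq> S" "\<forall>s\<in>G. d s \<in> polyring m"
    using assms(2) unfolding ideal_gen_def by blast
  define e where "e s = (if s \<in> F then c s else 0) + (if s \<in> G then d s else 0)" for s
  have "f = (\<Sum>s\<in>F \<union> G. (if s \<in> F then c s else 0) * s)"
    unfolding F(1) using F G by (intro sum.mono_neutral_cong_left) auto
  moreover have "g = (\<Sum>s\<in>F \<union> G. (if s \<in> G then d s else 0) * s)"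
    unfolding G(1) using F G by (intro sum.mono_neutral_cong_left) auto
  ultimately have "f + g = (\<Sum>s\<in>F \<union> G. e s * s)"
    by (simp add: e_def distrib_right sum.distrib)
  moreover have "\<forall>s\<in>F \<union> G. e s \<in> polyring m"
    using F(4) G(4) by (auto simp: e_def polyring_add)
  ultimately show ?thesis unfolding ideal_gen_def using F(2,3) G(2,3)
    by (intro CollectI exI [of _ "F \<union> G"] exI [of _ e]) auto
qed

lemma ideal_gen_uminus: "f \<in> ideal_gen m S \<Longrightarrow> - f \<in> ideal_gen m S"
  using ideal_gen_mult [of "- 1" m f S] polyring_uminus [of 1 m] by simp

lemma ideal_gen_trans:
  "x - y \<in> ideal_gen m S \<Longrightarrow> y - z \<in> ideal_gen m S \<Longrightarrow> x - z \<in> ideal_gen m S"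
  using ideal_gen_add [of "x - y" m S "y - z"] by simp

lemma ideal_gen_sym: "x - y \<in> ideal_gen m S \<Longrightarrow> y - x \<in> ideal_gen m S"
  using ideal_gen_uminus [of "x - y" m S] by simp

lemma ideal_gen_induct [consumes 1, case_names zero add mult]:
  assumes "f \<in> ideal_gen m S" "P 0" "\<And>f g. P f \<Longrightarrow> P g \<Longrightarrow> P (f + g)"
    and "\<And>c s. s \<in> S \<Longrightarrow> c \<in> polyring m \<Longrightarrow> P (c * s)"
  shows "P f"
proof -
  obtain F c where F: "f = (\<Sum>s\<in>F. c s * s)" "finite F" "F \<subseteq> S" "\<forall>s\<in>F. c s \<in> polyring m"
    using assms(1) unfolding ideal_gen_def by blast
  show ?thesis unfolding F(1) using F(2,3,4)
    by (induction F rule: finite_induct) (auto intro: assms)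
qed

lemma ideal_gen_least: "S \<subseteq> ideal_gen m S' \<Longrightarrow> ideal_gen m S \<subseteq> ideal_gen m S'"
proof
  fix f assume S: "S \<subseteq> ideal_gen m S'" and "f \<in> ideal_gen m S"
  from this(2) show "f \<in> ideal_gen m S'"
    by (induction rule: ideal_gen_induct)
       (use S in \<open>auto intro: ideal_gen_zero ideal_gen_add ideal_gen_mult\<close>)
qed

text \<open>For Q a fibre this is a coefficient of the toric image; for Q the monomials in a set of
  variables it is evaluation at the 0/1 point of that set.\<close>

definition lsum :: "expo set \<Rightarrow> 'k::field mpoly \<Rightarrow> 'k" where
  "lsum Q f = (\<Sum>u\<in>ks f. if u \<in> Q then lkp f u else 0)"

lemma lsum_superset:
  "finite A \<Longrightarrow> ks f \<subseteq> A \<Longrightarrow> lsum Q f = (\<Sum>u\<in>A. if u \<in> Q then lkp f u else 0)"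
  unfolding lsum_def by (intro sum.mono_neutral_left) (auto simp: in_keys_iff)

lemma lsum_zero [simp]: "lsum Q 0 = 0"
  by (simp add: lsum_def)

lemma lsum_add: "lsum Q (f + g) = lsum Q f + lsum Q g"
proof -
  let ?A = "ks f \<union> ks g"
  have "lsum Q (f + g) = (\<Sum>u\<in>?A. (if u \<in> Q then lkp f u else 0) + (if u \<in> Q then lkp g u else 0))"
    using keys_add [of f g] by (subst lsum_superset [of ?A]) (auto intro!: sum.cong simp: lookup_add)
  then show ?thesis
    by (simp add: sum.distrib lsum_superset [of ?A])
qed

lemma lsum_uminus: "lsum Q (- f) = - lsum Q f"
  using lsum_add [of Q f "- f"] by (simp add: minus_unique)

lemma lsum_diff: "lsum Q (f - g) = lsum Q f - lsum Q g"
  using lsum_add [of Q f "- g"] by (simp add: lsum_uminus)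

lemma lsum_sum: "lsum Q (sum f A) = (\<Sum>a\<in>A. lsum Q (f a))"
  by (induction A rule: infinite_finite_induct) (auto simp: lsum_add)

lemma lsum_single: "lsum Q (sg u c) = (if u \<in> Q then c else 0)"
  by (simp add: lsum_def)

lemma lsum_xmono [simp]: "lsum Q (xmono u) = (if u \<in> Q then 1 else 0)"
  by (simp add: xmono_def lsum_single)

lemma lsum_cong: "(\<And>u. u \<in> ks f \<Longrightarrow> u \<in> Q \<longleftrightarrow> u \<in> Q') \<Longrightarrow> lsum Q f = lsum Q' f"
  unfolding lsum_def by (rule sum.cong) auto

lemma sum_monomials: "(\<Sum>u\<in>ks f. sg u (lkp f u)) = f"
proof (rule poly_mapping_eqI)
  fix k
  have "(\<Sum>u\<in>ks f. lkp f u when u = k) = (\<Sum>u\<in>ks f. if u = k then lkp f u else 0)"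
    by (rule sum.cong) (auto simp: when_def)
  then show "lkp (\<Sum>u\<in>ks f. sg u (lkp f u)) k = lkp f k"
    by (simp add: lookup_sum lookup_single in_keys_iff)
qed

lemma lsum_xmono_mult: "lsum Q (xmono a * f) = lsum {g. a + g \<in> Q} f"
proof -
  have "xmono a * f = (\<Sum>u\<in>ks f. sg (a + u) (lkp f u))"
    by (subst (1) sum_monomials [symmetric]) (simp add: sum_distrib_left xmono_def mult_single)
  then have "lsum Q (xmono a * f) = (\<Sum>u\<in>ks f. if a + u \<in> Q then lkp f u else 0)"
    by (simp add: lsum_sum lsum_single)
  then show ?thesis by (simp add: lsum_def)
qed

text \<open>In p * (x^a - x^c) the two terms sum the coefficients of p over the shifts of Q by a and
  by c, which agree on monomials of the ring. Used contrapositively to show non-membership.\<close>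

lemma lsum_ideal:
  assumes "f \<in> ideal_gen m S"
    and "\<And>s. s \<in> S \<Longrightarrow> \<exists>a c. s = xmono a - xmono c \<and> (\<forall>g. ks g \<subseteq> {..<m} \<longrightarrow> (a + g \<in> Q \<longleftrightarrow> c + g \<in> Q))"
  shows "lsum Q f = 0"
  using assms(1)
proof (induction rule: ideal_gen_induct)
  case (mult p s)
  obtain a c where s: "s = xmono a - xmono c" "\<forall>g. ks g \<subseteq> {..<m} \<longrightarrow> (a + g \<in> Q \<longleftrightarrow> c + g \<in> Q)"
    using assms(2) [OF mult(1)] by blast
  have "p * s = xmono a * p - xmono c * p"
    by (simp add: s(1) right_diff_distrib mult.commute)
  moreover have "lsum {g. a + g \<in> Q} p = lsum {g. c + g \<in> Q} p"
    using s(2) mult(2) by (intro lsum_cong) (auto simp: polyring_def)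
  ultimately show ?case by (simp add: lsum_diff lsum_xmono_mult)
qed (auto simp: lsum_add)

lemma keys_xmono_diff: "u \<noteq> v \<Longrightarrow> ks (xmono u - xmono v :: 'k::field mpoly) = {u, v}"
  by (auto simp: in_keys_iff xmono_def lookup_minus lookup_single when_def split: if_splits)

lemma keys_xmono_diff_subset: "ks (xmono u - xmono v :: 'k::field mpoly) \<subseteq> {u, v}"
  by (cases "u = v") (auto simp: keys_xmono_diff)

section \<open>The toric ideal in terms of fibres\<close>

context fin_graph
begin

lemma mon_polyring: "mon u \<Longrightarrow> xmono u \<in> polyring m"
  by (simp add: mon_def xmono_def polyring_single)

lemma mon_keys: "f \<in> polyring m \<Longrightarrow> u \<in> ks f \<Longrightarrow> mon u"
  by (auto simp: polyring_def mon_def)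

text \<open>The coefficient of the toric image at t^d is \<open>lsum\<close> over the fibre of d;
  degrees d that no monomial of f attains contribute 0.\<close>

lemma toric_ideal_iff:
  "f \<in> toric_ideal m E \<longleftrightarrow> f \<in> polyring m \<and> (\<forall>w. mon w \<longrightarrow> lsum {u. fib w u} f = 0)"
proof -
  have look: "lkp (toric_map E f) d = lsum {u. edge_image E u = d} f" for d
    by (auto simp: toric_map_def lookup_sum lookup_single lsum_def when_def intro!: sum.cong)
  have eq: "lsum {u. edge_image E u = edge_image E w} f = lsum {u. fib w u} f"
    if "f \<in> polyring m" "mon w" for w
    using that by (intro lsum_cong) (auto simp: fib_edge_image dest: mon_keys)
  show ?thesis
  proof safe
    assume f: "f \<in> toric_ideal m E"
    then show "f \<in> polyring m" by (simp add: toric_ideal_def)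
    fix w assume "mon w"
    then show "lsum {u. fib w u} f = 0"
      using f eq look [of "edge_image E w"] by (simp add: toric_ideal_def)
  next
    assume f: "f \<in> polyring m" and z: "\<forall>w. mon w \<longrightarrow> lsum {u. fib w u} f = 0"
    have "lkp (toric_map E f) d = 0" for d
    proof (cases "\<exists>w\<in>ks f. edge_image E w = d")
      case True
      then obtain w where "w \<in> ks f" "d = edge_image E w" by blast
      then show ?thesis using z eq [OF f] mon_keys [OF f] look by simp
    next
      case False
      then show ?thesis unfolding look by (auto simp: lsum_def intro!: sum.neutral)
    qed
    then have "toric_map E f = 0" by (intro poly_mapping_eqI) simp
    then show "f \<in> toric_ideal m E" using f by (simp add: toric_ideal_def)
  qed
qed

lemma xmono_diff_toric: "fib u v \<Longrightarrow> xmono u - xmono v \<in> toric_ideal m E"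
  by (auto simp: toric_ideal_iff lsum_diff fib_def mon_polyring intro: polyring_diff)

lemma toric_xmono_diff:
  "xmono u - xmono v \<in> (toric_ideal m E :: 'k::field mpoly set) \<Longrightarrow> mon u \<Longrightarrow> mon v \<Longrightarrow> fib u v"
proof -
  assume a: "xmono u - xmono v \<in> (toric_ideal m E :: 'k mpoly set)" and m: "mon u" "mon v"
  then have "lsum {w. fib u w} (xmono u - xmono v :: 'k mpoly) = 0"
    by (simp add: toric_ideal_iff)
  then show "fib u v" using fib_refl [OF m(1)] by (auto simp: lsum_diff split: if_splits)
qed

lemma toric_binomial:
  assumes "s \<in> (toric_ideal m E :: 'k::field mpoly set)" "is_binomial m s"
  shows "\<exists>u v. s = xmono u - xmono v \<and> fib u v"
  using assms toric_xmono_diff unfolding is_binomial_def mon_def by blast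

text \<open>Subtracting a multiple of a binomial cancels one term of f without adding new ones, so
  the number of terms decreases.\<close>

lemma toric_subset:
  assumes "\<And>u v. fib u v \<Longrightarrow> xmono u - xmono v \<in> (ideal_gen m S :: 'k::field mpoly set)"
  shows "toric_ideal m E \<subseteq> ideal_gen m S"
proof
  fix f :: "'k mpoly" assume "f \<in> toric_ideal m E"
  then show "f \<in> ideal_gen m S"
  proof (induction "card (ks f)" arbitrary: f rule: less_induct)
    case less
    show ?case
    proof (cases "ks f = {}")
      case True
      then show ?thesis by (simp add: ideal_gen_zero)
    next
      case False
      then obtain u where u: "u \<in> ks f" by blast
      have fp: "f \<in> polyring m" using less.prems by (simp add: toric_ideal_iff)
      have mu: "mon u" using mon_keys [OF fp u] .
      \<comment> \<open>The coefficients over the fibre of u sum to 0, so u is not the only term of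
        f there.\<close>
      have "\<exists>v\<in>ks f. v \<noteq> u \<and> fib u v"
      proof (rule ccontr)
        assume no: "\<not> ?thesis"
        have "lsum {w. fib u w} f = (\<Sum>w\<in>ks f. if w = u then lkp f u else 0)"
          unfolding lsum_def using no fib_refl [OF mu] by (intro sum.cong) auto
        also have "\<dots> = lkp f u" using u by simp
        finally show False using less.prems mu u by (simp add: toric_ideal_iff in_keys_iff)
      qed
      then obtain v where v: "v \<in> ks f" "v \<noteq> u" "fib u v" by blast
      define c where "c = lkp f u"
      define h where "h = sg 0 c * (xmono u - xmono v)"
      have look: "lkp h w = (if w = u then c else if w = v then - c else 0)" for w
        using v(2) by (auto simp: h_def xmono_def right_diff_distrib mult_single lookup_minus lookup_single)
      have sub: "ks (f - h) \<subseteq> ks f - {u}"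
        using v(1) by (auto simp: in_keys_iff lookup_minus look c_def split: if_splits)
      have "card (ks (f - h)) < card (ks f)"
        using sub u by (intro psubset_card_mono) auto
      moreover have cp: "sg 0 c \<in> polyring m" by (rule polyring_single) simp
      have "f - h \<in> polyring m"
        using fp sub by (auto simp: polyring_def)
      moreover have "lsum {x. fib w x} h = 0" for w
      proof -
        have "h = xmono u * sg 0 c - xmono v * sg 0 c" by (simp add: h_def algebra_simps)
        then show ?thesis
          using v(3) by (auto simp: lsum_diff lsum_xmono_mult lsum_single dest: fib_trans fib_sym)
      qed
      ultimately have "f - h \<in> ideal_gen m S"
        using less.prems by (intro less.hyps) (auto simp: toric_ideal_iff lsum_diff)
      moreover have "h \<in> ideal_gen m S"
        unfolding h_def using assms [OF v(3)] cp ideal_gen_mult by blast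
      ultimately show ?thesis using ideal_gen_add by fastforce
    qed
  qed
qed

lemma ideal_subset_toric:
  assumes "\<And>s. s \<in> S \<Longrightarrow> s \<in> (toric_ideal m E :: 'k::field mpoly set) \<and> is_binomial m s"
  shows "ideal_gen m S \<subseteq> toric_ideal m E"
proof
  fix f assume f: "f \<in> ideal_gen m S"
  have "f \<in> polyring m" using f
    by (induction rule: ideal_gen_induct)
       (use assms in \<open>auto simp: toric_ideal_def intro: polyring_add polyring_mult\<close>)
  moreover have "lsum {u. fib w u} f = 0" for w
  proof (rule lsum_ideal [OF f])
    fix s assume "s \<in> S"
    then obtain a c where "s = xmono a - xmono c" "fib a c"
      using assms toric_binomial by blast
    moreover have "fib w (a + g) \<longleftrightarrow> fib w (c + g)" if "fib a c" "ks g \<subseteq> {..<m}" for a c g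
      using fib_add [of g a c] that fib_sym fib_trans unfolding mon_def by blast
    ultimately show "\<exists>a c. s = xmono a - xmono c \<and>
        (\<forall>g. ks g \<subseteq> {..<m} \<longrightarrow> (a + g \<in> {u. fib w u} \<longleftrightarrow> c + g \<in> {u. fib w u}))"
      by blast
  qed
  ultimately show "f \<in> toric_ideal m E" by (simp add: toric_ideal_iff)
qed

text \<open>Cancelling the shared variable leaves a binomial of smaller degree.\<close>

lemma step_ideal:
  assumes "\<And>a b. fib a b \<Longrightarrow> sz a < N \<Longrightarrow> xmono a - xmono b \<in> (ideal_gen m S :: 'k::field mpoly set)"
    and "step u v" "sz u \<le> N"
  shows "xmono u - xmono v \<in> (ideal_gen m S :: 'k mpoly set)"
proof -
  obtain i where i: "i \<in> ks u" "i \<in> ks v" and f: "fib u v"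
    using assms(2) by (auto simp: step_def)
  let ?g = "sg i (Suc 0)"
  have im: "i < m" using f i by (auto simp: fib_def mon_def)
  obtain u' v' where uv: "u = u' + ?g" "v = v' + ?g" using split_variable [OF i(1)] split_variable [OF i(2)] by metis
  have f': "fib u' v'" using f uv fib_cancel by blast
  have "sz ?g = Suc 0"
    using im by (simp add: sz_def lookup_single when_def sum.delta)
  then have "sz u' < N" using assms(3) uv by (simp add: sz_add)
  then have "xmono u' - xmono v' \<in> (ideal_gen m S :: 'k mpoly set)"
    using assms(1) f' by blast
  then have "xmono ?g * (xmono u' - xmono v') \<in> (ideal_gen m S :: 'k mpoly set)"
    using im by (intro ideal_gen_mult mon_polyring) simp_all
  then show ?thesis
    by (simp add: uv right_diff_distrib xmono_mult add.commute)
qed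

lemma conn_ideal:
  assumes "\<And>a b. fib a b \<Longrightarrow> sz a < N \<Longrightarrow> xmono a - xmono b \<in> (ideal_gen m S :: 'k::field mpoly set)"
    and "conn u v" "sz u \<le> N"
  shows "xmono u - xmono v \<in> (ideal_gen m S :: 'k mpoly set)"
  using assms(2) unfolding conn_def
proof (induction rule: rtranclp_induct)
  case base
  then show ?case by (simp add: ideal_gen_zero)
next
  case (step y z)
  have "sz y = sz u \<or> u = y" using step(1)
    by (induction rule: rtranclp_induct) (auto simp: step_def dest: fib_sz)
  then have "xmono y - xmono z \<in> (ideal_gen m S :: 'k mpoly set)"
    using step_ideal [OF assms(1) step(2)] assms(3) by auto
  then show ?case using step.IH ideal_gen_trans by blast
qed

text \<open>Moves by \<open>conn\<close> are free, since they follow from binomials of smaller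
  degree; only the joining of different classes must come from S.\<close>

definition link :: "'k::field mpoly set \<Rightarrow> expo \<Rightarrow> expo \<Rightarrow> bool" where
  "link S a b \<longleftrightarrow> conn a b \<or> xmono a - xmono b \<in> S \<or> xmono b - xmono a \<in> S"

lemma link_sym: "link S a b \<Longrightarrow> link S b a"
  by (auto simp: link_def conn_sym)

lemma link_rtranclp_sym: "(link S)\<^sup>*\<^sup>* a b \<Longrightarrow> (link S)\<^sup>*\<^sup>* b a"
  by (metis link_sym sympD sympI symp_rtranclp)

text \<open>Induction on degree: below the current degree everything is already in the ideal, which
  by \<open>conn_ideal\<close> pays for the \<open>conn\<close> moves of a linking chain.\<close>

lemma gen_criterion:
  assumes S: "\<And>s. s \<in> S \<Longrightarrow> \<exists>u v. s = xmono u - xmono v \<and> fib u v"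
    and con: "\<And>u v. fib u v \<Longrightarrow> (link (S :: 'k::field mpoly set))\<^sup>*\<^sup>* u v"
  shows "binomial_gen_set m (toric_ideal m E) S"
proof -
  have bin: "s \<in> toric_ideal m E \<and> is_binomial m s" if "s \<in> S" for s
    using S [OF that] xmono_diff_toric by (auto simp: is_binomial_def fib_def mon_def)
  have gen: "xmono u - xmono v \<in> ideal_gen m S" if "fib u v" for u v
    using that
  proof (induction "sz u" arbitrary: u v rule: less_induct)
    case less
    have low: "xmono a - xmono b \<in> ideal_gen m S" if "fib a b" "sz a < sz u" for a b
      using less.hyps that by blast
    have "xmono u - xmono v \<in> ideal_gen m S \<and> fib u v"
      using con [OF less.prems]
    proof (induction rule: rtranclp_induct)
      case base
      then show ?case using less.prems by (auto simp: ideal_gen_zero fib_def)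
    next
      case (step y z)
      have y: "fib u y" "xmono u - xmono y \<in> ideal_gen m S" using step.IH by auto
      have my: "mon y" "sz y = sz u" using y(1) fib_sz [OF y(1)] by (auto simp: fib_def)
      have "xmono y - xmono z \<in> ideal_gen m S \<and> (z = y \<or> fib y z)"
      proof (cases "conn y z")
        case True
        then show ?thesis using conn_ideal [OF low True] my conn_fib by auto
      next
        case False
        then have yz: "xmono y - xmono z \<in> S \<or> xmono z - xmono y \<in> S" "y \<noteq> z"
          using step(2) by (auto simp: link_def)
        then obtain p q where pq: "ks (xmono p - xmono q :: 'k mpoly) = {y, z}" "fib p q"
          using S keys_xmono_diff [of y z, where 'k = 'k] keys_xmono_diff [of z y, where 'k = 'k]
          by (metis insert_commute)
        then have "{y, z} \<subseteq> {p, q}" using keys_xmono_diff_subset by metis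
        then have "fib y z" using pq(2) yz(2) fib_sym by auto
        then show ?thesis using yz ideal_gen_base ideal_gen_sym by blast
      qed
      then show ?case using y ideal_gen_trans fib_trans by blast
    qed
    then show ?case by blast
  qed
  show ?thesis unfolding binomial_gen_set_def
    using bin ideal_subset_toric [of S] toric_subset [OF gen] by blast
qed

section \<open>Minimal generating sets and generation up to radical\<close>

text \<open>A generating system that is finite once critical monomials are squarefree; finite
  minimal systems are then obtained without appeal to Noetherianity.\<close>

definition all_crit_binomials :: "'k::field mpoly set" where
  "all_crit_binomials = {xmono u - xmono v | u v. fib u v \<and> crit u}"

lemma all_crit_gen: "binomial_gen_set m (toric_ideal m E) (all_crit_binomials :: 'k::field mpoly set)"
proof (rule gen_criterion)
  fix s :: "'k mpoly" assume "s \<in> all_crit_binomials"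
  then show "\<exists>u v. s = xmono u - xmono v \<and> fib u v" by (auto simp: all_crit_binomials_def)
next
  fix u v assume "fib u v"
  then have "link (all_crit_binomials :: 'k mpoly set) u v"
    by (auto simp: link_def all_crit_binomials_def crit_def)
  then show "(link (all_crit_binomials :: 'k mpoly set))\<^sup>*\<^sup>* u v"
    by blast
qed

lemma finite_crit:
  assumes "\<And>w i. crit w \<Longrightarrow> lkp w i \<le> 1"
  shows "finite (Collect crit)"
proof (rule finite_imageD)
  have "ks ` Collect crit \<subseteq> Pow {..<m}" by (auto simp: crit_def fib_def mon_def)
  then show "finite (ks ` Collect crit)" using finite_subset by blast
  show "inj_on ks (Collect crit)"
  proof (rule inj_onI, rule poly_mapping_eqI)
    fix u v i assume c: "u \<in> Collect crit" "v \<in> Collect crit" and k: "ks u = ks v"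
    have "lkp u i \<le> 1" "lkp v i \<le> 1" using assms c by auto
    moreover have "lkp u i = 0 \<longleftrightarrow> lkp v i = 0" using k by (metis in_keys_iff)
    ultimately show "lkp u i = lkp v i" by linarith
  qed
qed

lemma finite_all_crit:
  assumes "finite (Collect crit)"
  shows "finite (all_crit_binomials :: 'k::field mpoly set)"
proof (rule finite_subset)
  show "(all_crit_binomials :: 'k mpoly set) \<subseteq> (\<lambda>(u, v). xmono u - xmono v) ` (Collect crit \<times> Collect crit)"
  proof
    fix s :: "'k mpoly" assume "s \<in> all_crit_binomials"
    then obtain u v where "s = xmono u - xmono v" "crit u" "crit v"
      using crit_fib by (auto simp: all_crit_binomials_def)
    then show "s \<in> (\<lambda>(u, v). xmono u - xmono v) ` (Collect crit \<times> Collect crit)"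
      by (intro image_eqI [of _ _ "(u, v)"]) auto
  qed
qed (use assms in auto)

lemma minimal_subset:
  assumes "binomial_gen_set m I S0" "finite S0"
  shows "\<exists>S\<subseteq>S0. minimal_binomial_gen_set m I S"
proof -
  obtain S where S: "S \<subseteq> S0" "binomial_gen_set m I S"
    and min: "\<And>S'. S' \<subseteq> S0 \<Longrightarrow> binomial_gen_set m I S' \<Longrightarrow> card S \<le> card S'"
    using ex_has_least_nat [of "\<lambda>S. S \<subseteq> S0 \<and> binomial_gen_set m I S" S0 card] assms(1) by auto
  have "ideal_gen m S' \<noteq> I" if "S' \<subset> S" for S'
  proof
    assume "ideal_gen m S' = I"
    then have "binomial_gen_set m I S'"
      using S(2) that by (auto simp: binomial_gen_set_def)
    then have "card S \<le> card S'" using min that S(1) by blast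
    moreover have "card S' < card S"
      using that S(1) assms(2) by (intro psubset_card_mono) (auto intro: finite_subset)
    ultimately show False by simp
  qed
  then show ?thesis using S by (auto simp: minimal_binomial_gen_set_def)
qed

lemma xmono_diff_eq:
  assumes "xmono a - xmono b = (xmono p - xmono q :: 'k::field mpoly)" "a \<noteq> b"
  shows "{a, b} = {p, q}" "p \<noteq> q"
proof -
  show "p \<noteq> q"
  proof
    assume "p = q"
    then have "ks (xmono a - xmono b :: 'k mpoly) = {}" using assms(1) by simp
    then show False using keys_xmono_diff [OF assms(2), where 'k = 'k] by simp
  qed
  then show "{a, b} = {p, q}"
    using assms keys_xmono_diff [of a b, where 'k = 'k] keys_xmono_diff [of p q, where 'k = 'k] by simp
qed

text \<open>For g nonzero, p + g and q + g share g and are connected anyway. This makes the class of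
  u an admissible Q in \<open>lsum_ideal\<close>.\<close>

lemma conn_add_iff:
  assumes "fib p q" "mon g" "conn u p \<longleftrightarrow> conn u q"
  shows "conn u (p + g) \<longleftrightarrow> conn u (q + g)"
proof (cases "g = 0")
  case False
  have "fib (p + g) (q + g)" using assms fib_add by blast
  then have "step (g + p) (g + q)" using step_common False by (simp add: add.commute)
  then have "conn (p + g) (q + g)" by (simp add: step_conn add.commute)
  then show ?thesis using conn_trans conn_sym by blast
qed (use assms in simp)

text \<open>\<open>S0\<close> keeps the binomials that do not cross between the class of u and the
  rest of its fibre. Adding the given binomial generates, because any crossing can be routed through
  u and v; without it the class of u is invariant, so every minimal subsystem contains it.\<close>

lemma minimal_binomial_crit:
  assumes "finite (Collect crit)" "fib u v" "\<not> conn u v"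
  shows "minimal_binomial m (toric_ideal m E) (xmono u - xmono v :: 'k::field mpoly)"
proof -
  let ?s = "xmono u - xmono v :: 'k mpoly"
  define S0 :: "'k mpoly set" where "S0 = {xmono a - xmono b | a b. fib a b \<and> crit a \<and>
     (fib a u \<longrightarrow> (conn u a \<longleftrightarrow> conn u b))}"
  let ?S1 = "insert ?s S0"
  have "binomial_gen_set m (toric_ideal m E) ?S1"
  proof (rule gen_criterion)
    fix s assume "s \<in> ?S1"
    then show "\<exists>u v. s = xmono u - xmono v \<and> fib u v" using assms(2) by (auto simp: S0_def)
  next
    fix a b assume ab: "fib a b"
    let ?R = "link ?S1"
    have uv: "?R u v" by (simp add: link_def)
    have base: "?R c d" if "fib c d" "conn u c \<longleftrightarrow> conn u d" for c d
      using that by (auto simp: link_def S0_def crit_def)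
    have path: "?R\<^sup>*\<^sup>* c d" if "fib c d" "conn u c" "\<not> conn u d" for c d
    proof -
      have "?R c u" using that(2) conn_sym by (simp add: link_def)
      moreover have "fib v d"
        using that assms(2) conn_fib [of u c] fib_def fib_trans fib_sym by metis
      then have "?R v d" using base [of v d] that(3) assms(3) by blast
      ultimately show ?thesis using uv
        by (meson converse_rtranclp_into_rtranclp r_into_rtranclp)
    qed
    show "?R\<^sup>*\<^sup>* a b"
    proof (cases "conn u a \<longleftrightarrow> conn u b")
      case True
      then show ?thesis using base [OF ab] by blast
    next
      case False
      then show ?thesis using path ab fib_sym link_rtranclp_sym by metis
    qed
  qed
  moreover have "finite ?S1"
  proof -
    have "S0 \<subseteq> all_crit_binomials" by (auto simp: S0_def all_crit_binomials_def)
    then show ?thesis using finite_all_crit [OF assms(1)] finite_subset by auto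
  qed
  ultimately obtain S where S: "S \<subseteq> ?S1" "minimal_binomial_gen_set m (toric_ideal m E) S"
    using minimal_subset by blast
  have "?s \<in> S"
  proof (rule ccontr)
    assume "?s \<notin> S"
    then have sub: "S \<subseteq> S0" using S(1) by blast
    have "?s \<in> ideal_gen m S"
      using S(2) xmono_diff_toric [OF assms(2)] by (simp add: minimal_binomial_gen_set_def binomial_gen_set_def)
    then have "lsum {w. conn u w} ?s = 0"
    proof (rule lsum_ideal)
      fix s assume "s \<in> S"
      then obtain a b where ab: "s = xmono a - xmono b" "fib a b" "fib a u \<longrightarrow> (conn u a \<longleftrightarrow> conn u b)"
        using sub by (auto simp: S0_def)
      have "conn u a \<longleftrightarrow> conn u b"
        using ab assms(2) conn_fib [of u] fib_sym fib_trans fib_def by metis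
      then show "\<exists>a c. s = xmono a - xmono c \<and> (\<forall>g. ks g \<subseteq> {..<m} \<longrightarrow>
          (a + g \<in> {w. conn u w} \<longleftrightarrow> c + g \<in> {w. conn u w}))"
        using ab conn_add_iff unfolding mon_def by (intro exI [of _ a] exI [of _ b]) auto
    qed
    then show False using assms(3) by (simp add: lsum_diff)
  qed
  then show ?thesis using S(2) by (auto simp: minimal_binomial_def)
qed

text \<open>If u had another neighbour u' in its class, the binomials avoiding u would still
  generate: u is reached from u' for free.\<close>

lemma indispensable_single:
  assumes "fib u v" "\<not> conn u v"
    and "indispensable_monomial m (toric_ideal m E :: 'k::field mpoly set) u"
  shows "single u"
proof (rule ccontr)
  assume "\<not> single u"
  then obtain u' where u': "step u u'" "u' \<noteq> u" by (auto simp: single_def)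
  define S :: "'k mpoly set" where
    "S = {xmono a - xmono b | a b. fib a b \<and> a \<noteq> u \<and> b \<noteq> u}"
  let ?R = "link S"
  have u1: "?R u u'" "?R u' u" using u' step_conn step_sym by (auto simp: link_def)
  have fu: "fib u u'" using u'(1) by (simp add: step_def)
  have "binomial_gen_set m (toric_ideal m E) S"
  proof (rule gen_criterion)
    fix s assume "s \<in> S"
    then show "\<exists>u v. s = xmono u - xmono v \<and> fib u v" by (auto simp: S_def)
  next
    fix a b assume ab: "fib a b"
    have base: "?R c d" if "fib c d" "c \<noteq> u" "d \<noteq> u" for c d
      using that by (auto simp: S_def link_def)
    consider "a = b" | "a \<noteq> u" "b \<noteq> u" | "a = u" "b \<noteq> u" | "a \<noteq> u" "b = u" by blast
    then show "?R\<^sup>*\<^sup>* a b"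
    proof cases
      case 2
      then show ?thesis using base ab by blast
    next
      case 3
      then have "?R u' b" using base u'(2) ab fu fib_sym fib_trans by blast
      then show ?thesis using u1 3 by (meson converse_rtranclp_into_rtranclp r_into_rtranclp)
    next
      case 4
      then have "?R a u'" using base u'(2) ab fu fib_trans by blast
      then show ?thesis using u1 4 by (meson converse_rtranclp_into_rtranclp r_into_rtranclp)
    qed simp
  qed
  then obtain b where b: "b \<in> S" "u \<in> ks b"
    using assms(3) by (auto simp: indispensable_monomial_def)
  then obtain p q where "b = xmono p - xmono q" "p \<noteq> u" "q \<noteq> u" by (auto simp: S_def)
  then show False using b(2) keys_xmono_diff_subset [of p q, where 'k = 'k] by auto
qed

text \<open>Descent on degree: a monomial that is not critical but not alone in its fibre shares a
  variable with another one, and cancelling it keeps the two distinct.\<close>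

lemma crit_divisor:
  assumes "fib a c" "a \<noteq> c"
  shows "\<exists>u g. a = u + g \<and> crit u"
  using assms
proof (induction "sz a" arbitrary: a c rule: less_induct)
  case less
  show ?case
  proof (cases "crit a")
    case True
    then show ?thesis by (intro exI [of _ a] exI [of _ 0]) simp
  next
    case False
    then have "conn a c" using less.prems(1) by (auto simp: crit_def)
    then have "\<not> single a" using single_conn less.prems(2) by blast
    then obtain d where d: "fib a d" "ks a \<inter> ks d \<noteq> {}" "d \<noteq> a" by (auto simp: single_def step_def)
    then obtain i where i: "i \<in> ks a" "i \<in> ks d" by blast
    let ?g = "sg i (Suc 0)"
      obtain a' d' where ad: "a = a' + ?g" "d = d' + ?g" using split_variable [OF i(1)] split_variable [OF i(2)] by metis
    have im: "i < m" using d(1) i by (auto simp: fib_def mon_def)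
    have "sz a' < sz a"
      using im ad by (simp add: sz_add) (simp add: sz_def lookup_single when_def sum.delta)
    moreover have "fib a' d'" "a' \<noteq> d'" using ad d fib_cancel by auto
    ultimately obtain u g where "a' = u + g" "crit u" using less.hyps by blast
    then show ?thesis using ad(1) by (auto simp: add.assoc)
  qed
qed

text \<open>Evaluation at the 0/1 point of u forces some t in T to have a monomial p supported
  inside u. A critical divisor w of p is squarefree, hence divides u, and equals u because u is
  alone in its class; so p has the full support of u.\<close>

lemma touch:
  assumes sqf: "\<And>w i. crit w \<Longrightarrow> lkp w i \<le> 1"
    and T: "T \<subseteq> (toric_ideal m E :: 'k::field mpoly set)" "\<And>t. t \<in> T \<Longrightarrow> is_binomial m t"
      "toric_ideal m E \<subseteq> radical m (ideal_gen m T)"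
    and u: "single u" "fib u v" "\<not> conn u v"
  shows "\<exists>t\<in>T. \<exists>a\<in>ks t. ks a = ks u"
proof -
  define Q where "Q = {w :: expo. ks w \<subseteq> ks u}"
  have "xmono u - xmono v \<in> (toric_ideal m E :: 'k mpoly set)" using u xmono_diff_toric by blast
  then obtain k where k: "(xmono u - xmono v :: 'k mpoly) ^ k \<in> ideal_gen m T"
    using T(3) by (auto simp: radical_def)
  have "\<not> step u v" using u(3) step_conn by blast
  then have disj: "ks u \<inter> ks v = {}" using u(2) by (auto simp: step_def)
  have "v \<noteq> 0"
    using u(2,3) fib_sz [OF u(2)] sz_eq_0 by (metis conn_refl fib_def)
  then have vQ: "v + g \<notin> Q" for g
    using disj keys_ne [of v] by (auto simp: Q_def keys_add_nat)
  have uQ: "u + g \<in> Q \<longleftrightarrow> g \<in> Q" for g by (auto simp: Q_def keys_add_nat)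
  \<comment> \<open>At this point x^u has value 1 and x^v has value 0, as u and v are disjoint and v
    is not 0.\<close>
  have "lsum Q ((xmono u - xmono v :: 'k mpoly) ^ j) = 1" for j
  proof (induction j)
    case 0
    then show ?case by (simp add: lsum_def Q_def)
  next
    case (Suc j)
    then show ?case by (simp add: left_diff_distrib lsum_diff lsum_xmono_mult uQ vQ) (simp add: lsum_def)
  qed
  then have one: "lsum Q ((xmono u - xmono v :: 'k mpoly) ^ k) \<noteq> 0" by simp
  have "\<exists>t\<in>T. \<forall>a c. t = xmono a - xmono c \<longrightarrow> (\<exists>g. ks g \<subseteq> {..<m} \<and> (a + g \<in> Q \<longleftrightarrow> c + g \<notin> Q))"
    using lsum_ideal [OF k, of Q] one by blast
  then obtain t where t: "t \<in> T"
    "\<And>a c. t = xmono a - xmono c \<Longrightarrow> (\<exists>g. a + g \<in> Q \<longleftrightarrow> c + g \<notin> Q)" by blast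
  obtain a c where ac: "t = xmono a - xmono c" "fib a c" using T t(1) toric_binomial by blast
  obtain g where g: "a + g \<in> Q \<longleftrightarrow> c + g \<notin> Q" using t(2) ac(1) by blast
  then have "a \<noteq> c" "a \<in> Q \<or> c \<in> Q" by (auto simp: Q_def keys_add_nat)
  then obtain p q where p: "p \<in> ks t" "p \<in> Q" "fib p q" "p \<noteq> q"
    using ac keys_xmono_diff [of a c, where 'k = 'k] fib_sym by (metis insertCI)
  then obtain w h where w: "p = w + h" "crit w" using crit_divisor by blast
  obtain w' where w': "fib w w'" "\<not> conn w w'" using w(2) by (auto simp: crit_def)
  have kw: "ks w \<subseteq> ks u" using p(2) w(1) by (auto simp: Q_def keys_add_nat)
  \<comment> \<open>For squarefree w, containment of supports is divisibility.\<close>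
  have "lkp w i \<le> lkp u i" for i
  proof (cases "i \<in> ks w")
    case True
    then have "lkp u i \<ge> 1" using kw by (auto simp: in_keys_iff subset_iff Suc_le_eq)
    then show ?thesis using sqf [OF w(2), of i] by linarith
  qed (simp add: in_keys_iff)
  then obtain d where uw: "u = w + d" using lookup_le_split by blast
  \<comment> \<open>Otherwise replacing the factor w by a monomial w' from another class of its
    fibre gives a neighbour of u different from u.\<close>
  have "d = 0"
  proof (rule ccontr)
    assume ne: "d \<noteq> 0"
    have mg: "mon d" using u(2) uw by (simp add: fib_def)
    have "step (d + w) (d + w')"
      using step_common [OF _ ne] fib_add [OF mg w'(1)] by (metis add.commute)
    then have "d + w' = d + w" using u(1) uw unfolding single_def by (metis add.commute)
    then show False using w'(2) by simp
  qed
  then have "ks p = ks u" using w uw p(2) by (auto simp: Q_def keys_add_nat)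
  then show ?thesis using t(1) p(1) by blast
qed

text \<open>A generator cannot act below its own degree, so discarding s loses no binomial of
  smaller degree, and therefore none inside a class of the fibre of u.\<close>

lemma minimal_gen_set:
  assumes S: "minimal_binomial_gen_set m (toric_ideal m E) (S :: 'k::field mpoly set)"
    and s: "s \<in> S" "s = xmono u - xmono v" "fib u v"
  shows "s \<notin> ideal_gen m (S - {s})"
    and "\<And>a b. fib u a \<Longrightarrow> conn a b \<Longrightarrow> xmono a - xmono b \<in> ideal_gen m (S - {s})"
proof -
  let ?J = "ideal_gen m (S - {s})"
  have gen: "ideal_gen m S = toric_ideal m E" and bin: "S \<subseteq> toric_ideal m E" "\<And>t. t \<in> S \<Longrightarrow> is_binomial m t"
    using S by (auto simp: minimal_binomial_gen_set_def binomial_gen_set_def)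
  have "?J \<noteq> toric_ideal m E"
    using S s(1) by (auto simp: minimal_binomial_gen_set_def)
  then have not_gen: "?J \<noteq> ideal_gen m S" using gen by simp
  show sJ: "s \<notin> ?J"
  proof
    assume "s \<in> ?J"
    then have "S \<subseteq> ?J" using ideal_gen_base [of _ "S - {s}" m] by blast
    then have "ideal_gen m S \<subseteq> ?J" by (rule ideal_gen_least)
    then show False using not_gen ideal_gen_mono [of "S - {s}" S m] by blast
  qed
  have J_toric: "?J \<subseteq> toric_ideal m E"
    using ideal_gen_mono [of "S - {s}" S m] gen by blast
  have "u \<noteq> v" using sJ s(2) ideal_gen_zero [of m "S - {s}"] by auto
  have low: "xmono a - xmono b \<in> ?J" if ab: "fib a b" "sz a < sz u" for a b
  proof (rule ccontr)
    assume no: "xmono a - xmono b \<notin> ?J"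
    \<comment> \<open>The monomials congruent to x^a without the help of s.\<close>
    let ?Q = "{c. mon c \<and> xmono a - xmono c \<in> ?J}"
    have "xmono a - xmono b \<in> ideal_gen m S" using gen xmono_diff_toric [OF ab(1)] by simp
    then have "lsum ?Q (xmono a - xmono b :: 'k mpoly) = 0"
    proof (rule lsum_ideal)
      fix t assume t: "t \<in> S"
      then obtain p q where pq: "t = xmono p - xmono q" "fib p q" using bin toric_binomial by blast
      have "p + g \<in> ?Q \<longleftrightarrow> q + g \<in> ?Q" if g: "ks g \<subseteq> {..<m}" for g
      proof (cases "t = s")
        case False
        then have "t \<in> ?J" using t ideal_gen_base [of t "S - {s}" m] by blast
        then have "xmono g * (xmono p - xmono q) \<in> ?J"
          using pq(1) g ideal_gen_mult mon_polyring unfolding mon_def by blast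
        then have "xmono (p + g) - xmono (q + g) \<in> ?J"
          by (simp add: right_diff_distrib xmono_mult add.commute)
        moreover have "mon (p + g)" "mon (q + g)" using g pq(2) by (auto simp: fib_def mon_def keys_add_nat)
        ultimately show ?thesis using ideal_gen_trans ideal_gen_sym by blast
      next
        case True
        then have "{u, v} = {p, q}" using xmono_diff_eq(1) [of u v p q, where 'k = 'k] \<open>u \<noteq> v\<close> s(2) pq(1) by simp
        then have szp: "sz p = sz u" "sz q = sz u" using fib_sz [OF s(3)] fib_sz [OF pq(2)] by auto
        \<comment> \<open>Multiples of the terms of s have degree at least
          \<open>sz u > sz a\<close>, so for t = s both memberships are false.\<close>
        have "c + g \<notin> ?Q" if "sz c = sz u" for c
        proof
          assume "c + g \<in> ?Q"
          then have "fib a (c + g)" using J_toric ab(1) toric_xmono_diff unfolding fib_def by blast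
          then show False using fib_sz ab(2) that by (fastforce simp: sz_add)
        qed
        then show ?thesis using szp by blast
      qed
      then show "\<exists>a' c. t = xmono a' - xmono c \<and> (\<forall>g. ks g \<subseteq> {..<m} \<longrightarrow> (a' + g \<in> ?Q \<longleftrightarrow> c + g \<in> ?Q))"
        using pq(1) by blast
    qed
    moreover have "a \<in> ?Q" "b \<notin> ?Q" using ab no ideal_gen_zero by (auto simp: fib_def)
    ultimately show False by (auto simp: lsum_diff split: if_splits)
  qed
  show "xmono a - xmono b \<in> ?J" if "fib u a" "conn a b" for a b
    using conn_ideal [OF low that(2)] fib_sz [OF that(1)] by simp
qed

text \<open>Binomials are counted separately for each vertex set W of a critical fibre. On each W
  the minimal system is no larger than any T generating up to radical, and no binomial of T is
  counted for two different W.\<close>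

lemma bar_eq_mu:
  fixes I :: "'k::field mpoly set"
  defines "I \<equiv> toric_ideal m E"
  assumes sqf: "\<And>w i. crit w \<Longrightarrow> lkp w i \<le> 1"
    and VS_inj: "\<And>u v. crit u \<Longrightarrow> crit v \<Longrightarrow> VS u = VS v \<Longrightarrow> fib u v"
    and one_single: "\<And>u v. fib u v \<Longrightarrow> \<not> conn u v \<Longrightarrow> single u \<or> single v"
    and three: "\<And>u v w x. fib u v \<Longrightarrow> fib u w \<Longrightarrow> \<not> conn u v \<Longrightarrow> \<not> conn u w \<Longrightarrow> \<not> conn v w \<Longrightarrow>
      fib u x \<Longrightarrow> x \<in> {u, v, w}"
  shows "bar m I = mu m I"
proof -
  have fin: "finite (Collect crit)" using sqf by (rule finite_crit)
  have ex: "\<exists>S. minimal_binomial_gen_set m I S"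
    using minimal_subset [OF all_crit_gen finite_all_crit [OF fin]] unfolding I_def by blast
  define S where "S = (SOME S. minimal_binomial_gen_set m I S)"
  have S: "minimal_binomial_gen_set m I S" unfolding S_def by (rule someI_ex [OF ex])
  have S_bin: "\<exists>u v. s = xmono u - xmono v \<and> fib u v" if "s \<in> S" for s
    using S that toric_binomial
    unfolding minimal_binomial_gen_set_def binomial_gen_set_def I_def by blast
  note min1 = minimal_gen_set(1) [OF S [unfolded I_def]]
  note min2 = minimal_gen_set(2) [OF S [unfolded I_def]]
  have S_nc: "\<not> conn u v" if "s \<in> S" "s = xmono u - xmono v" "fib u v" for s u v
    using min1 [OF that] min2 [OF that, of u v] that fib_refl by (auto simp: fib_def)
  have S_keys: "ks s = {u, v}" if "s \<in> S" "s = xmono u - xmono v" "fib u v" for s u v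
  proof -
    have "u \<noteq> v" using S_nc [OF that] by auto
    then show ?thesis using that(2) keys_xmono_diff by blast
  qed
  define B where "B = VS ` Collect crit"
  have finB: "finite B" using fin by (simp add: B_def)
  define P where "P A W = {s \<in> A. \<exists>u\<in>ks s. VS u = W}" for A :: "'k mpoly set" and W
  have S_cover: "S \<subseteq> (\<Union>W\<in>B. P S W)"
  proof
    fix s assume s: "s \<in> S"
    then obtain u v where uv: "s = xmono u - xmono v" "fib u v" using S_bin by blast
    then have "crit u" using S_nc [OF s] critI by blast
    then show "s \<in> (\<Union>W\<in>B. P S W)" using s S_keys [OF s uv] by (auto simp: B_def P_def)
  qed
  \<comment> \<open>Two generators joining the same two classes differ by binomials inside these
    classes, so one of them would be redundant.\<close>
  have same_pair: "s = s'"
    if s: "s \<in> S" "s = xmono u - xmono v" "fib u v" and s': "s' \<in> S" "s' = xmono u' - xmono v'" "fib u' v'"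
      and fu: "fib u u'" and c: "conn u u' \<and> conn v v' \<or> conn u v' \<and> conn v u'" for s s' u v u' v'
  proof (rule ccontr)
    assume "s \<noteq> s'"
    let ?J = "ideal_gen m (S - {s})"
    have J: "xmono u' - xmono v' \<in> ?J" "xmono v' - xmono u' \<in> ?J"
      using s' \<open>s \<noteq> s'\<close> ideal_gen_base [of s' "S - {s}" m] ideal_gen_sym by auto
    have fx: "fib u x" if "x \<in> {u, v, u', v'}" for x
      using that s(3) s'(3) fu fib_refl fib_trans unfolding fib_def by auto
    have mn: "xmono a - xmono b \<in> ?J" if "conn a b" "a \<in> {u, v, u', v'}" for a b
      using min2 [OF s, of a b] fx [OF that(2)] that(1) by simp
    have "xmono u - xmono v \<in> ?J"
      using c
    proof
      assume "conn u u' \<and> conn v v'"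
      then have "xmono u - xmono u' \<in> ?J" "xmono v' - xmono v \<in> ?J"
        using mn conn_sym by auto
      then show ?thesis using J ideal_gen_trans by blast
    next
      assume "conn u v' \<and> conn v u'"
      then have "xmono u - xmono v' \<in> ?J" "xmono u' - xmono v \<in> ?J"
        using mn conn_sym by auto
      then show ?thesis using J ideal_gen_trans by blast
    qed
    then show False using min1 [OF s] s(2) by simp
  qed
  have local_bound: "finite (P S W) \<and> card (P S W) \<le> card (P T W)"
    if W: "W \<in> B" and T: "finite T" "T \<subseteq> I" "\<And>t. t \<in> T \<Longrightarrow> is_binomial m t" "I \<subseteq> radical m (ideal_gen m T)" for T W
  proof -
    have touched: "\<exists>t\<in>P T W. \<exists>a\<in>ks t. ks a = ks u" if "single u" "crit u" "VS u = W" for u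
    proof -
      obtain v where "fib u v" "\<not> conn u v" using \<open>crit u\<close> by (auto simp: crit_def)
      then obtain t a where ta: "t \<in> T" "a \<in> ks t" "ks a = ks u"
        using touch [OF sqf T(2)[unfolded I_def] T(3) T(4)[unfolded I_def] \<open>single u\<close>] by blast
      then have "VS a = W" using VS_keys that by blast
      then show ?thesis using ta by (auto simp: P_def)
    qed
    obtain u0 where u0: "crit u0" "VS u0 = W" using W by (auto simp: B_def)
    have inW: "fib u0 u \<and> fib u0 v \<and> \<not> conn u v" if "s \<in> P S W" "s = xmono u - xmono v" "fib u v" for s u v
    proof -
      have sS: "s \<in> S" using that by (simp add: P_def)
      have nc: "\<not> conn u v" using S_nc [OF sS that(2,3)] .
      have "VS u = W" using that S_keys [OF sS that(2,3)] VS_fib [OF that(3)] by (auto simp: P_def)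
      then have "fib u0 u" using VS_inj u0 critI nc that(3) by blast
      then show ?thesis using nc that(3) fib_trans by blast
    qed
    have finT: "finite (P T W)" using T(1) by (simp add: P_def)
    show ?thesis
    \<comment> \<open>Two classes give the bound 1 on both sides, three classes the bound 2.\<close>
    proof (cases "\<exists>u v w. fib u0 u \<and> fib u0 v \<and> fib u0 w \<and> \<not> conn u v \<and> \<not> conn u w \<and> \<not> conn v w")
      case False
      \<comment> \<open>With only two classes in the fibre, both generators join the same
        pair.\<close>
      have "s = s'" if "s \<in> P S W" "s' \<in> P S W" for s s'
      proof -
        have ss: "s \<in> S" "s' \<in> S" using that by (auto simp: P_def)
        obtain u v where uv: "s = xmono u - xmono v" "fib u v" using S_bin [OF ss(1)] by blast
        obtain u' v' where uv': "s' = xmono u' - xmono v'" "fib u' v'" using S_bin [OF ss(2)] by blast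
        note i = inW [OF that(1) uv] inW [OF that(2) uv']
        have "conn u u' \<or> conn v u'" "conn u v' \<or> conn v v'" using False i by blast+
        then have "conn u u' \<and> conn v v' \<or> conn u v' \<and> conn v u'"
          using i conn_trans conn_sym by blast
        then show ?thesis using same_pair [OF ss(1) uv ss(2) uv'] i fib_sym fib_trans by blast
      qed
      then have "finite (P S W) \<and> card (P S W) \<le> 1"
        by (metis card_1_singleton_iff card.empty finite.emptyI finite.insertI is_singletonI' is_singleton_def
            le_numeral_extra(4) zero_le_one One_nat_def)
      moreover have "P T W \<noteq> {}"
      proof -
        obtain v0 where v0: "fib u0 v0" "\<not> conn u0 v0" using u0 by (auto simp: crit_def)
        then have "single u0 \<or> single v0" using one_single by blast
        moreover have "crit v0" "VS v0 = W" using v0 critI' VS_fib u0 by auto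
        ultimately show ?thesis using touched u0 by blast
      qed
      then have "1 \<le> card (P T W)" using finT by (simp add: Suc_le_eq card_gt_0_iff)
      ultimately show ?thesis by linarith
    next
      case True
      then obtain u v w where f: "fib u0 u" "fib u0 v" "fib u0 w" and nc: "\<not> conn u v" "\<not> conn u w" "\<not> conn v w"
        by blast
      have fuv: "fib u v" "fib u w" using f fib_sym fib_trans by blast+
      have all: "x \<in> {u, v, w}" if "fib u0 x" for x
        using three [OF fuv nc, of x] that f fib_sym fib_trans by blast
      have ne: "u \<noteq> v" "u \<noteq> w" "v \<noteq> w" using nc by auto
      have nc': "\<not> conn x y" if "x \<in> {u, v, w}" "y \<in> {u, v, w}" "x \<noteq> y" for x y
        using that nc conn_sym by auto
      \<comment> \<open>The fibre is exactly {u, v, w} and these are pairwise not connected, so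
        nothing is left to share a variable with x.\<close>
      have sing: "single x" if "x \<in> {u, v, w}" for x
        unfolding single_def
      proof safe
        fix y assume st: "step x y"
        then have "fib x y" by (simp add: step_def)
        then have "y \<in> {u, v, w}" using all that f fib_trans by blast
        then show "y = x" using nc' [OF that] st step_conn by blast
      qed
      have disj: "ks x \<inter> ks y = {}" if "x \<in> {u, v, w}" "y \<in> {u, v, w}" "x \<noteq> y" for x y
      proof -
        have "fib x y" using that f fib_trans fib_sym by blast
        then show ?thesis using nc' [OF that] step_conn by (auto simp: step_def)
      qed
      have nz: "ks x \<noteq> {}" if "x \<in> {u, v, w}" for x
      proof
        assume "ks x = {}"
        then have "x = 0" by simp
        have "fib u0 x" "sz x = 0" using that f \<open>x = 0\<close> by (auto simp: sz_def)
        then have "sz u0 = 0" using fib_sz by simp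
        then have "sz u = 0" "sz v = 0" using fib_sz [OF f(1)] fib_sz [OF f(2)] by auto
        then show False using ne fuv sz_eq_0 unfolding fib_def by metis
      qed
      have cr: "crit x \<and> VS x = W" if "x \<in> {u, v, w}" for x
        using that f u0 crit_fib VS_fib by blast
      have tc: "\<exists>t\<in>P T W. \<exists>a\<in>ks t. ks a = ks x" if "x \<in> {u, v, w}" for x
        using touched sing cr that by blast
      \<comment> \<open>Each of the three supports must occur in T, and one binomial has at most two
        monomials.\<close>
      have "2 \<le> card (P T W)"
      proof (rule ccontr)
        assume "\<not> 2 \<le> card (P T W)"
        then have le1: "card (P T W) \<le> Suc 0" by simp
        obtain t a where t: "t \<in> P T W" "a \<in> ks t" "ks a = ks u" using tc [of u] by auto
        have all_t: "t' = t" if "t' \<in> P T W" for t'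
          using le1 t(1) that card_le_Suc0_iff_eq [OF finT] by auto
        have tc': "\<exists>a\<in>ks t. ks a = ks x" if "x \<in> {u, v, w}" for x
          using tc [OF that] all_t by metis
        obtain b where b: "b \<in> ks t" "ks b = ks v" using tc' [of v] by auto
        obtain c where c: "c \<in> ks t" "ks c = ks w" using tc' [of w] by auto
        have "ks u \<noteq> ks v" "ks u \<noteq> ks w" "ks v \<noteq> ks w"
          using disj [of u v] disj [of u w] disj [of v w] nz [of u] nz [of v] ne by auto
        then have "a \<noteq> b" "a \<noteq> c" "b \<noteq> c" using t b c by auto
        then have "card {a, b, c} = 3" by simp
        moreover have "{a, b, c} \<subseteq> ks t" using t b c by simp
        moreover have "t \<in> T" using t(1) by (simp add: P_def)
        then obtain p q where "t = xmono p - xmono q" using T(3) unfolding is_binomial_def by blast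
        then have "card (ks t) \<le> 2"
          using keys_xmono_diff_subset [of p q, where 'k = 'k] card_mono [of "{p, q}" "ks t"]
          by (auto simp: card_insert_if split: if_splits)
        ultimately show False using card_mono [of "ks t" "{a, b, c}"] by simp
      qed
      moreover have "finite (P S W) \<and> card (P S W) \<le> 2"
      proof -
        have pairs: "\<exists>x y. s = xmono x - xmono y \<and> fib x y \<and> x \<noteq> y \<and> x \<in> {u, v, w} \<and> y \<in> {u, v, w}" if "s \<in> P S W" for s
        proof -
          have "s \<in> S" using that by (simp add: P_def)
          then obtain x y where xy: "s = xmono x - xmono y" "fib x y" using S_bin by blast
          then show ?thesis using inW [OF that xy] all by (intro exI [of _ x] exI [of _ y]) auto
        qed
        have uniq: "s = s'" if "s \<in> P S W" "s' \<in> P S W" "ks s = ks s'" for s s'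
        proof -
          have ss: "s \<in> S" "s' \<in> S" using that by (auto simp: P_def)
          obtain x y where xy: "s = xmono x - xmono y" "fib x y" using S_bin [OF ss(1)] by blast
          obtain x' y' where xy': "s' = xmono x' - xmono y'" "fib x' y'" using S_bin [OF ss(2)] by blast
          have "{x, y} = {x', y'}" using S_keys [OF ss(1) xy] S_keys [OF ss(2) xy'] that(3) by simp
          then have "conn x x' \<and> conn y y' \<or> conn x y' \<and> conn y x'" by (auto simp: doubleton_eq_iff)
          moreover have "fib x x'" using inW [OF that(1) xy] inW [OF that(2) xy'] fib_sym fib_trans by blast
          ultimately show ?thesis using same_pair [OF ss(1) xy ss(2) xy'] by blast
        qed
        then have inj: "inj_on ks (P S W)" by (auto simp: inj_on_def)
        have im: "ks ` P S W \<subseteq> {{u, v}, {u, w}, {v, w}}"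
        proof
          fix k assume "k \<in> ks ` P S W"
          then obtain s where s: "s \<in> P S W" "k = ks s" by blast
          obtain x y where "s = xmono x - xmono y" "x \<noteq> y" "x \<in> {u, v, w}" "y \<in> {u, v, w}"
            using pairs [OF s(1)] by blast
          then have "k = {x, y}" using s(2) keys_xmono_diff [of x y, where 'k = 'k] by simp
          then show "k \<in> {{u, v}, {u, w}, {v, w}}"
            using \<open>x \<noteq> y\<close> \<open>x \<in> _\<close> \<open>y \<in> _\<close> by auto
        qed
        \<comment> \<open>Generators on all three pairs would form a triangle, where one is the sum
          of the other two up to signs.\<close>
        have "ks ` P S W \<noteq> {{u, v}, {u, w}, {v, w}}"
        proof
          assume eq: "ks ` P S W = {{u, v}, {u, w}, {v, w}}"
          have get: "\<exists>s\<in>P S W. (s = xmono x - xmono y \<or> s = xmono y - xmono x) \<and> ks s = {x, y}"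
            if xy: "{x, y} \<in> ks ` P S W" for x y
          proof -
            obtain s where s: "s \<in> P S W" "ks s = {x, y}" using xy by (metis imageE)
            obtain p q where pq: "s = xmono p - xmono q" "p \<noteq> q" using pairs [OF s(1)] by blast
            then have "{p, q} = {x, y}" using s(2) keys_xmono_diff [of p q, where 'k = 'k] by simp
            then show ?thesis using s pq by (auto simp: doubleton_eq_iff)
          qed
          obtain s1 where s1: "s1 \<in> P S W" "s1 = xmono u - xmono v \<or> s1 = xmono v - xmono u" "ks s1 = {u, v}"
            using get [of u v] eq by auto
          obtain s2 where s2: "s2 \<in> P S W" "s2 = xmono u - xmono w \<or> s2 = xmono w - xmono u" "ks s2 = {u, w}"
            using get [of u w] eq by auto
          obtain s3 where s3: "s3 \<in> P S W" "s3 = xmono v - xmono w \<or> s3 = xmono w - xmono v" "ks s3 = {v, w}"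
            using get [of v w] eq by auto
          have "s1 \<noteq> s2" "s1 \<noteq> s3" using s1(3) s2(3) s3(3) ne by (auto simp: doubleton_eq_iff)
          let ?J = "ideal_gen m (S - {s1})"
          have "s2 \<in> ?J" "s3 \<in> ?J"
            using ideal_gen_base [of _ "S - {s1}" m] \<open>s1 \<noteq> s2\<close> \<open>s1 \<noteq> s3\<close> s2(1) s3(1) by (auto simp: P_def)
          then have "xmono u - xmono w \<in> ?J" "xmono w - xmono v \<in> ?J"
            using s2(2) s3(2) ideal_gen_sym by blast+
          then have "xmono u - xmono v \<in> ?J" "xmono v - xmono u \<in> ?J" using ideal_gen_trans ideal_gen_sym by blast+
          then have "s1 \<in> ?J" using s1(2) by blast
          moreover have "s1 \<in> S" using s1 by (simp add: P_def)
          ultimately show False using min1 S_bin by blast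
        qed
        then have "ks ` P S W \<subset> {{u, v}, {u, w}, {v, w}}" using im by blast
        then have "card (ks ` P S W) < card {{u, v}, {u, w}, {v, w}}" by (intro psubset_card_mono) auto
        also have "\<dots> \<le> 3" by (auto simp: card_insert_if)
        finally have "card (P S W) \<le> 2" using card_image [OF inj] by simp
        moreover have "finite (P S W)"
          using finite_imageD [OF _ inj] im finite_subset by (metis finite.emptyI finite.insertI)
        ultimately show ?thesis by blast
      qed
      ultimately show ?thesis by linarith
    qed
  qed
  have bound: "finite S \<and> card S \<le> card T"
    if T: "finite T" "T \<subseteq> I" "\<And>t. t \<in> T \<Longrightarrow> is_binomial m t" "I \<subseteq> radical m (ideal_gen m T)" for T
  proof -
    have lb: "finite (P S W)" "card (P S W) \<le> card (P T W)" if "W \<in> B" for W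
      using local_bound [OF that T] by auto
    have finS: "finite (\<Union>W\<in>B. P S W)" using finB lb by blast
    have "card S \<le> card (\<Union>W\<in>B. P S W)" using S_cover finS card_mono by blast
    also have "\<dots> \<le> (\<Sum>W\<in>B. card (P S W))" using finB by (rule card_UN_le)
    also have "\<dots> \<le> (\<Sum>W\<in>B. card (P T W))" using lb by (intro sum_mono)
    \<comment> \<open>Both monomials of a binomial of the toric ideal lie in one fibre and have the
      same \<open>VS\<close>.\<close>
    also have "\<dots> = card (\<Union>W\<in>B. P T W)"
    proof (rule card_UN_disjoint [symmetric])
      show "\<forall>W\<in>B. \<forall>W'\<in>B. W \<noteq> W' \<longrightarrow> P T W \<inter> P T W' = {}"
      proof (intro ballI impI equals0I)
        fix W W' t assume "W \<noteq> W'" and t: "t \<in> P T W \<inter> P T W'"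
        then obtain a b where ab: "a \<in> ks t" "VS a = W" "b \<in> ks t" "VS b = W'" by (auto simp: P_def)
        have "t \<in> T" using t by (simp add: P_def)
        then obtain p q where pq: "t = xmono p - xmono q" "fib p q"
          using T toric_binomial unfolding I_def by blast
        then have "a \<in> {p, q}" "b \<in> {p, q}" using ab keys_xmono_diff_subset [of p q, where 'k = 'k] by auto
        then show False using VS_fib [OF pq(2)] ab \<open>W \<noteq> W'\<close> by auto
      qed
    qed (use finB T(1) in \<open>auto simp: P_def\<close>)
    also have "\<dots> \<le> card T" using T(1) by (intro card_mono) (auto simp: P_def)
    finally show ?thesis using finS S_cover finite_subset by blast
  qed
  have I_rad: "I \<subseteq> radical m I"
  proof
    fix f assume "f \<in> I"
    then have "f \<in> polyring m" "f ^ 1 \<in> I" by (simp_all add: I_def toric_ideal_def)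
    then show "f \<in> radical m I" unfolding radical_def by blast
  qed
  have S_props: "S \<subseteq> I" "\<forall>b\<in>S. is_binomial m b" "ideal_gen m S = I"
    using S by (auto simp: minimal_binomial_gen_set_def binomial_gen_set_def)
  \<comment> \<open>S is an arbitrary choice among minimal systems; comparing it with the finite
    system \<open>all_crit_binomials\<close> shows that it is finite.\<close>
  have "finite S"
    using bound [OF finite_all_crit [OF fin]] all_crit_gen [where 'k = 'k] I_rad
    by (simp add: binomial_gen_set_def I_def)
  have "bar m I = card S"
    unfolding bar_def
  proof (rule Least_equality)
    show "\<exists>T. finite T \<and> card T = card S \<and> T \<subseteq> I \<and> (\<forall>b\<in>T. is_binomial m b) \<and>
        radical m (ideal_gen m T) = radical m I"
      using S_props \<open>finite S\<close> by (intro exI [of _ S]) simp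
    fix k assume "\<exists>T. finite T \<and> card T = k \<and> T \<subseteq> I \<and> (\<forall>b\<in>T. is_binomial m b) \<and>
        radical m (ideal_gen m T) = radical m I"
    then obtain T where "finite T" "card T = k" "T \<subseteq> I" "\<forall>b\<in>T. is_binomial m b"
        "radical m (ideal_gen m T) = radical m I" by blast
    then show "card S \<le> k" using bound [of T] I_rad by simp
  qed
  then show ?thesis by (simp add: mu_def S_def)
qed

section \<open>Alternating closed walks\<close>

definition eix :: "nat \<Rightarrow> nat \<Rightarrow> nat" where "eix x y = (THE i. i < m \<and> E i = {x, y})"

definition emon :: "nat \<Rightarrow> nat \<Rightarrow> expo" where "emon x y = sg (eix x y) (Suc 0)"

abbreviation adjacent :: "nat \<Rightarrow> nat \<Rightarrow> bool" where "adjacent \<equiv> adj m E"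

lemma eix_eq: "i < m \<Longrightarrow> E i = {x, y} \<Longrightarrow> eix x y = i"
  unfolding eix_def using edge_inj by (intro the_equality) (auto simp: inj_on_def)

lemma adj_eix: "adjacent x y \<Longrightarrow> eix x y < m \<and> E (eix x y) = {x, y}"
  using eix_eq by (auto simp: adj_def)

lemma adj_neq: "adjacent x y \<Longrightarrow> x \<noteq> y"
  using edge_card by (fastforce simp: adj_def)

lemma adj_sym: "adjacent x y \<Longrightarrow> adjacent y x"
  by (auto simp: adj_def insert_commute)

lemma mon_emon: "adjacent x y \<Longrightarrow> mon (emon x y)"
  by (simp add: emon_def adj_eix)

lemma vdeg_emon: "adjacent x y \<Longrightarrow> vdeg (emon x y) z = of_bool (x = z) + of_bool (y = z)"
  using adj_eix [of x y] adj_neq [of x y] by (auto simp: emon_def vdeg_single)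

lemma edge_through:
  assumes "vdeg u x > 0"
  shows "\<exists>y u'. adjacent x y \<and> u = u' + emon x y"
proof -
  obtain i where i: "i < m" "x \<in> E i" "i \<in> ks u" using assms by (auto simp: vdeg_pos_iff)
  obtain p q where "E i = {p, q}" using edge_card [OF i(1)] by (auto simp: card_2_iff)
  then obtain y where y: "E i = {x, y}" using i(2) by auto
  have "adjacent x y" using i(1) y by (auto simp: adj_def)
  then show ?thesis using split_variable [OF i(3)] eix_eq [OF i(1) y] by (auto simp: emon_def)
qed

definition walk :: "(nat \<Rightarrow> nat) \<Rightarrow> nat \<Rightarrow> bool" where
  "walk x L \<longleftrightarrow> (\<forall>k<L. adjacent (x k) (x (Suc k)))"

text \<open>The edges of the walk at the positions in K of one colour: even positions if c, odd ones
otherwise.\<close>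

definition col :: "(nat \<Rightarrow> nat) \<Rightarrow> bool \<Rightarrow> nat set \<Rightarrow> expo" where
  "col x c K = (\<Sum>k\<in>{k\<in>K. even k = c}. emon (x k) (x (Suc k)))"

lemma col_empty [simp]: "col x c {} = 0"
  by (simp add: col_def)

lemma col_union:
  assumes "finite A" "finite B" "A \<inter> B = {}"
  shows "col x c (A \<union> B) = col x c A + col x c B"
proof -
  have "{k \<in> A \<union> B. even k = c} = {k\<in>A. even k = c} \<union> {k\<in>B. even k = c}" by auto
  then show ?thesis unfolding col_def using assms by (simp add: sum.union_disjoint disjoint_iff)
qed

lemma col_insert:
  "finite K \<Longrightarrow> k \<notin> K \<Longrightarrow> col x c (insert k K) = col x c K + (if even k = c then emon (x k) (x (Suc k)) else 0)"
proof -
  assume k: "finite K" "k \<notin> K"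
  have "{j \<in> {k}. even j = c} = (if even k = c then {k} else {})" by auto
  then have "col x c {k} = (if even k = c then emon (x k) (x (Suc k)) else 0)" by (simp add: col_def)
  then show ?thesis using col_union [of K "{k}" x c] k by simp
qed

lemma col_cong: "(\<And>k. k \<in> K \<Longrightarrow> x k = x' k \<and> x (Suc k) = x' (Suc k)) \<Longrightarrow> col x c K = col x' c K"
  unfolding col_def by (rule sum.cong) auto

lemma col_mon: "walk x L \<Longrightarrow> K \<subseteq> {..<L} \<Longrightarrow> mon (col x c K)"
  unfolding col_def using finite_subset [of K "{..<L}"]
  by (intro mon_sum) (auto simp: walk_def mon_emon)

lemma col_keys: "finite K \<Longrightarrow> ks (col x c K) = (\<lambda>k. eix (x k) (x (Suc k))) ` {k\<in>K. even k = c}"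
  unfolding col_def by (subst keys_sum_nat) (auto simp: emon_def)

lemma col_eq_0: "finite K \<Longrightarrow> col x c K = 0 \<longleftrightarrow> (\<forall>k\<in>K. even k \<noteq> c)"
  using col_keys [of K x c] by (auto simp flip: keys_eq_empty)

definition signed_deg :: "(nat \<Rightarrow> nat) \<Rightarrow> nat set \<Rightarrow> nat \<Rightarrow> int" where
  "signed_deg x K y = int (vdeg (col x True K) y) - int (vdeg (col x False K) y)"

lemma signed_deg_empty [simp]: "signed_deg x {} y = 0"
  by (simp add: signed_deg_def)

lemma signed_deg_union: "finite A \<Longrightarrow> finite B \<Longrightarrow> A \<inter> B = {} \<Longrightarrow> signed_deg x (A \<union> B) y = signed_deg x A y + signed_deg x B y"
  by (simp add: signed_deg_def col_union vdeg_add)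

text \<open>An inner vertex occurrence lies on two consecutive edges of opposite sign, so the sum
  telescopes to the two ends.\<close>

lemma signed_deg_arc:
  assumes "walk x L" "a \<le> b" "b \<le> L"
  shows "signed_deg x {a..<b} y = (-1) ^ a * of_bool (x a = y) - (-1) ^ b * of_bool (x b = y)"
  using assms(2,3)
proof (induction b rule: dec_induct)
  case base
  then show ?case by simp
next
  case (step b)
  have "{a..<Suc b} = insert b {a..<b}" using step.hyps by auto
  then have c: "col x c {a..<Suc b} = col x c {a..<b} + (if even b = c then emon (x b) (x (Suc b)) else 0)" for c
    by (simp add: col_insert)
  have "adjacent (x b) (x (Suc b))" using assms(1) step.prems by (simp add: walk_def)
  then have "signed_deg x {a..<Suc b} y = signed_deg x {a..<b} y + (-1) ^ b * (of_bool (x b = y) + of_bool (x (Suc b) = y))"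
    by (auto simp: signed_deg_def c vdeg_add vdeg_emon)
  then show ?case using step by (simp add: algebra_simps)
qed

lemma sz_col:
  assumes "walk x L"
  shows "sz (col x True {..<L}) + sz (col x False {..<L}) = L"
proof -
  have "sz (emon p q) = Suc 0" if "adjacent p q" for p q
    using that adj_eix by (simp add: sz_def emon_def lookup_single when_def sum.delta)
  then have *: "walk x N \<Longrightarrow> sz (col x True {..<N}) + sz (col x False {..<N}) = N" for N
    by (induction N) (auto simp: sz_def [of 0] walk_def lessThan_Suc col_insert sz_add)
  show ?thesis using * assms .
qed

definition altw :: "(nat \<Rightarrow> nat) \<Rightarrow> nat \<Rightarrow> expo \<Rightarrow> expo \<Rightarrow> bool" where
  "altw x L u v \<longleftrightarrow> walk x L \<and> even L \<and> 0 < L \<and> x L = x 0 \<and>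
     u = col x True {..<L} \<and> v = col x False {..<L}"

text \<open>\<open>switch\<close> applied to the edges at positions K: c is the colour in surplus on
  K, and f makes up for the surplus. A contradiction thus needs positions of both parities inside
  and outside K.\<close>

lemma walk_switch:
  assumes "altw x L u v" "fib u v" "\<not> conn u v" "K \<subseteq> {..<L}" "mon f"
    and "\<And>y. signed_deg x K y = (if c then 1 else -1) * int (vdeg f y)"
  shows "(\<forall>k\<in>{..<L} - K. even k \<noteq> c) \<or> (\<forall>k\<in>K. even k = c)"
proof -
  have fin: "finite K" using assms(4) finite_subset by blast
  define U where "U c = col x c {..<L}" for c
  have U: "U c = col x c K + col x c ({..<L} - K)" for c
    unfolding U_def using col_union [of K "{..<L} - K" x c] fin assms(4) by (simp add: Un_absorb1)
  have "U True = u" "U False = v" using assms(1) by (auto simp: altw_def U_def)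
  then have f: "fib (U c) (U (\<not> c))" and nc: "\<not> conn (U c) (U (\<not> c))"
    using assms(2,3) fib_sym conn_sym by (cases c; auto)+
  have "vdeg (col x c K) = vdeg (col x (\<not> c) K + f)"
  proof
    fix y show "vdeg (col x c K) y = vdeg (col x (\<not> c) K + f) y"
      using assms(6) [of y] by (cases c) (auto simp: signed_deg_def vdeg_add)
  qed
  then have "col x c ({..<L} - K) = 0 \<or> col x (\<not> c) K = 0"
    using switch [OF f [unfolded U] nc [unfolded U] assms(5)] by simp
  then show ?thesis using fin by (auto simp: col_eq_0)
qed

text \<open>The two colours of an even closed trail have equal degrees, so \<open>switch\<close>
  with f = 0 leaves nothing of u over; then equality of sizes leaves nothing of v.\<close>

lemma closed_trail_complete:
  assumes "fib u v" "\<not> conn u v" "walk x N" "even N" "0 < N" "x N = x 0"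
    and "u = col x True {..<N} + u'" "v = col x False {..<N} + v'"
  shows "altw x N u v"
proof -
  have "vdeg (col x True {..<N}) y = vdeg (col x False {..<N} + 0) y" for y
    using signed_deg_arc [OF assms(3), of 0 N y] assms(4,6) by (simp add: signed_deg_def lessThan_atLeast0)
  then have "u' = 0 \<or> col x False {..<N} = 0"
    using switch [OF assms(1,2)[unfolded assms(7,8)], of 0] by auto
  moreover have "1 < N" using assms(4,5) by (cases "N = 1") auto
  then have "col x False {..<N} \<noteq> 0" by (auto simp: col_eq_0 intro!: bexI [of _ 1])
  ultimately have "u' = 0" by blast
  moreover have "sz v = sz u" using fib_sz [OF assms(1)] by simp
  moreover have "sz (col x True {..<N}) = sz (col x False {..<N})"
  proof -
    have "(\<Sum>y<n. vdeg (col x True {..<N}) y) = (\<Sum>y<n. vdeg (col x False {..<N}) y)"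
      using \<open>\<And>y. vdeg (col x True {..<N}) y = _\<close> by simp
    then show ?thesis by (simp add: sum_vdeg)
  qed
  ultimately have "sz v' = 0" using assms(7,8) by (simp add: sz_add)
  moreover have "mon v'" using assms(1,8) by (simp add: fib_def)
  ultimately show ?thesis using \<open>u' = 0\<close> assms sz_eq_0 by (simp add: altw_def)
qed

lemma altw_exists:
  assumes "fib u v" "\<not> conn u v" "vdeg u y > 0"
  shows "\<exists>x L. altw x L u v \<and> x 0 = y"
proof (rule ccontr)
  assume no: "\<not> ?thesis"
  have "\<exists>x u' v'. walk x N \<and> x 0 = y \<and> u = col x True {..<N} + u' \<and> v = col x False {..<N} + v'" for N
  proof (induction N)
    case 0
    show ?case by (rule exI [of _ "\<lambda>_. y"]) (simp add: walk_def)
  next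
    case (Suc N)
    then obtain x u' v' where x: "walk x N" "x 0 = y" and u': "u = col x True {..<N} + u'"
      and v': "v = col x False {..<N} + v'" by blast
    have nclosed: "even N \<Longrightarrow> 0 < N \<Longrightarrow> x N \<noteq> x 0"
      using no closed_trail_complete [OF assms(1,2) x(1) _ _ _ u' v'] x(2) by blast
    define W where "W c = (if c then u' else v')" for c
    have "int (vdeg u (x N)) = int (vdeg v (x N))" using assms(1) by (simp add: fib_def)
    then have "int (vdeg v' (x N)) - int (vdeg u' (x N)) = signed_deg x {..<N} (x N)"
      by (simp add: u' v' vdeg_add signed_deg_def)
    also have "\<dots> = of_bool (x 0 = x N) - (-1) ^ N"
      using signed_deg_arc [OF x(1), of 0 N "x N"] by (simp add: lessThan_atLeast0)
    \<comment> \<open>u and v have equal degree at the current end, and the trail has used one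
      colour more there; hence an edge of the other colour is left.\<close>
    finally have "vdeg (W (even N)) (x N) > 0"
      using nclosed assms(3) x(2) u' by (cases "N = 0"; cases "even N") (auto simp: W_def of_bool_def split: if_splits)
    then obtain z w where z: "adjacent (x N) z" "W (even N) = w + emon (x N) z"
      using edge_through by blast
    define x' where "x' = x(Suc N := z)"
    have cx: "col x' c {..<N} = col x c {..<N}" for c
      by (rule col_cong) (auto simp: x'_def)
    have cS: "col x' c {..<Suc N} = col x c {..<N} + (if even N = c then emon (x N) z else 0)" for c
      by (simp add: lessThan_Suc col_insert cx) (simp add: x'_def)
    have "walk x' (Suc N)" using x(1) z(1) by (auto simp: walk_def x'_def less_Suc_eq)
    moreover have "x' 0 = y" using x(2) by (simp add: x'_def)
    moreover have "u = col x' True {..<Suc N} + (if even N then w else u')"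
      using u' z(2) by (cases "even N") (simp_all add: cS W_def ac_simps)
    moreover have "v = col x' False {..<Suc N} + (if even N then v' else w)"
      using v' z(2) by (cases "even N") (simp_all add: cS W_def ac_simps)
    ultimately show ?case by blast
  qed
  \<comment> \<open>One step more than u and v have edges, counted with multiplicity.\<close>
  then obtain x u' v' where x: "walk x (Suc (sz u + sz v))"
    "u = col x True {..<Suc (sz u + sz v)} + u'" "v = col x False {..<Suc (sz u + sz v)} + v'" by blast
  have "sz u \<ge> sz (col x True {..<Suc (sz u + sz v)})" "sz v \<ge> sz (col x False {..<Suc (sz u + sz v)})"
    using x(2,3) by (metis sz_add le_add1)+
  then show False using sz_col [OF x(1)] by linarith
qed

section \<open>Induced odd cycles with a tail\<close>

text \<open>Its powers are walks of given length in the subgraph induced on X. Such walks are cut,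
  reversed and joined freely; simplicity comes from minimality alone.\<close>

definition arel :: "nat set \<Rightarrow> nat \<Rightarrow> nat \<Rightarrow> bool" where
  "arel X a b \<longleftrightarrow> adjacent a b \<and> a \<in> X \<and> b \<in> X"

lemma arel_relpow_mono: "(arel X ^^ k) a b \<Longrightarrow> X \<subseteq> Y \<Longrightarrow> (arel Y ^^ k) a b"
  by (erule relpowp_mono [rotated]) (auto simp: arel_def)

lemma relpow_arc:
  fixes q :: "nat \<Rightarrow> 'a"
  assumes "\<And>t. a \<le> t \<Longrightarrow> t < b \<Longrightarrow> R (q t) (q (Suc t))" "a \<le> b"
  shows "(R ^^ (b - a)) (q a) (q b)"
  unfolding relpowp_fun_conv using assms by (intro exI [of _ "\<lambda>t. q (a + t)"]) auto

lemma relpow_join: "(R ^^ i) x y \<Longrightarrow> (R ^^ k) y z \<Longrightarrow> (R ^^ (i + k)) x z"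
  by (auto simp: relpowp_add)

text \<open>The vertices q 0, ..., q (N - 1) induce a path from q 0 to q j and an odd cycle from q j to
q (N - 1) and back.\<close>

definition lolli :: "(nat \<Rightarrow> nat) \<Rightarrow> nat \<Rightarrow> nat \<Rightarrow> bool" where
  "lolli q N j \<longleftrightarrow> j + 3 \<le> N \<and> odd (N - j) \<and> inj_on q {..<N} \<and>
     (\<forall>a b. a < b \<and> b < N \<longrightarrow> (adjacent (q a) (q b) \<longleftrightarrow> b = Suc a \<or> (a = j \<and> b = N - 1)))"

text \<open>A shortest walk from r that ends with an odd loop is an induced path with an induced odd
cycle at its end, as every further edge would shorten it.\<close>

lemma lollipop:
  assumes "(arel X ^^ i0) r y0" "(arel X ^^ k0) y0 y0" "odd k0"
  shows "\<exists>q N j. lolli q N j \<and> q 0 = r \<and> q ` {..<N} \<subseteq> X"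
proof -
  let ?R = "arel X"
  \<comment> \<open>The total length of tail and loop is minimised; minimising the loop alone would
    not control edges between tail and loop.\<close>
  define P where "P N \<longleftrightarrow> (\<exists>i k y. N = i + k \<and> (?R ^^ i) r y \<and> (?R ^^ k) y y \<and> odd k)" for N
  define N where "N = (LEAST N. P N)"
  have "P (i0 + k0)" using assms unfolding P_def by blast
  then have "P N" unfolding N_def by (rule LeastI)
  then obtain j k y where jk: "N = j + k" "(?R ^^ j) r y" "(?R ^^ k) y y" "odd k"
    unfolding P_def by blast
  have no: False if "(?R ^^ i) r z" "(?R ^^ l) z z" "odd l" "i + l < N" for i l z
    using that not_less_Least [of "i + l" P] unfolding P_def N_def by blast
  obtain f where f: "f 0 = r" "f j = y" "\<And>t. t < j \<Longrightarrow> ?R (f t) (f (Suc t))"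
    using jk(2) by (auto simp: relpowp_fun_conv)
  obtain g where g: "g 0 = y" "g k = y" "\<And>t. t < k \<Longrightarrow> ?R (g t) (g (Suc t))"
    using jk(3) by (auto simp: relpowp_fun_conv)
  define q where "q t = (if t \<le> j then f t else g (t - j))" for t
  have q0: "q 0 = r" and qj: "q j = y" "q N = y" using f g jk(1) by (auto simp: q_def)
  have st: "?R (q t) (q (Suc t))" if "t < N" for t
  proof (cases "t < j")
    case True
    then show ?thesis using f by (simp add: q_def)
  next
    case False
    then have "q t = g (t - j)" "q (Suc t) = g (Suc (t - j))"
      using f g by (auto simp: q_def Suc_diff_le)
    then show ?thesis using g(3) [of "t - j"] False that jk(1) by simp
  qed
  have sym: "?R b a" if "?R a b" for a b
    using that by (auto simp: arel_def adj_sym)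
  have fw: "(?R ^^ (b - a)) (q a) (q b)" if "a \<le> b" "b \<le> N" for a b
    by (rule relpow_arc) (use st that in auto)
  have bw: "(?R ^^ (b - a)) (q b) (q a)" if "a \<le> b" "b \<le> N" for a b
  proof -
    have "(?R ^^ ((N - a) - (N - b))) (q (N - (N - b))) (q (N - (N - a)))"
    proof (rule relpow_arc [of "N - b" "N - a" ?R "\<lambda>t. q (N - t)"])
      fix t assume "t < N - a"
      then have t: "t < N" by simp
      then have "N - t = Suc (N - Suc t)" by simp
      then show "?R (q (N - t)) (q (N - Suc t))" using st [of "N - Suc t"] sym t by simp
    qed (use that in auto)
    then show ?thesis using that by simp
  qed
  have one: "(?R ^^ 1) a b" if "?R a b" for a b using that by (simp only: relpowp_1)
  have jN: "j < N" "odd (N - j)" using jk by (auto intro: odd_pos)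
  have "N - j \<noteq> 1"
  proof
    assume "N - j = 1"
    then have "N = Suc j" using jN by simp
    then have "?R y y" using st [of j] qj by simp
    then show False using adj_neq by (auto simp: arel_def)
  qed
  have "N - j \<noteq> 2" using jN(2) by (metis even_numeral)
  then have j3: "j + 3 \<le> N" using \<open>N - j \<noteq> 1\<close> jN by linarith
  have fr: "(?R ^^ t) r (q t)" if "t \<le> N" for t using fw [of 0 t] that q0 by simp
  have loop: "(?R ^^ (N - j)) (q j) (q j)" using fw [of j N] jN qj by simp
  \<comment> \<open>An odd piece between the repetitions is itself a loop closing earlier. An even
    piece is cut out of the loop or the tail; if it contains the junction j, a shorter odd loop at q
    a runs from b on to the end and back along the tail.\<close>
  have nodup: False if ab: "a < b" "b < N" and eq: "q a = q b" for a b
  proof (cases "odd (b - a)")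
    case True
    have "(?R ^^ (b - a)) (q a) (q a)" using fw [of a b] ab eq by simp
    then show False using no [OF fr [of a] _ True] ab by auto
  next
    case False
    consider "j \<le> a" | "b \<le> j" | "a < j" "j < b" by linarith
    then show False
    proof cases
      case 1
      have "(?R ^^ (a - j)) (q j) (q a)" "(?R ^^ (N - b)) (q a) (q j)"
        using fw [of j a] fw [of b N] ab eq 1 qj by simp_all
      note l = relpow_join [OF this]
      have od: "odd ((a - j) + (N - b))" using False jN(2) ab 1 by auto
      show False by (rule no [OF fr l od]) (use 1 ab in \<open>linarith+\<close>)
    next
      case 2
      have "(?R ^^ a) r (q b)" "(?R ^^ (j - b)) (q b) (q j)"
        using fr [of a] fw [of b j] ab eq 2 jN by simp_all
      note l = relpow_join [OF this]
      show False by (rule no [OF l loop jN(2)]) (use 2 ab jN in \<open>linarith+\<close>)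
    next
      case 3
      have "(?R ^^ (N - b)) (q a) (q j)" "(?R ^^ (j - a)) (q j) (q a)"
        using fw [of b N] bw [of a j] ab eq 3 qj by simp_all
      note l = relpow_join [OF this]
      have od: "odd ((N - b) + (j - a))" using False jN(2) ab 3 by auto
      show False by (rule no [OF fr l od]) (use 3 ab in \<open>linarith+\<close>)
    qed
  qed
  \<comment> \<open>With even b - a the chord closes an odd loop; with odd b - a it is a shortcut
    that keeps the parity.\<close>
  have chord: "b = Suc a \<or> (a = j \<and> b = N - 1)" if ab: "a < b" "b < N" and adj: "adjacent (q a) (q b)" for a b
  proof (rule ccontr)
    assume nc: "\<not> ?thesis"
    have "q a \<in> X" "q b \<in> X" using st [of a] st [of b] ab by (auto simp: arel_def)
    then have e: "(?R ^^ 1) (q a) (q b)" "(?R ^^ 1) (q b) (q a)"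
      using adj one sym unfolding arel_def by blast+
    have fra: "(?R ^^ (a + 1)) r (q b)" using relpow_join [OF fr e(1)] ab by simp
    show False
    proof (cases "even (b - a)")
      case True
      have "(?R ^^ (b - a)) (q a) (q b)" using fw ab by simp
      note l = relpow_join [OF this e(2)]
      have o: "odd (b - a + 1)" using True by simp
      \<comment> \<open>The new loop has total length b + 1, so only b = N - 1 survives. There the
        closing edge between q b and q j gives a second way to shorten, unless a = j.\<close>
      have "\<not> b + 1 < N"
      proof
        assume "b + 1 < N"
        then show False by (intro no [OF fr l o]) (use ab in \<open>linarith+\<close>)
      qed
      then have b: "b = N - 1" using ab by simp
      then have aj: "a \<noteq> j" using nc by simp
      have "?R (q b) (q j)" using st [of b] b ab qj by simp
      then have e': "(?R ^^ 1) (q j) (q b)" "(?R ^^ 1) (q b) (q j)"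
        using one sym by blast+
      have par: "even (j + a)" using True jN b ab by presburger
      have "a + 1 \<noteq> j" "j + 1 \<noteq> a" using par by auto
      then consider "a + 2 \<le> j" | "j + 2 \<le> a" using aj by linarith
      then show False
      proof cases
        case 1
        have "(?R ^^ (b - j)) (q b) (q j)" using bw [of j b] b jN by simp
        note l = relpow_join [OF this e'(1)]
        have od: "odd (b - j + 1)" using b jN by presburger
        show False by (rule no [OF fra l od]) (use 1 b jN in \<open>linarith+\<close>)
      next
        case 2
        have "(?R ^^ j) r (q j)" using fr jN by simp
        note p = relpow_join [OF this e'(1)]
        have "(?R ^^ (b - a)) (q b) (q a)" using bw [of a b] ab by simp
        note l = relpow_join [OF this e(1)]
        show False by (rule no [OF p l o]) (use 2 b ab in \<open>linarith+\<close>)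
      qed
    next
      case False
      have b3: "a + 3 \<le> b"
      proof -
        have "b \<noteq> a + 1" using nc by simp
        moreover have "b \<noteq> a + 2" using False by auto
        ultimately show ?thesis using ab by linarith
      qed
      consider "j \<le> a" | "b \<le> j" | "a < j" "j + 2 \<le> b" | "a < j" "b = j + 1" by linarith
      then show False
      proof cases
        case 1
        have "(?R ^^ (a - j)) (q j) (q a)" "(?R ^^ (N - b)) (q b) (q j)"
          using fw [of j a] fw [of b N] ab 1 qj by simp_all
        note l = relpow_join [OF relpow_join [OF this(1) e(1)] this(2)]
        have od: "odd ((a - j) + 1 + (N - b))" using False jN(2) ab 1 by auto
        show False by (rule no [OF fr l od]) (use 1 ab b3 in \<open>linarith+\<close>)
      next
        case 2
        have "(?R ^^ (j - b)) (q b) (q j)" using fw [of b j] 2 jN by simp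
        note p = relpow_join [OF fra this]
        show False by (rule no [OF p loop jN(2)]) (use 2 ab jN b3 in \<open>linarith+\<close>)
      next
        case 3
        have "(?R ^^ (N - b)) (q b) (q j)" "(?R ^^ (j - a)) (q j) (q a)"
          using fw [of b N] bw [of a j] ab 3 qj by simp_all
        note l = relpow_join [OF relpow_join [OF e(1) this(1)] this(2)]
        have od: "odd (1 + (N - b) + (j - a))" using False jN(2) ab 3 by auto
        show False by (rule no [OF fr l od]) (use 3 ab in \<open>linarith+\<close>)
      next
        case 4
        have "(?R ^^ (N - b)) (q b) (q j)" "(?R ^^ (b - j)) (q j) (q b)"
          using fw [of b N] fw [of j b] ab 4 qj by simp_all
        note l = relpow_join [OF this]
        have od: "odd ((N - b) + (b - j))" using 4 ab jN(2) by simp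
        show False by (rule no [OF fra l od]) (use 4 b3 ab in \<open>linarith+\<close>)
      qed
    qed
  qed
  have adjs: "adjacent (q a) (q (Suc a))" if "a < N" for a using st [OF that] by (simp add: arel_def)
  from this [of "N - 1"] have adjl: "adjacent (q j) (q (N - 1))"
    using jN qj adj_sym by simp
  have "lolli q N j"
    unfolding lolli_def
  proof (intro conjI allI impI)
    show "inj_on q {..<N}"
    proof (rule inj_onI)
      fix a b assume "a \<in> {..<N}" "b \<in> {..<N}" "q a = q b"
      then show "a = b" using nodup [of a b] nodup [of b a] by (metis lessThan_iff linorder_neqE_nat)
    qed
    fix a b assume "a < b \<and> b < N"
    then show "adjacent (q a) (q b) \<longleftrightarrow> b = Suc a \<or> (a = j \<and> b = N - 1)"
      using chord [of a b] adjs [of a] adjl by auto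
  qed (use j3 jN in auto)
  moreover have "q ` {..<N} \<subseteq> X" using st by (auto simp: arel_def)
  ultimately show ?thesis using q0 by blast
qed

text \<open>The two tails are glued at their free ends r into the joining path. One tail may be
  trivial, but \<open>0 < j'\<close> keeps the length of the path at least 1.\<close>

lemma two_lollipops:
  assumes q: "lolli q N j" and q': "lolli q' N' j'" and r: "q 0 = r" "q' 0 = r" "0 < j'"
    and inter: "q ` {..<N} \<inter> q' ` {..<N'} = {r}"
    and cross: "\<And>a b. a \<in> q ` {..<N} - {r} \<Longrightarrow> b \<in> q' ` {..<N'} - {r} \<Longrightarrow> \<not> adjacent a b"
  shows "\<not> sharp_condition n m E"
proof -
  define c where "c q N j = map q [j..<N]" for q :: "nat \<Rightarrow> nat" and N j
  have cyc: "is_cycle m E (c q N j) \<and> odd (length (c q N j)) \<and> set (c q N j) = q ` {j..<N} \<and>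
     (\<forall>t. j \<le> t \<and> Suc t < N \<longrightarrow> {q t, q (Suc t)} \<in> cycle_edges (c q N j)) \<and>
     {q j, q (N - 1)} \<in> cycle_edges (c q N j)"
    if l: "lolli q N j" for q N j
  proof -
    have N: "j + 3 \<le> N" "odd (N - j)" "inj_on q {..<N}" using l by (auto simp: lolli_def)
    have len: "length (c q N j) = N - j" by (simp add: c_def)
    have nth: "c q N j ! k = q (j + k)" if "k < N - j" for k using that by (simp add: c_def)
    have adjs: "adjacent (q t) (q (Suc t))" if "Suc t < N" for t using l that by (auto simp: lolli_def)
    have adjl: "adjacent (q (N - 1)) (q j)"
    proof (rule adj_sym)
      have "j < N - 1" "N - 1 < N" using N by auto
      then show "adjacent (q j) (q (N - 1))" using l by (simp add: lolli_def)
    qed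
    have "is_cycle m E (c q N j)"
      unfolding is_cycle_def len
    proof (intro conjI allI impI)
      show "distinct (c q N j)"
        using inj_on_subset [OF N(3), of "{j..<N}"] by (simp add: c_def distinct_map subset_iff)
      show "3 \<le> N - j" using N by simp
      fix k assume k: "k < N - j"
      show "adjacent (c q N j ! k) (c q N j ! ((k + 1) mod (N - j)))"
      proof (cases "k + 1 = N - j")
        case True
        then have "j + k = N - 1" by simp
        then show ?thesis using adjl k N(1) True by (simp add: nth)
      next
        case False
        then show ?thesis using adjs [of "j + k"] k by (simp add: nth)
      qed
    qed
    moreover have "{q t, q (Suc t)} \<in> cycle_edges (c q N j)" if "j \<le> t" "Suc t < N" for t
      unfolding cycle_edges_def len mem_Collect_eq
      using that by (intro exI [of _ "t - j"]) (auto simp: nth)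
    moreover have "{q j, q (N - 1)} \<in> cycle_edges (c q N j)"
    proof -
      have "{q j, q (N - 1)} = {c q N j ! (N - j - 1), c q N j ! ((N - j - 1 + 1) mod (N - j))}"
      proof -
        have "N - j - 1 + 1 = N - j" using N(1) by simp
        then have "(N - j - 1 + 1) mod (N - j) = 0" by (simp only: mod_self)
        moreover have "j + (N - j - 1) = N - 1" using N(1) by simp
        ultimately show ?thesis using N(1) nth [of 0] nth [of "N - j - 1"] by (auto simp: insert_commute)
      qed
      moreover have "N - j - 1 < N - j" using N(1) by simp
      ultimately show ?thesis unfolding cycle_edges_def len by blast
    qed
    ultimately show ?thesis using N(2) len by (auto simp: c_def)
  qed
  let ?c1 = "c q N j" and ?c2 = "c q' N' j'"
  \<comment> \<open>Backwards along the first tail to r, then out along the second.\<close>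
  define g where "g t = (if t \<le> j then q (j - t) else q' (t - j))" for t
  define p where "p = map g [0..<Suc (j + j')]"
  have N: "j + 3 \<le> N" "inj_on q {..<N}" "j' + 3 \<le> N'" "inj_on q' {..<N'}"
    using q q' by (auto simp: lolli_def)
  have adjq: "adjacent (q t) (q (Suc t))" if "Suc t < N" for t using q that by (auto simp: lolli_def)
  have adjq': "adjacent (q' t) (q' (Suc t))" if "Suc t < N'" for t using q' that by (auto simp: lolli_def)
  have ne: "q a \<noteq> q' b" if "a < N" "b < N'" "0 < b" for a b
  proof
    assume "q a = q' b"
    then have "q' b \<in> q ` {..<N}" using that by (metis imageI lessThan_iff)
    moreover have "q' b \<in> q' ` {..<N'}" using that by simp
    ultimately have "q' b \<in> {r}" unfolding inter [symmetric] by (rule IntI)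
    then have "q' b = q' 0" using r by simp
    then show False using inj_onD [OF N(4), of b 0] that by auto
  qed
  have gs: "adjacent (g t) (g (Suc t))" if "t < j + j'" for t
  proof -
    consider "t < j" | "t = j" | "j < t" by linarith
    then show ?thesis
    proof cases
      case 1
      then have "j - t = Suc (j - Suc t)" by simp
      then show ?thesis using adj_sym [OF adjq [of "j - Suc t"]] 1 N(1) by (simp add: g_def)
    next
      case 2
      then show ?thesis using adjq' [of 0] r N(3) that by (simp add: g_def)
    next
      case 3
      then show ?thesis using adjq' [of "t - j"] N(3) that by (simp add: g_def Suc_diff_le)
    qed
  qed
  have ginj: "inj_on g {..<Suc (j + j')}"
  proof (rule inj_onI)
    fix s t assume st: "s \<in> {..<Suc (j + j')}" "t \<in> {..<Suc (j + j')}" and eq: "g s = g t"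
    consider "s \<le> j" "t \<le> j" | "s \<le> j" "j < t" | "j < s" "t \<le> j" | "j < s" "j < t" by linarith
    then show "s = t"
    proof cases
      case 1
      then have "j - s = j - t" using eq N(1,2) by (auto simp: g_def inj_on_def)
      then show ?thesis using 1 by simp
    next
      case 2
      have "j - s < N" "t - j < N'" "0 < t - j" using st N(1,3) 2 by auto
      from ne [OF this] show ?thesis using eq 2 by (simp add: g_def)
    next
      case 3
      have "j - t < N" "s - j < N'" "0 < s - j" using st N(1,3) 3 by auto
      from ne [OF this] show ?thesis using eq 3 by (simp add: g_def)
    next
      case 4
      then have "s - j = t - j" using eq st N(3,4) by (auto simp: g_def inj_on_def)
      then show ?thesis using 4 by simp
    qed
  qed
  have path: "is_path m E p"
    unfolding is_path_def
  proof (intro conjI allI impI)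
    show "distinct p" using ginj by (simp add: p_def distinct_map atLeast0LessThan del: upt_Suc)
    show "p \<noteq> []" by (simp add: p_def)
    fix k assume k: "k + 1 < length p"
    then have "p ! k = g k" "p ! (k + 1) = g (Suc k)" by (simp_all add: p_def del: upt_Suc)
    then show "adjacent (p ! k) (p ! (k + 1))" using gs k by (simp add: p_def)
  qed
  have pe: "{g t, g (Suc t)} \<in> path_edges p" if "t < j + j'" for t
    unfolding path_edges_def mem_Collect_eq
    using that by (intro exI [of _ t]) (auto simp: p_def simp del: upt_Suc)
  have pe1: "{q t, q (Suc t)} \<in> path_edges p" if "t < j" for t
    using pe [of "j - Suc t"] that by (simp add: g_def insert_commute Suc_diff_Suc)
  have pe2: "{q' t, q' (Suc t)} \<in> path_edges p" if "t < j'" for t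
    using pe [of "j + t"] that r by (cases "t = 0") (auto simp: g_def)
  have setp: "set p = q ` {..j} \<union> q' ` {..j'}"
  proof
    show "set p \<subseteq> q ` {..j} \<union> q' ` {..j'}" by (auto simp: p_def g_def simp del: upt_Suc)
    show "q ` {..j} \<union> q' ` {..j'} \<subseteq> set p"
    proof
      fix x assume "x \<in> q ` {..j} \<union> q' ` {..j'}"
      then consider t where "t \<le> j" "x = q t" | t where "t \<le> j'" "x = q' t" by auto
      then have "\<exists>s\<le>j + j'. x = g s"
      proof cases
        case 1
        then show ?thesis by (intro exI [of _ "j - t"]) (simp add: g_def)
      next
        case 2
        then show ?thesis using r by (intro exI [of _ "j + t"]) (simp add: g_def)
      qed
      then show "x \<in> set p" by (auto simp: p_def image_iff less_Suc_eq_le simp del: upt_Suc)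
    qed
  qed
  have hd: "hd p = q j" by (simp add: p_def g_def hd_map del: upt_Suc)
  have last: "last p = q' j'" using r(3) by (simp add: p_def g_def)
  have sets: "set ?c1 \<union> set ?c2 \<union> set p = q ` {..<N} \<union> q' ` {..<N'}"
  proof -
    have "{..<N} = {j..<N} \<union> {..j}" "{..<N'} = {j'..<N'} \<union> {..j'}" using N by auto
    then show ?thesis using cyc [OF q] cyc [OF q'] setp by (auto simp: image_Un)
  qed
  have mem: "{x, y} \<in> cycle_edges ?c1 \<union> cycle_edges ?c2 \<union> path_edges p"
    if xy: "x \<in> q ` {..<N} \<union> q' ` {..<N'}" "y \<in> q ` {..<N} \<union> q' ` {..<N'}" "adjacent x y" for x y
  proof -
    have e1: "{q a, q b} \<in> cycle_edges ?c1 \<union> cycle_edges ?c2 \<union> path_edges p"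
      if "a < b" "b < N" "adjacent (q a) (q b)" for a b
    proof -
      have "b = Suc a \<or> a = j \<and> b = N - 1" using q that unfolding lolli_def by blast
      then show ?thesis using cyc [OF q] pe1 [of a] that by (cases "a < j") auto
    qed
    have e2: "{q' a, q' b} \<in> cycle_edges ?c1 \<union> cycle_edges ?c2 \<union> path_edges p"
      if "a < b" "b < N'" "adjacent (q' a) (q' b)" for a b
    proof -
      have "b = Suc a \<or> a = j' \<and> b = N' - 1" using q' that unfolding lolli_def by blast
      then show ?thesis using cyc [OF q'] pe2 [of a] that by (cases "a < j'") auto
    qed
    have rr: "r \<in> q ` {..<N}" "r \<in> q' ` {..<N'}" using inter by auto
    have nocross: False
      if "a \<in> q ` {..<N}" "b \<in> q' ` {..<N'}" "a \<notin> q' ` {..<N'}" "b \<notin> q ` {..<N}" "adjacent a b" for a b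
    proof -
      have "a \<noteq> r" "b \<noteq> r" using that rr by metis+
      then show False using cross [of a b] that by blast
    qed
    consider "x \<in> q ` {..<N}" "y \<in> q ` {..<N}" | "x \<in> q' ` {..<N'}" "y \<in> q' ` {..<N'}"
      using xy(1,2) nocross [OF _ _ _ _ xy(3)] nocross [OF _ _ _ _ adj_sym [OF xy(3)]] by blast
    then show ?thesis
    proof cases
      case 1
      then obtain a b where ab: "a < N" "b < N" "x = q a" "y = q b" by auto
      have "a \<noteq> b" using adj_neq [OF xy(3)] ab by auto
      then consider "a < b" | "b < a" by linarith
      then show ?thesis
      proof cases
        case 1
        then show ?thesis using e1 [of a b] ab xy(3) by simp
      next
        case 2
        then show ?thesis using e1 [of b a] ab adj_sym [OF xy(3)] by (simp add: insert_commute)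
      qed
    next
      case 2
      then obtain a b where ab: "a < N'" "b < N'" "x = q' a" "y = q' b" by auto
      have "a \<noteq> b" using adj_neq [OF xy(3)] ab by auto
      then consider "a < b" | "b < a" by linarith
      then show ?thesis
      proof cases
        case 1
        then show ?thesis using e2 [of a b] ab xy(3) by simp
      next
        case 2
        then show ?thesis using e2 [of b a] ab adj_sym [OF xy(3)] by (simp add: insert_commute)
      qed
    qed
  qed
  have edge_adj: "adjacent x y" if "{x, y} \<in> cycle_edges ?c1 \<union> cycle_edges ?c2 \<union> path_edges p" for x y
  proof -
    have ce: "\<exists>a b. {x, y} = {a, b} \<and> adjacent a b" if "is_cycle m E c" "{x, y} \<in> cycle_edges c" for c
      using that unfolding cycle_edges_def is_cycle_def by blast
    have pe: "\<exists>a b. {x, y} = {a, b} \<and> adjacent a b" if "{x, y} \<in> path_edges p"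
      using that path unfolding path_edges_def is_path_def by blast
    have "\<exists>a b. {x, y} = {a, b} \<and> adjacent a b"
      using that ce [of ?c1] ce [of ?c2] pe cyc [OF q] cyc [OF q'] by blast
    then show ?thesis using adj_sym by (auto simp: doubleton_eq_iff)
  qed
  have c_disj: "set ?c1 \<inter> set ?c2 = {}"
    using cyc [OF q] cyc [OF q'] ne r(3) by fastforce
  have ends: "hd p \<in> set ?c1" "last p \<in> set ?c2"
    using cyc [OF q] cyc [OF q'] N by (auto simp: hd last)
  have p_inter: "set p \<inter> (set ?c1 \<union> set ?c2) = {hd p, last p}"
  proof
    show "{hd p, last p} \<subseteq> set p \<inter> (set ?c1 \<union> set ?c2)"
      using ends setp by (auto simp: hd last)
    show "set p \<inter> (set ?c1 \<union> set ?c2) \<subseteq> {hd p, last p}"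
    proof
      fix x assume x: "x \<in> set p \<inter> (set ?c1 \<union> set ?c2)"
      have s: "set ?c1 = q ` {j..<N}" "set ?c2 = q' ` {j'..<N'}" using cyc [OF q] cyc [OF q'] by auto
      consider a b where "a \<le> j" "x = q a" "j \<le> b" "b < N" "x = q b"
        | a b where "a \<le> j" "x = q a" "j' \<le> b" "b < N'" "x = q' b"
        | a b where "a \<le> j'" "0 < a" "x = q' a" "j \<le> b" "b < N" "x = q b"
        | a b where "a \<le> j'" "x = q' a" "j' \<le> b" "b < N'" "x = q' b"
        using x r unfolding setp s by (auto simp: image_iff) (metis gr0I le0)
      then show "x \<in> {hd p, last p}"
      proof cases
        case 1
        then have "a = b" using N(1,2) by (auto simp: inj_on_def)
        then show ?thesis using 1 hd by simp
      next
        case 2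
        then show ?thesis using ne [of a b] r(3) N by simp
      next
        case 3
        then show ?thesis using ne [of b a] N by simp
      next
        case 4
        then have "a = b" using N(3,4) by (auto simp: inj_on_def)
        then show ?thesis using 4 last by simp
      qed
    qed
  qed
  have p_len: "2 \<le> length p" using r(3) by (simp add: p_def)
  have induced: "\<forall>x\<in>set ?c1 \<union> set ?c2 \<union> set p. \<forall>y\<in>set ?c1 \<union> set ?c2 \<union> set p.
      adjacent x y \<longleftrightarrow> {x, y} \<in> cycle_edges ?c1 \<union> cycle_edges ?c2 \<union> path_edges p"
    unfolding sets using mem edge_adj by (intro ballI iffI)
  show ?thesis
    unfolding sharp_condition_def not_not
    using cyc [OF q] cyc [OF q'] path c_disj ends p_inter p_len induced
    by (intro exI [of _ ?c1] exI [of _ ?c2] exI [of _ p]) simp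
qed

text \<open>Inside Y, the set \<open>X1\<close> is attached to the rest only at r1, and
  \<open>X2\<close> only at r2. One lollipop is taken from r1 inside \<open>X1\<close>, the other
  from r1 inside \<open>X2\<close> together with a shortest path to r2.\<close>

lemma two_cuts:
  assumes r: "r1 \<in> X1" "r2 \<in> X2" "X1 \<inter> X2 = {}" "X1 \<subseteq> Y" "X2 \<subseteq> Y"
    and out1: "\<And>a b. a \<in> X1 - {r1} \<Longrightarrow> b \<in> Y \<Longrightarrow> adjacent a b \<Longrightarrow> b \<in> X1"
    and out2: "\<And>a b. a \<in> X2 - {r2} \<Longrightarrow> b \<in> Y \<Longrightarrow> adjacent a b \<Longrightarrow> b \<in> X2"
    and odd1: "(arel X1 ^^ k1) r1 r1" "odd k1"
    and odd2: "(arel X2 ^^ k2) r2 r2" "odd k2"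
    and con: "(arel Y ^^ d0) r1 r2"
  shows "\<not> sharp_condition n m E"
proof -
  define d where "d = (LEAST d. (arel Y ^^ d) r1 r2)"
  have "(arel Y ^^ d) r1 r2" unfolding d_def using con by (rule LeastI)
  then obtain w where w: "w 0 = r1" "w d = r2" "\<And>t. t < d \<Longrightarrow> arel Y (w t) (w (Suc t))"
    by (auto simp: relpowp_fun_conv)
  have short: False if "(arel Y ^^ e) r1 r2" "e < d" for e
    using that not_less_Least unfolding d_def by blast
  have seg: "(arel Y ^^ (d - t)) (w t) r2" if "t \<le> d" for t
    using relpow_arc [of t d "arel Y" w] w that by auto
  have d0: "0 < d" using w r by (cases "d = 0") auto
  have wY: "w t \<in> Y" if "t \<le> d" for t
    using w(2) w(3) [of t] r that by (cases "t = d") (auto simp: arel_def)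
  have w_ne: "w t \<noteq> r1" if "0 < t" "t \<le> d" for t
    using short [of "d - t"] seg [OF that(2)] that by auto
  \<comment> \<open>A shortest path does not return to r1, the only exit of \<open>X1\<close>, so
    once back in \<open>X1\<close> it would stay there and end at r2 in \<open>X1\<close>.\<close>
  have wX1: "w t \<notin> X1" if "0 < t" "t \<le> d" for t
  proof
    assume t: "w t \<in> X1"
    have "w s \<in> X1" if "t \<le> s" "s \<le> d" for s
      using that
    proof (induction s rule: dec_induct)
      case base
      then show ?case using t by simp
    next
      case (step s)
      have "w s \<in> X1 - {r1}" using w_ne [of s] step \<open>0 < t\<close> by simp
      moreover have "adjacent (w s) (w (Suc s))" "w (Suc s) \<in> Y"
        using w(3) [of s] step.prems by (simp_all add: arel_def)
      ultimately show ?case by (intro out1 [of "w s"])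
    qed
    then show False using w(2) r \<open>t \<le> d\<close> by blast
  qed
  define Z where "Z = X2 \<union> w ` {..d}"
  have ZY: "Z \<subseteq> Y" using r wY by (auto simp: Z_def)
  have XZ: "X1 \<inter> Z = {r1}"
  proof
    show "X1 \<inter> Z \<subseteq> {r1}"
    proof
      fix a assume a: "a \<in> X1 \<inter> Z"
      then have "a \<notin> X2" using r(3) by auto
      then obtain t where "t \<le> d" "a = w t" using a by (auto simp: Z_def)
      then have "t = 0" using wX1 [of t] a by auto
      then show "a \<in> {r1}" using w(1) \<open>a = w t\<close> by simp
    qed
    show "{r1} \<subseteq> X1 \<inter> Z" using r w(1) by (auto simp: Z_def image_iff intro: bexI [of _ 0])
  qed
  \<comment> \<open>Hence r1 has only one neighbour in Z and cannot lie on a cycle there, which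
    gives the second lollipop a proper tail.\<close>
  have nbr: "b = w 1" if "b \<in> Z" "adjacent r1 b" for b
  proof (cases "b \<in> X2 - {r2}")
    case True
    then have "r1 \<in> X2" using out2 [of b r1] r that adj_sym by blast
    then show ?thesis using r by blast
  next
    case False
    have "b = w d \<or> b \<in> w ` {..d}" using False that(1) w(2) by (auto simp: Z_def)
    then obtain t where t: "t \<le> d" "b = w t" by auto
    have "t \<noteq> 0" using t(2) adj_neq [OF that(2)] w(1) by (cases "t = 0") auto
    moreover have "\<not> 2 \<le> t"
    proof
      assume "2 \<le> t"
      have "arel Y r1 b" using that ZY r by (auto simp: arel_def)
      then have "(arel Y ^^ (1 + (d - t))) r1 r2"
        using relpow_join [of 1 "arel Y" r1 b] seg [OF t(1)] t(2) by (simp only: relpowp_1)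
      then show False by (rule short) (use \<open>2 \<le> t\<close> t(1) in linarith)
    qed
    ultimately have "t = 1" by linarith
    then show ?thesis using t by simp
  qed
  obtain q N j where q: "lolli q N j" "q 0 = r1" "q ` {..<N} \<subseteq> X1"
    using lollipop [of 0 X1 r1 r1 k1] odd1 by auto
  have "(arel Z ^^ d) r1 r2"
    unfolding relpowp_fun_conv using w by (intro exI [of _ w]) (auto simp: arel_def Z_def)
  then obtain q' N' j' where q': "lolli q' N' j'" "q' 0 = r1" "q' ` {..<N'} \<subseteq> Z"
    using lollipop [of d Z r1 r2 k2] arel_relpow_mono [OF odd2(1), of Z] odd2(2) by (auto simp: Z_def)
  have N: "j + 3 \<le> N" "j' + 3 \<le> N'" using q q' by (auto simp: lolli_def)
  have "0 < j'"
  proof (rule ccontr)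
    assume "\<not> 0 < j'"
    then have "j' = 0" by simp
    have "adjacent (q' 0) (q' 1)" "adjacent (q' 0) (q' (N' - 1))"
      using q'(1) N(2) \<open>j' = 0\<close> by (auto simp: lolli_def)
    moreover have "q' 1 \<in> Z" "q' (N' - 1) \<in> Z" using q'(3) N(2) by auto
    ultimately have eq: "q' 1 = q' (N' - 1)" using nbr [of "q' 1"] nbr [of "q' (N' - 1)"] q'(2) by simp
    have inj: "inj_on q' {..<N'}" using q'(1) by (simp add: lolli_def)
    have "1 = N' - 1" by (rule inj_onD [OF inj eq]) (use N(2) in auto)
    then show False using N(2) by linarith
  qed
  moreover have "q ` {..<N} \<inter> q' ` {..<N'} = {r1}"
  proof -
    have "q 0 \<in> q ` {..<N}" "q' 0 \<in> q' ` {..<N'}" using N by auto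
    then show ?thesis using XZ q q' by auto
  qed
  moreover have "\<not> adjacent a b" if "a \<in> q ` {..<N} - {r1}" "b \<in> q' ` {..<N'} - {r1}" for a b
  proof
    assume ad: "adjacent a b"
    have "a \<in> X1 - {r1}" "b \<in> Z" "b \<noteq> r1" using that q(3) q'(3) by auto
    then have "b \<in> X1" using out1 [of a b] ad ZY by auto
    then show False using XZ \<open>b \<in> Z\<close> \<open>b \<noteq> r1\<close> by auto
  qed
  ultimately show ?thesis using two_lollipops [OF q(1) q'(1) q(2) q'(2)] by blast
qed

section \<open>The walk between two classes of a fibre\<close>

text \<open>The edges at even positions pair up the positions 0, ..., L - 1, so each visit of y
  contributes exactly 1.\<close>

lemma vdeg_visits:
  assumes "walk x L" "even L"
  shows "vdeg (col x True {..<L}) y = card {k. k < L \<and> x k = y}"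
proof -
  have "walk x (2 * s) \<Longrightarrow> vdeg (col x True {..<2 * s}) y = (\<Sum>k<2 * s. of_bool (x k = y))" for s
  proof (induction s)
    case (Suc s)
    have "{..<2 * Suc s} = insert (Suc (2 * s)) (insert (2 * s) {..<2 * s})" by auto
    moreover have "adjacent (x (2 * s)) (x (Suc (2 * s)))" using Suc.prems by (simp add: walk_def)
    ultimately show ?case using Suc by (simp add: col_insert vdeg_add vdeg_emon walk_def)
  qed simp
  then have "vdeg (col x True {..<L}) y = (\<Sum>k<L. of_bool (x k = y))"
    using assms by (metis dvd_def)
  also have "\<dots> = card ({..<L} \<inter> {k. x k = y})" by (simp add: of_bool_def sum.If_cases)
  also have "{..<L} \<inter> {k. x k = y} = {k. k < L \<and> x k = y}" by auto
  finally show ?thesis .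
qed

end

locale crit_walk = fin_graph n m E for n m E +
  fixes x :: "nat \<Rightarrow> nat" and L :: nat and u v :: expo
  assumes altw: "altw x L u v" and fuv: "fib u v" and nc: "\<not> conn u v"
begin

lemma walkx: "walk x L" and evenL: "even L" and posL: "0 < L" and xL: "x L = x 0"
  and u_col: "u = col x True {..<L}" and v_col: "v = col x False {..<L}"
  using altw by (auto simp: altw_def)

lemma adj_step: "k < L \<Longrightarrow> adjacent (x k) (x (Suc k))"
  using walkx by (simp add: walk_def)

lemma vdeg_u: "vdeg u y = card {k. k < L \<and> x k = y}"
  using vdeg_visits [OF walkx evenL] u_col by simp

text \<open>\<open>walk_switch\<close> with explicit witnesses: p, p' of both parities inside K and
  r, r' of both parities outside.\<close>

lemma switch_False:
  assumes "\<forall>k\<in>K. k < L" "mon f"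
    and "(\<forall>y. signed_deg x K y = int (vdeg f y)) \<or> (\<forall>y. signed_deg x K y = - int (vdeg f y))"
    and "p \<in> K" "p' \<in> K" "even p \<noteq> even p'"
    and "r < L" "r' < L" "r \<notin> K" "r' \<notin> K" "even r \<noteq> even r'"
  shows False
proof -
  obtain c where c: "\<And>y. signed_deg x K y = (if c then 1 else -1) * int (vdeg f y)"
  proof (cases "\<forall>y. signed_deg x K y = int (vdeg f y)")
    case True
    then show ?thesis using that [of True] by simp
  next
    case False
    then have "\<forall>y. signed_deg x K y = - int (vdeg f y)" using assms(3) by blast
    then show ?thesis using that [of False] by simp
  qed
  have "K \<subseteq> {..<L}" using assms(1) by auto
  from walk_switch [OF altw fuv nc this assms(2) c]
  show False
  proof
    assume a: "\<forall>k\<in>{..<L} - K. even k \<noteq> c"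
    then have "even r \<noteq> c" "even r' \<noteq> c" using assms by auto
    then show False using assms(11) by blast
  next
    assume "\<forall>k\<in>K. even k = c"
    then have "even p = c" "even p' = c" using assms by auto
    then show False using assms(6) by blast
  qed
qed

section \<open>Forbidden revisits and chords of the walk\<close>

lemma signed_deg_arc1: "a \<le> b \<Longrightarrow> b \<le> L \<Longrightarrow>
    signed_deg x {a..<b} y = (-1) ^ a * of_bool (x a = y) - (-1) ^ b * of_bool (x b = y)"
  by (rule signed_deg_arc [OF walkx])

lemma signed_deg_arc2: "a \<le> b \<Longrightarrow> b \<le> c \<Longrightarrow> c \<le> d \<Longrightarrow> d \<le> L \<Longrightarrow>
    signed_deg x ({a..<b} \<union> {c..<d}) y = (-1) ^ a * of_bool (x a = y) - (-1) ^ b * of_bool (x b = y)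
      + ((-1) ^ c * of_bool (x c = y) - (-1) ^ d * of_bool (x d = y))"
  using signed_deg_union [of "{a..<b}" "{c..<d}" x y] by (simp add: signed_deg_arc1)

text \<open>A closed arc of even length has alternating degree 0, so f = 0 works.\<close>

lemma revisit_odd:
  assumes "a < b" "b < L" "x a = x b"
  shows "even a \<noteq> even b"
proof
  assume par: "even a = even b"
  have s: "signed_deg x {a..<b} y = int (vdeg 0 y)" for y
    using signed_deg_arc1 [of a b y] assms par by (cases "even a") auto
  have "Suc a < b" using assms(1) par by (cases "b = Suc a") auto
  then have p: "a \<in> {a..<b}" "Suc a \<in> {a..<b}" by auto
  \<comment> \<open>Outside the arc, b and its successor have both parities; if b is the last
    position, a - 1 replaces the successor.\<close>
  show False
  proof (cases "Suc b < L")
    case True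
    show False
      using switch_False [of "{a..<b}" 0 a "Suc a" b "Suc b"] s p assms True by auto
  next
    case False
    then have b: "L = Suc b" using assms by simp
    then have "odd a" using evenL par by auto
    then obtain a' where a': "a = Suc a'" by (cases a) auto
    show False
      using switch_False [of "{a..<b}" 0 a "Suc a" b a'] s p assms \<open>odd a\<close> par a' by auto
  qed
qed

text \<open>By \<open>revisit_odd\<close> the ends of the arcs from i to k and from j to l cancel in
  pairs, so f = 0 works.\<close>

lemma revisit_no_cross:
  assumes "i < k" "k < j" "j < l" "l < L" "x i = x j" "x k = x l"
  shows False
proof -
  have p: "even i \<noteq> even j" "even k \<noteq> even l"
    using revisit_odd [of i j] revisit_odd [of k l] assms by auto
  let ?K = "{i..<k} \<union> {j..<l}"
  have s: "signed_deg x ?K y = int (vdeg 0 y)" for y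
    using signed_deg_arc2 [of i k j l y] assms p by (cases "even i"; cases "even k") auto
  have bd: "\<forall>t\<in>?K. t < L" using assms by auto
  show False
    by (rule switch_False [OF bd, of 0 i j k l]) (use s p assms in auto)
qed

text \<open>At ends of opposite parity an arc has the alternating degree of its chord up to sign.
  The two exceptions are the positions joined by an edge of the walk.\<close>

lemma chord_consecutive:
  assumes "a < b" "b < L" "even a \<noteq> even b" "adjacent (x a) (x b)"
  shows "b = Suc a \<or> (a = 0 \<and> b = L - 1)"
proof (rule ccontr)
  assume no: "\<not> ?thesis"
  let ?f = "emon (x a) (x b)"
  have s: "signed_deg x {a..<b} y = (-1) ^ a * int (vdeg ?f y)" for y
    using signed_deg_arc1 [of a b y] assms by (cases "even a") (auto simp: vdeg_emon)
  then have s': "(\<forall>y. signed_deg x {a..<b} y = int (vdeg ?f y)) \<or> (\<forall>y. signed_deg x {a..<b} y = - int (vdeg ?f y))"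
    by (cases "even a") auto
  have p: "a \<in> {a..<b}" "Suc a \<in> {a..<b}" using no assms(1) by auto
  show False
  proof (cases "Suc b < L")
    case True
    show False
      using switch_False [of "{a..<b}" ?f a "Suc a" b "Suc b"] s' p assms True mon_emon by auto
  next
    case False
    then have b: "L = Suc b" using assms by simp
    have "a \<noteq> 0" using no b by auto
    moreover have "even a" using b evenL assms(3) by auto
    ultimately obtain a' where a': "a = Suc (Suc a')" by (auto elim!: evenE) (metis Suc_1 add_2_eq_Suc gr0_implies_Suc mult_Suc_right)
    show False
      by (rule switch_False [of "{a..<b}" ?f a "Suc a" b a'])
         (use s' p assms a' mon_emon [OF assms(4)] in auto)
  qed
qed

text \<open>The ends i and j cancel, so the arcs from i to a and from j to b together balance the
  chord; its ends have equal parity by \<open>chord_consecutive\<close>.\<close>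

lemma chord_no_cross_right:
  assumes "i < a" "a < j" "j < b" "b < L" "x i = x j" "adjacent (x a) (x b)"
  shows False
proof -
  have p: "even i \<noteq> even j" using revisit_odd [of i j] assms by auto
  have ab: "even a = even b" using chord_consecutive [of a b] assms by auto
  let ?K = "{i..<a} \<union> {j..<b}" and ?f = "emon (x a) (x b)"
  have "signed_deg x ?K y = - ((-1) ^ a * int (vdeg ?f y))" for y
    using signed_deg_arc2 [of i a j b y] assms p ab by (cases "even i"; cases "even a") (auto simp: vdeg_emon)
  then have s: "(\<forall>y. signed_deg x ?K y = int (vdeg ?f y)) \<or> (\<forall>y. signed_deg x ?K y = - int (vdeg ?f y))"
    by (cases "even a") auto
  \<comment> \<open>Position a is one outside witness. The second is next to a or to b, or before i
    when both of these places are blocked.\<close>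
  have "\<exists>r<L. r \<notin> ?K \<and> even r \<noteq> even a"
  proof -
    consider "Suc a < j" | "Suc b < L" | "j = Suc a" "L = Suc b" using assms by linarith
    then show ?thesis
    proof cases
      case 1
      then show ?thesis using assms by (intro exI [of _ "Suc a"]) auto
    next
      case 2
      then show ?thesis using assms ab by (intro exI [of _ "Suc b"]) auto
    next
      case 3
      then have "odd i" "odd a" using p ab evenL by auto
      then show ?thesis using odd_pos [of i] assms by (intro exI [of _ "i - 1"]) auto
    qed
  qed
  then obtain r where r: "r < L" "r \<notin> ?K" "even r \<noteq> even a" by blast
  have bd: "\<forall>t\<in>?K. t < L" using assms by auto
  show False
    by (rule switch_False [OF bd mon_emon [OF assms(6)] s, of i j a r]) (use r p assms in auto)
qed

text \<open>Mirror image of \<open>chord_no_cross_right\<close>. Now i and j are the outside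
  witnesses, and the second inside witness has to be found.\<close>

lemma chord_no_cross_left:
  assumes "b < i" "i < a" "a < j" "j < L" "x i = x j" "adjacent (x a) (x b)"
  shows False
proof -
  have p: "even i \<noteq> even j" using revisit_odd [of i j] assms by auto
  have ab: "even b = even a"
  proof (rule ccontr)
    assume "even b \<noteq> even a"
    then have "a = Suc b \<or> b = 0 \<and> a = L - 1"
      using chord_consecutive [OF _ _ _ adj_sym [OF assms(6)]] assms(1-4) by simp
    then show False using assms by auto
  qed
  let ?K = "{b..<i} \<union> {a..<j}" and ?f = "emon (x a) (x b)"
  have "signed_deg x ?K y = (-1) ^ a * int (vdeg ?f y)" for y
    using signed_deg_arc2 [of b i a j y] assms p ab by (cases "even i"; cases "even a") (auto simp: vdeg_emon)
  then have s: "(\<forall>y. signed_deg x ?K y = int (vdeg ?f y)) \<or> (\<forall>y. signed_deg x ?K y = - int (vdeg ?f y))"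
    by (cases "even a") auto
  have "\<exists>r. r \<in> ?K \<and> even r \<noteq> even a"
  proof -
    consider "Suc b < i" | "Suc a < j" | "i = Suc b" "j = Suc a" using assms by linarith
    then show ?thesis
    proof cases
      case 1
      then show ?thesis using assms ab by (intro exI [of _ "Suc b"]) auto
    next
      case 2
      then show ?thesis using assms by (intro exI [of _ "Suc a"]) auto
    next
      case 3
      then show ?thesis using p ab by auto
    qed
  qed
  then obtain r where r: "r \<in> ?K" "even r \<noteq> even a" by blast
  have bd: "\<forall>t\<in>?K. t < L" using assms by auto
  show False
    by (rule switch_False [OF bd mon_emon [OF assms(6)] s, of a r i j]) (use r p assms in auto)
qed

text \<open>Three positions cannot have pairwise different parities.\<close>

lemma no_triple:
  assumes "a < L" "b < L" "c < L" "x a = x b" "x b = x c" "a \<noteq> b" "b \<noteq> c" "a \<noteq> c"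
  shows False
proof -
  have "even p \<noteq> even q" if "p < L" "q < L" "x p = x q" "p \<noteq> q" for p q
    using revisit_odd [of p q] revisit_odd [of q p] that by (cases "p < q") auto
  from this [of a b] this [of b c] this [of a c] show False using assms by auto
qed

lemma walk_arel: "a \<le> b \<Longrightarrow> b \<le> L \<Longrightarrow> x ` {a..b} \<subseteq> X \<Longrightarrow> (arel X ^^ (b - a)) (x a) (x b)"
  by (rule relpow_arc) (auto simp: arel_def adj_step)

text \<open>Since revisits do not cross, the odd loop from k to l misses one of the two odd loops at
  x 0. No chord leaves either loop except at its base, so \<open>two_cuts\<close> applies.\<close>

lemma two_revisits:
  assumes j: "0 < j" "j < L" "x j = x 0" and kl: "0 < k" "k < l" "l < L" "x k = x l"
    and ne: "k \<noteq> j" "l \<noteq> j"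
  shows "\<not> sharp_condition n m E"
proof -
  have xb: "x b \<noteq> x 0" if "0 < b" "b < L" "b \<noteq> j" for b
    using no_triple [of 0 j b] that j posL by auto
  have oj: "odd j" using revisit_odd [of 0 j] j by auto
  have okl: "odd (l - k)" using revisit_odd [of k l] kl by auto
  have "\<not> (k < j \<and> j < l)" using revisit_no_cross [of 0 k j l] j kl by auto
  then consider "l < j" | "j < k" using ne by linarith
  \<comment> \<open>The arc from p to q is the loop at x 0 that avoids k and l: from j to L, or from
    0 to j. The escape b = 0 is harmless because x 0 belongs to the loop.\<close>
  then obtain p q where pq: "p \<le> q" "q \<le> L" "x p = x 0" "x q = x 0" "odd (q - p)"
    and apart: "\<And>t. k \<le> t \<Longrightarrow> t \<le> l \<Longrightarrow> 0 < t \<and> t \<noteq> j \<and> (t < p \<or> q < t)"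
    and chord: "\<And>a b. p < a \<Longrightarrow> a < q \<Longrightarrow> b < L \<Longrightarrow> b < p \<or> q < b \<Longrightarrow> adjacent (x a) (x b) \<Longrightarrow> b = 0"
    and merge: "\<And>a b. p < a \<Longrightarrow> a < q \<Longrightarrow> b < L \<Longrightarrow> b < p \<or> q < b \<Longrightarrow> x a = x b \<Longrightarrow> b = 0"
  proof cases
    case 1
    have "b = 0" if "j < a" "a < L" "b < L" "b < j \<or> L < b" "adjacent (x a) (x b)" for a b
      using chord_no_cross_right [of 0 b j a] that j adj_sym by auto
    moreover have "b = 0" if "j < a" "a < L" "b < L" "b < j \<or> L < b" "x a = x b" for a b
      using revisit_no_cross [of 0 b j a] that j by auto
    ultimately show ?thesis using that [of j L] 1 j kl oj evenL xL by auto
  next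
    case 2
    have "b = 0" if "0 < a" "a < j" "b < L" "b < 0 \<or> j < b" "adjacent (x a) (x b)" for a b
      using chord_no_cross_right [of 0 a j b] that j by auto
    moreover have "b = 0" if "0 < a" "a < j" "b < L" "b < 0 \<or> j < b" "x a = x b" for a b
      using revisit_no_cross [of 0 a j b] that j by auto
    ultimately show ?thesis using that [of 0 j] 2 j kl oj by auto
  qed
  let ?X1 = "x ` {p..q}" and ?X2 = "x ` {k..l}" and ?Y = "x ` {..<L}"
  have x0: "x 0 \<in> ?X1" using pq by (metis atLeastAtMost_iff imageI order_refl)
  have apart': "x a \<noteq> x b" if "p \<le> a" "a \<le> q" "k \<le> b" "b \<le> l" for a b
  proof
    assume eq: "x a = x b"
    have b: "0 < b" "b \<noteq> j" "b < p \<or> q < b" "b < L" using apart [of b] that kl by auto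
    show False
    proof (cases "a = p \<or> a = q")
      case True
      then show False using xb [of b] eq b pq by auto
    next
      case False
      then show False using merge [of a b] that b eq by auto
    qed
  qed
  have disj: "?X1 \<inter> ?X2 = {}" using apart' by (auto simp: image_iff)
  have sub1: "?X1 \<subseteq> ?Y"
  proof
    fix z assume "z \<in> ?X1"
    then obtain t where t: "p \<le> t" "t \<le> q" "z = x t" by auto
    show "z \<in> ?Y"
    proof (cases "t < L")
      case False
      then have "t = q" using t(2) pq(2) by simp
      then have "z = x 0" using t(3) pq(4) by simp
      then show ?thesis using posL by auto
    qed (use t in auto)
  qed
  have sub2: "?X2 \<subseteq> ?Y" using kl by auto
  show ?thesis
  proof (rule two_cuts [of "x 0" ?X1 "x k" ?X2 ?Y "q - p" "l - k" k])
    show "x 0 \<in> ?X1" by (rule x0)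
    show "x k \<in> ?X2" using kl by auto
    show "?X1 \<inter> ?X2 = {}" "?X1 \<subseteq> ?Y" "?X2 \<subseteq> ?Y" using disj sub1 sub2 .
    show "(arel ?X1 ^^ (q - p)) (x 0) (x 0)" using walk_arel [of p q ?X1] pq by simp
    show "odd (q - p)" "odd (l - k)" using pq okl by auto
    show "(arel ?X2 ^^ (l - k)) (x k) (x k)" using walk_arel [of k l ?X2] kl by simp
    show "(arel ?Y ^^ k) (x 0) (x k)" using walk_arel [of 0 k ?Y] kl by force
  next
    fix a' b' assume a: "a' \<in> ?X1 - {x 0}" and b: "b' \<in> ?Y" and adj: "adjacent a' b'"
    obtain a where a1: "p \<le> a" "a \<le> q" "a' = x a" using a by auto
    have "a \<noteq> p" "a \<noteq> q" using a a1 pq by auto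
    then have a2: "p < a" "a < q" using a1 by auto
    obtain b where b1: "b < L" "b' = x b" using b by auto
    show "b' \<in> ?X1"
    proof (cases "p \<le> b \<and> b \<le> q")
      case True
      then show ?thesis using b1 by auto
    next
      case False
      then have "b = 0" using chord [of a b] a2 b1 adj a1 by auto
      then show ?thesis using b1 x0 by simp
    qed
  next
    fix a' b' assume a: "a' \<in> ?X2 - {x k}" and b: "b' \<in> ?Y" and adj: "adjacent a' b'"
    obtain a where a1: "k \<le> a" "a \<le> l" "a' = x a" using a by auto
    have "a \<noteq> k" "a \<noteq> l" using a a1 kl by auto
    then have a2: "k < a" "a < l" using a1 by auto
    obtain b where b1: "b < L" "b' = x b" using b by auto
    have "\<not> l < b" using chord_no_cross_right [of k a l b] a2 kl b1 adj a1 by auto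
    moreover have "\<not> b < k" using chord_no_cross_left [of b k a l] a2 kl b1 adj a1 by auto
    ultimately show "b' \<in> ?X2" using b1 by auto
  qed
qed

end

context fin_graph
begin

text \<open>The vertices of the walk are distinct except that x j = x 0 is allowed for one position j;
the value j = 0 encodes the absence of a repetition.\<close>

definition shape :: "(nat \<Rightarrow> nat) \<Rightarrow> nat \<Rightarrow> nat \<Rightarrow> bool" where
  "shape x L j \<longleftrightarrow> (j = 0 \<and> inj_on x {..<L}) \<or>
     (0 < j \<and> j < L \<and> odd j \<and> x j = x 0 \<and> inj_on x ({..<L} - {j}))"

text \<open>If a vertex repeats, the walk is rebuilt to start there, so that the repetition sits at
  position 0; condition (sharp) enters through \<open>two_revisits\<close> and forbids
  another.\<close>

lemma crit_shape:
  assumes "sharp_condition n m E" "fib u v" "\<not> conn u v"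
  shows "\<exists>x L j. crit_walk n m E x L u v \<and> shape x L j"
proof -
  have cw: "crit_walk n m E x L u v" if "altw x L u v" for x L
    by unfold_locales (use that assms in auto)
  have "u \<noteq> 0"
    using assms(2,3) fib_sz [OF assms(2)] sz_eq_0 by (metis conn_refl fib_def sz_def sz_eq_0 mon_zero)
  then have "sz u \<noteq> 0" using assms(2) sz_eq_0 by (auto simp: fib_def)
  then have "\<exists>y<n. vdeg u y \<noteq> 0" using sum_vdeg [of u] by (metis lessThan_iff mult_eq_0_iff sum.neutral zero_neq_numeral)
  then obtain y x L where x: "altw x L u v" using altw_exists [OF assms(2,3)] by blast
  interpret W: crit_walk n m E x L u v using cw [OF x] .
  show ?thesis
  proof (cases "inj_on x {..<L}")
    case True
    then show ?thesis using cw [OF x] by (auto simp: shape_def)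
  next
    case False
    then obtain i j where ij: "i < L" "j < L" "i \<noteq> j" "x i = x j" by (auto simp: inj_on_def)
    \<comment> \<open>The repeated vertex has degree at least 2 in u, so every alternating walk from
      u to v started there visits it again.\<close>
    have "card {i, j} \<le> card {k. k < L \<and> x k = x i}"
      using ij by (intro card_mono) auto
    then have two: "2 \<le> vdeg u (x i)" using ij W.vdeg_u by simp
    then obtain x' L' where x': "altw x' L' u v" "x' 0 = x i"
      using altw_exists [OF assms(2,3), of "x i"] by auto
    interpret W': crit_walk n m E x' L' u v using cw [OF x'(1)] .
    have "\<exists>j'. 0 < j' \<and> j' < L' \<and> x' j' = x' 0"
    proof (rule ccontr)
      assume "\<not> ?thesis"
      then have "{k. k < L' \<and> x' k = x' 0} \<subseteq> {0}" by (auto intro: gr0I)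
      then have "vdeg u (x i) \<le> 1" using W'.vdeg_u [of "x i"] x'(2) card_mono [of "{0 :: nat}"] by fastforce
      then show False using two by simp
    qed
    then obtain j' where j': "0 < j'" "j' < L'" "x' j' = x' 0" by blast
    have "inj_on x' ({..<L'} - {j'})"
    proof (rule ccontr)
      assume "\<not> ?thesis"
      then obtain p q where "p \<in> {..<L'} - {j'}" "q \<in> {..<L'} - {j'}" "x' p = x' q" "p \<noteq> q"
        by (auto simp: inj_on_def)
      then obtain k l where kl: "k < l" "l < L'" "x' k = x' l" "k \<noteq> j'" "l \<noteq> j'"
        by (metis DiffE insertCI lessThan_iff linorder_neqE_nat)
      have "k \<noteq> 0"
      proof
        assume "k = 0"
        then show False using W'.no_triple [of 0 j' l] kl j' W'.posL by auto
      qed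
      then show False using W'.two_revisits [of j' k l] j' kl assms(1) by auto
    qed
    then have "shape x' L' j'" using j' W'.revisit_odd [of 0 j'] by (auto simp: shape_def)
    then show ?thesis using cw [OF x'(1)] by blast
  qed
qed

end

context crit_walk
begin

lemma vdeg_shape:
  assumes "shape x L j"
  shows "vdeg u y = of_bool (y \<in> x ` {..<L}) + of_bool (0 < j \<and> y = x 0)"
proof (cases "y \<in> x ` {..<L}")
  case False
  then have "{k. k < L \<and> x k = y} = {}" by auto
  then show ?thesis using False posL vdeg_u [of y] by (auto simp: image_iff)
next
  case True
  then obtain k where k: "k < L" "y = x k" by auto
  show ?thesis
  proof (cases "j = 0")
    case True
    then have "{t. t < L \<and> x t = y} = {k}" using assms k by (auto simp: shape_def inj_on_def)
    then show ?thesis using k True vdeg_u [of y] by simp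
  next
    case False
    then have j: "0 < j" "j < L" "x j = x 0" "inj_on x ({..<L} - {j})" using assms by (auto simp: shape_def)
    show ?thesis
    proof (cases "y = x 0")
      case True
      have "{t. t < L \<and> x t = y} = {0, j}"
      proof -
        have "t = 0" if "t < L" "x t = x 0" "t \<noteq> j" for t
          using inj_onD [OF j(4), of t 0] that j posL by auto
        then show ?thesis using True j posL by auto
      qed
      then show ?thesis using True j posL vdeg_u [of y] by auto
    next
      case False
      then have kj: "k \<noteq> j" using k j by auto
      have "{t. t < L \<and> x t = y} = {k}"
      proof -
        have "t = k" if "t < L" "x t = x k" for t
        proof -
          have "t \<noteq> j" using that j k False by auto
          then show ?thesis using inj_onD [OF j(4), of t k] that k kj by auto
        qed
        then show ?thesis using k by auto
      qed
      then show ?thesis using False k vdeg_u [of y] by auto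
    qed
  qed
qed

lemma VS_u: "VS u = x ` {..<L}"
proof -
  have "vdeg u y > 0 \<longleftrightarrow> y \<in> x ` {..<L}" for y
    unfolding vdeg_u card_gt_0_iff by auto
  then show ?thesis by (auto simp: VS_def)
qed

end

context fin_graph
begin

text \<open>Every edge has an end other than x 0, and such a vertex has degree at most 1.\<close>

lemma crit_squarefree:
  assumes "sharp_condition n m E" "crit w"
  shows "lkp w i \<le> 1"
proof (cases "i < m")
  case True
  obtain v where v: "fib w v" "\<not> conn w v" using assms(2) by (auto simp: crit_def)
  obtain x L j where W: "crit_walk n m E x L w v" "shape x L j"
    using crit_shape [OF assms(1) v] by blast
  obtain p q where pq: "E i = {p, q}" "p \<noteq> q" using edge_card [OF True] by (auto simp: card_2_iff)
  then obtain z where z: "z \<in> E i" "z \<noteq> x 0" by auto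
  then have "vdeg w z \<le> 1" using crit_walk.vdeg_shape [OF W] by simp
  then show ?thesis using lkp_le_vdeg [OF True z(1), of w] by simp
next
  case False
  have "mon w" using assms(2) by (auto simp: crit_def fib_def)
  then have "i \<notin> ks w" using False by (auto simp: mon_def)
  then show ?thesis by (simp add: in_keys_iff)
qed

end

section \<open>Fibres with the same vertices, and fibres with three classes\<close>

lemma even_card_involution:
  assumes "finite A" "\<And>a. a \<in> A \<Longrightarrow> f a \<in> A \<and> f (f a) = a \<and> f a \<noteq> a"
  shows "even (card A)"
  using assms
proof (induction A rule: finite_psubset_induct)
  case (psubset A)
  show ?case
  proof (cases "A = {}")
    case False
    then obtain a where a: "a \<in> A" by blast
    let ?B = "A - {a, f a}"
    have fa: "f a \<in> A" "f a \<noteq> a" "f (f a) = a" using psubset.prems a by auto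
    have "f b \<in> ?B \<and> f (f b) = b \<and> f b \<noteq> b" if b: "b \<in> ?B" for b
      using psubset.prems [of b] psubset.prems [of a] b a by auto
    moreover have "?B \<subset> A" using a by auto
    ultimately have "even (card ?B)" using psubset.IH [of ?B] by blast
    moreover have "card ?B = card A - card {a, f a}"
      using a fa by (intro card_Diff_subset) auto
    moreover have "card {a, f a} = 2" using fa by simp
    moreover have "card {a, f a} \<le> card A"
      using a fa psubset.hyps by (intro card_mono) auto
    ultimately show ?thesis by auto
  qed simp
qed

lemma card_opposite_parity:
  assumes "a < b" "even a = even b"
  shows "card {t. a < t \<and> t < b \<and> even t \<noteq> even (a :: nat)} = (b - a) div 2"
proof -
  have "{t. a < t \<and> t < b \<and> even t \<noteq> even a} = (\<lambda>s. Suc a + 2 * s) ` {..<(b - a) div 2}"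
  proof (intro equalityI subsetI)
    fix t assume t: "t \<in> {t. a < t \<and> t < b \<and> even t \<noteq> even a}"
    then have e: "even (t - Suc a)" by auto
    then have "t = Suc a + 2 * ((t - Suc a) div 2)" using t by auto
    moreover have "(t - Suc a) div 2 < (b - a) div 2"
    proof -
      have "even (b - a)" using assms by auto
      then show ?thesis using e t by (auto elim!: evenE)
    qed
    ultimately show "t \<in> (\<lambda>s. Suc a + 2 * s) ` {..<(b - a) div 2}" by blast
  qed auto
  moreover have "inj_on (\<lambda>s. Suc a + 2 * s) {..<(b - a) div 2}" by (auto simp: inj_on_def)
  ultimately show ?thesis by (simp add: card_image)
qed

context crit_walk
begin

lemma eix_sym: "eix p q = eix q p"
  by (simp add: eix_def insert_commute)

lemma walk_edge_keys: "k < L \<Longrightarrow> eix (x k) (x (Suc k)) \<in> ks u \<union> ks v"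
  unfolding u_col v_col by (cases "even k") (auto simp: col_keys)

text \<open>By \<open>chord_consecutive\<close> such a chord is an edge of the walk; the pair 0, L -
  1 is the last edge, since x L = x 0.\<close>

lemma odd_chord_key:
  assumes "a < L" "b < L" "even a \<noteq> even b" "adjacent (x a) (x b)"
  shows "eix (x a) (x b) \<in> ks u \<union> ks v"
proof -
  have *: "eix (x a) (x b) \<in> ks u \<union> ks v"
    if "a < b" "b < L" "even a \<noteq> even b" "adjacent (x a) (x b)" for a b
  proof -
    have "b = Suc a \<or> a = 0 \<and> b = L - 1" by (rule chord_consecutive [OF that])
    then consider "b = Suc a" | "a = 0" "b = L - 1" by blast
    then show ?thesis
    proof cases
      case 1
      then show ?thesis using walk_edge_keys [of a] that by simp
    next
      case 2
      then have "eix (x b) (x (Suc b)) = eix (x b) (x a)" using posL xL by simp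
      then show ?thesis using walk_edge_keys [of b] that eix_sym by metis
    qed
  qed
  consider "a < b" | "b < a" using assms(3) by (cases a b rule: linorder_cases) auto
  then show ?thesis
  proof cases
    case 1
    then show ?thesis using *[of a b] assms by blast
  next
    case 2
    then have "eix (x b) (x a) \<in> ks u \<union> ks v" using *[of b a] assms adj_sym by blast
    then show ?thesis using eix_sym by metis
  qed
qed

lemma length_ge_4: "4 \<le> L"
proof -
  have "L \<noteq> 2"
  proof
    assume L: "L = 2"
    have "{k \<in> {..<2 :: nat}. even k} = {0}" "{k \<in> {..<2 :: nat}. odd k} = {1}"
      by (auto simp: less_2_cases_iff)
    then have "u = emon (x 0) (x 1)" "v = emon (x 1) (x 0)"
      using u_col v_col xL L by (simp_all add: col_def numeral_2_eq_2)
    then have "u = v" using eix_sym by (simp add: emon_def)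
    then show False using nc by simp
  qed
  then show ?thesis using evenL posL by presburger
qed

text \<open>The two loops meet only at x 0 by injectivity, and no chord joins them by
  \<open>chord_no_cross_right\<close>; hence x 0 is a cut vertex.\<close>

lemma shape_separates:
  assumes "shape x L j" "0 < j"
  shows "x ` {..<L} = {x 0} \<union> x ` {0<..<j} \<union> x ` {j<..<L}"
    and "x 0 \<notin> x ` {0<..<j} \<union> x ` {j<..<L}"
    and "x ` {0<..<j} \<inter> x ` {j<..<L} = {}"
    and "x ` {0<..<j} \<noteq> {}" "x ` {j<..<L} \<noteq> {}"
    and "\<And>p q. p \<in> x ` {0<..<j} \<Longrightarrow> q \<in> x ` {j<..<L} \<Longrightarrow> \<not> adjacent p q"
proof -
  have j: "j < L" "x j = x 0" "odd j" and inj: "inj_on x ({..<L} - {j})"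
    using assms by (auto simp: shape_def)
  have "{..<L} = {0} \<union> {0<..<j} \<union> {j} \<union> {j<..<L}" using j(1) by auto
  then have "x ` {..<L} = x ` ({0} \<union> {0<..<j} \<union> {j} \<union> {j<..<L})" by (rule arg_cong)
  then show "x ` {..<L} = {x 0} \<union> x ` {0<..<j} \<union> x ` {j<..<L}"
    using j(2) by (simp add: image_Un)
  have ne: "x a \<noteq> x b" if "a < L" "b < L" "a \<noteq> b" "a \<noteq> j" "b \<noteq> j" for a b
    using inj_onD [OF inj, of a b] that by auto
  show "x 0 \<notin> x ` {0<..<j} \<union> x ` {j<..<L}"
  proof
    assume "x 0 \<in> x ` {0<..<j} \<union> x ` {j<..<L}"
    then obtain a where "x 0 = x a" "a < L" "a \<noteq> 0" "a \<noteq> j" using j(1) by auto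
    then show False using ne [of 0 a] assms(2) posL by auto
  qed
  show "x ` {0<..<j} \<inter> x ` {j<..<L} = {}"
  proof (rule equals0I)
    fix z assume "z \<in> x ` {0<..<j} \<inter> x ` {j<..<L}"
    then obtain a b where "x a = x b" "a < j" "j < b" "b < L" by auto
    then show False using ne [of a b] by auto
  qed
  have "j \<noteq> 1"
  proof
    assume "j = 1"
    then have "adjacent (x 0) (x 0)" using adj_step [of 0] posL j(2) by simp
    then show False using adj_neq by blast
  qed
  then have "1 \<in> {0<..<j}" using assms(2) by auto
  then show "x ` {0<..<j} \<noteq> {}" by blast
  have "j \<noteq> L - 1"
  proof
    assume "j = L - 1"
    then have "adjacent (x 0) (x 0)" using adj_step [of j] j xL posL by simp
    then show False using adj_neq by blast
  qed
  then have "Suc j \<in> {j<..<L}" using j(1) by auto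
  then show "x ` {j<..<L} \<noteq> {}" by blast
  fix p q assume "p \<in> x ` {0<..<j}" "q \<in> x ` {j<..<L}"
  then obtain a b where "0 < a" "a < j" "j < b" "b < L" "p = x a" "q = x b" by auto
  then show "\<not> adjacent p q" using chord_no_cross_right [of 0 a j b] j(2) by auto
qed

lemma shape_card: "shape x L j \<Longrightarrow> card (x ` {..<L}) = L - of_bool (0 < j)"
proof -
  assume s: "shape x L j"
  show ?thesis
  proof (cases "j = 0")
    case True
    then show ?thesis using s by (auto simp: shape_def card_image)
  next
    case False
    then have j: "0 < j" "j < L" "x j = x 0" "inj_on x ({..<L} - {j})" using s by (auto simp: shape_def)
    have "x ` {..<L} = x ` ({..<L} - {j})"
    proof
      show "x ` {..<L} \<subseteq> x ` ({..<L} - {j})"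
      proof
        fix z assume "z \<in> x ` {..<L}"
        then obtain t where "t < L" "z = x t" by auto
        then show "z \<in> x ` ({..<L} - {j})" using j posL by (cases "t = j") auto
      qed
    qed auto
    then show ?thesis using j by (simp add: card_image)
  qed
qed

end

context fin_graph
begin

text \<open>The repeated vertex is the only cut vertex of the subgraph induced on the walk.\<close>

lemma cut_unique:
  assumes X: "crit_walk n m E x L u v" "shape x L j" "0 < j"
    and Y: "crit_walk n m E y L' u' v'" "shape y L' j'" "0 < j'"
    and eq: "x ` {..<L} = y ` {..<L'}"
  shows "x 0 = y 0"
proof (rule ccontr)
  assume ne: "x 0 \<noteq> y 0"
  interpret X: crit_walk n m E x L u v by (rule X(1))
  interpret Y: crit_walk n m E y L' u' v' by (rule Y(1))
  let ?A = "y ` {0<..<j'}" and ?B = "y ` {j'<..<L'}"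
  note sep = Y.shape_separates [OF Y(2,3)]
  have "x 0 \<in> ?A \<union> ?B" using eq sep(1) ne X.posL by blast
  \<comment> \<open>C is the side of the cut at y 0 that contains x 0, and D is the other
    side.\<close>
  then obtain C D where CD: "x 0 \<in> C" "C \<inter> D = {}" "D \<noteq> {}" "x ` {..<L} = {y 0} \<union> C \<union> D" "y 0 \<notin> D"
    and nadj: "\<And>p q. p \<in> C \<Longrightarrow> q \<in> D \<Longrightarrow> \<not> adjacent p q"
  proof
    assume a: "x 0 \<in> ?A"
    have c: "y 0 \<notin> ?B" using sep(2) by simp
    have d: "x ` {..<L} = {y 0} \<union> ?A \<union> ?B" using sep(1) eq by (rule trans [rotated])
    show ?thesis by (rule that [OF a sep(3) sep(5) d c sep(6)])
  next
    assume a: "x 0 \<in> ?B"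
    have b: "?B \<inter> ?A = {}" using sep(3) by (simp only: Int_commute)
    have c: "y 0 \<notin> ?A" using sep(2) by simp
    have d: "x ` {..<L} = {y 0} \<union> ?B \<union> ?A" unfolding eq sep(1) by (simp only: Un_ac)
    have e: "\<not> adjacent p q" if "p \<in> ?B" "q \<in> ?A" for p q
      using sep(6) [OF that(2,1)] adj_sym by blast
    show ?thesis by (rule that [OF a b sep(4) d c e])
  qed
  have j: "j < L" "x j = x 0" "inj_on x ({..<L} - {j})" using X(2,3) by (auto simp: shape_def)
  have "y 0 \<in> x ` {..<L}" unfolding CD(4) by simp
  then obtain h where h: "h < L" "x h = y 0" by (metis imageE lessThan_iff)
  have hne: "h \<noteq> j" "h \<noteq> 0" using h(2) j(2) ne by metis+
  have uniq: "t = h" if "t < L" "x t = y 0" for t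
  proof -
    have "t \<noteq> j" using that j ne by auto
    then show ?thesis using inj_onD [OF j(3), of t h] that h hne by auto
  qed
  have next_C: "x t \<in> C" if "x s \<in> C" "adjacent (x s) (x t)" "t < L" "t \<noteq> h" for s t
  proof -
    have "x t \<in> {y 0} \<union> C \<union> D" unfolding CD(4) [symmetric] using that(3) by simp
    moreover have "x t \<noteq> y 0" using uniq [OF that(3)] that(4) by blast
    moreover have "x t \<notin> D" using nadj [OF that(1)] that(2) by blast
    ultimately show ?thesis by simp
  qed
  \<comment> \<open>The walk x passes y 0 only at position h. Followed from x 0 in both directions
    up to h it stays in C, which leaves D empty.\<close>
  have low: "t < h \<Longrightarrow> x t \<in> C" for t
  proof (induction t)
    case 0
    then show ?case using CD(1) by simp
  next
    case (Suc t)
    then show ?case using next_C [of t "Suc t"] X.adj_step [of t] h by auto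
  qed
  have high: "x (L - s) \<in> C" if "s < L - h" for s
    using that
  proof (induction s)
    case 0
    then show ?case using CD(1) X.xL by simp
  next
    case (Suc s)
    have "Suc (L - Suc s) = L - s" using Suc.prems by simp
    then have "adjacent (x (L - s)) (x (L - Suc s))"
      using X.adj_step [of "L - Suc s"] adj_sym Suc.prems by simp
    then show ?case using next_C [of "L - s" "L - Suc s"] Suc by auto
  qed
  have "x t \<in> C \<or> t = h" if "t < L" for t
  proof (cases "t < h")
    case False
    then show ?thesis using high [of "L - t"] that by (cases "t = h") auto
  qed (use low in auto)
  then have C_or: "z \<in> C \<or> z = y 0" if "z \<in> x ` {..<L}" for z using h(2) that by auto
  obtain d where d: "d \<in> D" using CD(3) by (metis ex_in_conv)
  then have "d \<in> x ` {..<L}" unfolding CD(4) by simp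
  then have "d \<in> C" using C_or CD(5) d by metis
  then show False using CD(2) d by (metis IntI emptyE)
qed

text \<open>The number of vertices is L or L - 1 with L even, so its parity tells whether a vertex
  repeats; \<open>cut_unique\<close> tells which one. This fixes all degrees.\<close>

lemma VS_determines:
  assumes sharp: "sharp_condition n m E" and "crit u" "crit u'" "VS u = VS u'"
  shows "fib u u'"
proof -
  obtain v where v: "fib u v" "\<not> conn u v" using assms(2) by (auto simp: crit_def)
  obtain x L j where X: "crit_walk n m E x L u v" "shape x L j" using crit_shape [OF sharp v] by blast
  obtain v' where v': "fib u' v'" "\<not> conn u' v'" using assms(3) by (auto simp: crit_def)
  obtain y L' j' where Y: "crit_walk n m E y L' u' v'" "shape y L' j'" using crit_shape [OF sharp v'] by blast
  interpret X: crit_walk n m E x L u v by (rule X(1))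
  interpret Y: crit_walk n m E y L' u' v' by (rule Y(1))
  have eq: "x ` {..<L} = y ` {..<L'}" using X.VS_u Y.VS_u assms(4) by simp
  have card: "L - of_bool (0 < j) = L' - of_bool (0 < j')"
    using X.shape_card [OF X(2)] Y.shape_card [OF Y(2)] eq by simp
  have jj: "0 < j \<longleftrightarrow> 0 < j'"
  proof (rule ccontr)
    assume "\<not> ?thesis"
    then have "L = L' - 1 \<or> L' = L - 1" using card by auto
    then show False using X.evenL Y.evenL X.posL Y.posL by auto
  qed
  have "vdeg u y' = vdeg u' y'" for y'
    using X.vdeg_shape [OF X(2), of y'] Y.vdeg_shape [OF Y(2), of y'] eq jj cut_unique [OF X _ Y _ eq] by auto
  then show ?thesis using v v' by (auto simp: fib_def fun_eq_iff)
qed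

lemma two_keys_vdeg:
  assumes "i < m" "i' < m" "i \<noteq> i'" "y \<in> E i" "y \<in> E i'"
  shows "lkp w i + lkp w i' \<le> vdeg w y"
proof -
  have "lkp w i + lkp w i' = (\<Sum>k\<in>{i, i'}. if y \<in> E k then lkp w k else 0)" using assms by simp
  also have "\<dots> \<le> vdeg w y" unfolding vdeg_def using assms by (intro sum_mono2) auto
  finally show ?thesis .
qed

definition restrict :: "nat set \<Rightarrow> expo \<Rightarrow> expo" where
  "restrict I w = (\<Sum>i\<in>ks w \<inter> I. sg i (lkp w i))"

lemma lookup_restrict: "lkp (restrict I w) k = (if k \<in> I then lkp w k else 0)"
proof -
  have "lkp (restrict I w) k = (\<Sum>i\<in>ks w \<inter> I. if i = k then lkp w k else 0)"
    unfolding restrict_def lookup_sum by (rule sum.cong) (auto simp: lookup_single when_def)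
  then show ?thesis by (simp add: in_keys_iff)
qed

lemma restrict_split: "w = restrict I w + restrict (- I) w"
  by (rule poly_mapping_eqI) (simp add: lookup_add lookup_restrict)

end

context crit_walk
begin

text \<open>x 0 occupies positions 0 and j of opposite parity, so an edge of w at x 0 is a chord of
  opposite parity for one of them, hence an edge of u or v.\<close>

lemma no_third_if_revisit:
  assumes "shape x L j" "0 < j" "fib u w" "\<not> conn u w" "\<not> conn v w"
  shows False
proof -
  have j: "j < L" "x j = x 0" "odd j" using assms by (auto simp: shape_def)
  have dw: "vdeg w = vdeg u" using assms(3) by (simp add: fib_def)
  have "vdeg w (x 0) > 0" using dw vdeg_shape [OF assms(1)] assms(2) by simp
  then obtain z w' where z: "adjacent (x 0) z" "w = w' + emon (x 0) z" using edge_through by blast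
  have key: "eix (x 0) z \<in> ks w" using z(2) by (simp add: keys_add_nat emon_def)
  have "vdeg w z > 0" using z by (simp add: vdeg_add vdeg_emon)
  then have "z \<in> VS u" using dw by (simp add: VS_def)
  then obtain b where b: "b < L" "z = x b" using VS_u by auto
  have "eix (x 0) z \<in> ks u \<union> ks v"
    using odd_chord_key [of 0 b] odd_chord_key [of j b] b j z(1) posL by (cases "even b") auto
  moreover have "fib v w" using fuv assms(3) fib_sym fib_trans by blast
  ultimately show False using key assms(3-5) step_conn unfolding step_def by blast
qed

text \<open>The exchanged monomial contains the foreign edge i, so it differs from u and v. As these
  are alone in their classes it shares nothing with either, which gives both conditions where
  \<open>walk_switch\<close> gives only one of them.\<close>

lemma switch_single:
  assumes "single u" "single v" "\<forall>k\<in>K. k < L" "mon f"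
    and "\<And>y. signed_deg x K y = (if c then 1 else -1) * int (vdeg f y)"
    and i: "i \<in> ks f" "i \<notin> ks u" "i \<notin> ks v"
  shows "(\<forall>k<L. k \<notin> K \<longrightarrow> even k \<noteq> c) \<and> (\<forall>k\<in>K. even k = c)"
proof -
  have fin: "finite K" using assms(3) by (meson finite_nat_set_iff_bounded)
  have sub: "K \<subseteq> {..<L}" using assms(3) by auto
  define U where "U c = col x c {..<L}" for c
  have U: "U c = col x c K + col x c ({..<L} - K)" for c
    unfolding U_def using col_union [of K "{..<L} - K" x c] fin sub by (simp add: Un_absorb1)
  have "U True = u" "U False = v" using altw by (auto simp: altw_def U_def)
  then have f: "fib (U c) (U (\<not> c))" and s: "single (U c)" "single (U (\<not> c))"
    and ii: "i \<notin> ks (U c)" "i \<notin> ks (U (\<not> c))"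
    using assms fuv fib_sym by (cases c; auto)+
  let ?z = "(col x (\<not> c) K + f) + col x c ({..<L} - K)"
  have iz: "i \<in> ks ?z" using i(1) by (simp add: keys_add_nat)
  have deg: "vdeg (col x c K) = vdeg (col x (\<not> c) K + f)"
  proof
    fix y show "vdeg (col x c K) y = vdeg (col x (\<not> c) K + f) y"
      using assms(5) [of y] by (cases c) (auto simp: signed_deg_def vdeg_add)
  qed
  have mz: "mon (col x (\<not> c) K + f)" using col_mon [OF walkx sub] assms(4) by simp
  have "fib (U c) ?z"
    unfolding U [of c] fib_def using deg mz col_mon [OF walkx] sub by (auto simp: vdeg_add fun_eq_iff)
  then have fz: "fib (U (\<not> c)) ?z" using f fib_sym fib_trans by blast
  have "col x c ({..<L} - K) = 0"
  proof (rule ccontr)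
    assume "\<not> ?thesis"
    then have "conn (U c) ?z" using switch1(1) [OF f [unfolded U [of c]] mz deg] U [of c] by simp
    then show False using single_conn [OF s(1)] iz ii by metis
  qed
  moreover have "col x (\<not> c) K = 0"
  proof (rule ccontr)
    assume ne: "\<not> ?thesis"
    have "step (col x (\<not> c) K + col x (\<not> c) ({..<L} - K)) (col x (\<not> c) K + (f + col x c ({..<L} - K)))"
      using step_common [OF _ ne] fz U [of "\<not> c"] by (simp add: add.assoc)
    then have "step (U (\<not> c)) ?z" unfolding U [of "\<not> c"] by (simp only: add.assoc)
    then have "?z = U (\<not> c)" using s(2) unfolding single_def by blast
    then show False using iz ii by metis
  qed
  ultimately show ?thesis using fin by (auto simp: col_eq_0)
qed

text \<open>The walk is a cycle, and w is a perfect matching of it by chords of equal parity. If L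
  is not 4, chords of different parity do not cross, so w preserves positions mod 4; then u and w
  can be exchanged on half of the residues, which connects them.\<close>

lemma third_forces_4:
  assumes inj: "inj_on x {..<L}" and w: "fib u w" "\<not> conn u w" "\<not> conn v w"
    and s: "single u" "single v"
  shows "L = 4"
proof (rule ccontr)
  assume L4: "L \<noteq> 4"
  have sh: "shape x L 0" using inj by (simp add: shape_def)
  have fvw: "fib v w" using fuv w(1) fib_sym fib_trans by blast
  have dw: "vdeg w y = of_bool (y \<in> x ` {..<L})" for y
    using vdeg_shape [OF sh, of y] w(1) by (simp add: fib_def)
  have disj: "ks w \<inter> (ks u \<union> ks v) = {}" using w fvw step_conn unfolding step_def by blast
  define M where "M a b \<longleftrightarrow> a < L \<and> b < L \<and> adjacent (x a) (x b) \<and> eix (x a) (x b) \<in> ks w" for a b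
  have M_sym: "M b a" if "M a b" for a b using that adj_sym eix_sym unfolding M_def by metis
  have M_ex: "\<exists>b. M a b" if "a < L" for a
  proof -
    have "vdeg w (x a) > 0" using that dw by simp
    then obtain z w' where z: "adjacent (x a) z" "w = w' + emon (x a) z" using edge_through by blast
    have "vdeg w z > 0" using z by (simp add: vdeg_add vdeg_emon)
    then have "z \<in> x ` {..<L}" using dw [of z] by (cases "z \<in> x ` {..<L}") auto
    then obtain b where "b < L" "z = x b" by auto
    then show ?thesis using that z by (auto simp: M_def keys_add_nat emon_def)
  qed
  have M_uniq: "b = b'" if "M a b" "M a b'" for a b b'
  proof (rule ccontr)
    assume ne: "b \<noteq> b'"
    let ?i = "eix (x a) (x b)" and ?i' = "eix (x a) (x b')"
    have e: "?i < m" "E ?i = {x a, x b}" "?i' < m" "E ?i' = {x a, x b'}"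
      using that adj_eix by (auto simp: M_def)
    have "x b \<noteq> x b'" using inj that ne by (auto simp: M_def inj_on_def)
    then have "?i \<noteq> ?i'" using e by (metis doubleton_eq_iff)
    then have "lkp w ?i + lkp w ?i' \<le> vdeg w (x a)" using two_keys_vdeg [of ?i ?i'] e by auto
    moreover have "1 \<le> lkp w ?i" "1 \<le> lkp w ?i'" using that by (auto simp: M_def in_keys_iff Suc_le_eq)
    moreover have "vdeg w (x a) \<le> 1" using dw by simp
    ultimately show False by linarith
  qed
  obtain \<sigma> where \<sigma>: "\<And>a. a < L \<Longrightarrow> M a (\<sigma> a)" using M_ex by metis
  have \<sigma>L: "\<sigma> a < L" if "a < L" for a using \<sigma> [OF that] by (simp add: M_def)
  have \<sigma>\<sigma>: "\<sigma> (\<sigma> a) = a" if "a < L" for a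
    using M_uniq [OF \<sigma> [OF \<sigma>L [OF that]] M_sym [OF \<sigma> [OF that]]] .
  have \<sigma>ne: "\<sigma> a \<noteq> a" if "a < L" for a
    using \<sigma> [OF that] adj_neq unfolding M_def by metis
  \<comment> \<open>A chord of opposite parity would be an edge of u or v, but w is disjoint from
    both.\<close>
  have \<sigma>par: "even (\<sigma> a) = even a" if "a < L" for a
    using odd_chord_key [of a "\<sigma> a"] \<sigma> [OF that] disj unfolding M_def by blast
  text \<open>Two crossing chords of different parity can be exchanged against the arcs between
    their ends.\<close>
  have no_cross: False if "a < a'" "a' < b" "b < b'" "b' < L" "M a b" "M a' b'" "even a \<noteq> even a'" for a a' b b'
  proof -
    let ?f = "emon (x a) (x b) + emon (x a') (x b')" and ?K = "{a..<a'} \<union> {b..<b'}"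
    have ad: "adjacent (x a) (x b)" "adjacent (x a') (x b')" using that by (auto simp: M_def)
    have par: "even b = even a" "even b' = even a'"
      using M_uniq [OF that(5) \<sigma>] M_uniq [OF that(6) \<sigma>] \<sigma>par that(5,6) by (auto simp: M_def)
    have signed_deg: "signed_deg x ?K y = (if even a then 1 else -1) * int (vdeg ?f y)" for y
      using signed_deg_arc2 [of a a' b b' y] that par by (auto simp: vdeg_add vdeg_emon [OF ad(1)] vdeg_emon [OF ad(2)])
    have key: "eix (x a) (x b) \<in> ks ?f" by (simp add: keys_add_nat emon_def)
    have nk: "eix (x a) (x b) \<notin> ks u" "eix (x a) (x b) \<notin> ks v" using that disj by (auto simp: M_def)
    have bd: "\<forall>k\<in>?K. k < L" using that by auto
    have mf: "mon ?f" using mon_emon ad by simp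
    note sw = switch_single [OF s bd mf signed_deg key nk]
    \<comment> \<open>All positions inside \<open>?K\<close> have one parity and all outside the
      other, so every arc between the four ends is a single edge and L = 4.\<close>
    have out: "even k \<noteq> even a" if "k < L" "k \<notin> ?K" for k using sw that by blast
    have ins: "even k = even a" if "k \<in> ?K" for k using sw that by blast
    have "a' = Suc a" using ins [of "Suc a"] that by (cases "a' = Suc a") auto
    moreover have "b' = Suc b" using ins [of "Suc b"] that par by (cases "b' = Suc b") auto
    moreover have "b = Suc a'" using out [of "Suc a'"] that calculation by (cases "b = Suc a'") auto
    moreover have "L = Suc b'" using out [of "Suc b'"] that par calculation by (cases "L = Suc b'") auto
    moreover have "even a" using evenL calculation by auto
    moreover have "a = 0"
    proof (rule ccontr)
      assume "a \<noteq> 0"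
      then obtain a0 where "a = Suc (Suc a0)" using \<open>even a\<close> by (cases a; cases "a - 1") auto
      then show False using out [of a0] that by auto
    qed
    ultimately show False using L4 by simp
  qed
  \<comment> \<open>The positions of the other parity below this chord are matched among themselves
    by \<open>no_cross\<close>. Their number, half the span of the chord, is therefore even.\<close>
  have mod4: "\<sigma> a mod 4 = a mod 4" if "a < L" "a < \<sigma> a" for a
  proof -
    let ?b = "\<sigma> a"
    have Mab: "M a ?b" using \<sigma> that by simp
    have par: "even a = even ?b" using \<sigma>par that by simp
    let ?A = "{t. a < t \<and> t < ?b \<and> even t \<noteq> even a}"
    have "\<sigma> t \<in> ?A \<and> \<sigma> (\<sigma> t) = t \<and> \<sigma> t \<noteq> t" if t: "t \<in> ?A" for t
    proof -
      have tL: "t < L" using t \<sigma>L [OF \<open>a < L\<close>] by auto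
      have pt: "even (\<sigma> t) = even t" using \<sigma>par tL by simp
      have Mt: "M t (\<sigma> t)" "M (\<sigma> t) t" using \<sigma> tL M_sym by auto
      have "\<sigma> t \<noteq> a" "\<sigma> t \<noteq> ?b" using t pt par by auto
      moreover have "\<not> \<sigma> t < a"
        using no_cross [of "\<sigma> t" a t ?b] t pt Mt(2) Mab \<sigma>L [OF \<open>a < L\<close>] by auto
      moreover have "\<not> ?b < \<sigma> t"
        using no_cross [of a t ?b "\<sigma> t"] t Mt(1) Mab \<sigma>L [OF tL] by auto
      ultimately have "a < \<sigma> t" "\<sigma> t < ?b" by linarith+
      then show ?thesis using t pt \<sigma>\<sigma> [OF tL] \<sigma>ne [OF tL] by auto
    qed
    then have "even (card ?A)" by (intro even_card_involution [where f = \<sigma>]) auto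
    then have "even ((?b - a) div 2)" using card_opposite_parity [OF that(2) par] by simp
    moreover have "even (?b - a)" using par that by auto
    ultimately have "4 dvd ?b - a" by presburger
    then show ?thesis using that by (metis mod_eq_dvd_iff_nat less_imp_le)
  qed
  have mod4': "\<sigma> a mod 4 = a mod 4" if "a < L" for a
  proof (cases "a < \<sigma> a")
    case True
    then show ?thesis using mod4 that by blast
  next
    case False
    then have "\<sigma> a < \<sigma> (\<sigma> a)" using \<sigma>ne [OF that] \<sigma>\<sigma> [OF that] by simp
    then show ?thesis using mod4 [OF \<sigma>L [OF that]] \<sigma>\<sigma> [OF that] by simp
  qed
  \<comment> \<open>The residues 0 and 1 are closed under \<open>\<sigma>\<close> and also under the
    edges of u, which join 2s to 2s + 1. So u and w both split along \<open>P\<close>.\<close>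
  define P where "P = {t. t < L \<and> t mod 4 < 2}"
  define I where "I = {i. i < m \<and> E i \<subseteq> x ` P}"
  let ?w1 = "restrict I w" and ?w2 = "restrict (- I) w"
  have vw1: "vdeg ?w1 y = of_bool (y \<in> x ` P)" for y
  proof (cases "y \<in> x ` P")
    case True
    then obtain a where a: "a < L" "a mod 4 < 2" "y = x a" by (auto simp: P_def)
    have inI: "i \<in> I" if i: "i < m" "y \<in> E i" "lkp w i \<noteq> 0" for i
    proof -
      obtain p q where "E i = {p, q}" using edge_card [OF i(1)] by (auto simp: card_2_iff)
      then obtain z where z: "E i = {y, z}" using i(2) by auto
      have "vdeg w z > 0" using vdeg_pos_iff i z by (auto simp: in_keys_iff)
      then have "z \<in> x ` {..<L}" using dw [of z] by (cases "z \<in> x ` {..<L}") auto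
      then obtain b where b: "b < L" "z = x b" by auto
      have e: "E i = {x a, x b}" using z a(3) b(2) by simp
      have "adjacent (x a) (x b)" using e i(1) by (auto simp: adj_def)
      moreover have "eix (x a) (x b) \<in> ks w" using eix_eq [OF i(1) e] i(3) by (simp add: in_keys_iff)
      ultimately have "M a b" using a(1) b(1) by (simp add: M_def)
      then have "b = \<sigma> a" by (rule M_uniq [OF _ \<sigma> [OF a(1)]])
      then have "z \<in> x ` P" using b mod4' [OF a(1)] a(2) by (auto simp: P_def)
      then show ?thesis using z True i(1) by (auto simp: I_def)
    qed
    have "vdeg ?w1 y = vdeg w y"
      unfolding vdeg_def using inI by (intro sum.cong) (auto simp: lookup_restrict)
    then show ?thesis using True a dw by auto
  next
    case False
    have "vdeg ?w1 y = 0"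
      unfolding vdeg_def using False by (intro sum.neutral) (auto simp: lookup_restrict I_def)
    then show ?thesis using False by simp
  qed
  have vc: "vdeg (col x True P) y = of_bool (y \<in> x ` P)" for y
  proof -
    have "vdeg (col x True P) y = (\<Sum>k\<in>{k \<in> P. even k}. of_bool (x k = y) + of_bool (x (Suc k) = y))"
      unfolding col_def vdeg_sum using adj_step by (intro sum.cong) (auto simp: P_def vdeg_emon)
    also have "\<dots> = (\<Sum>k\<in>{k \<in> P. even k}. of_bool (x k = y)) + (\<Sum>k\<in>{k \<in> P. even k}. of_bool (x (Suc k) = y))"
      by (rule sum.distrib)
    also have "(\<Sum>k\<in>{k \<in> P. even k}. of_bool (x (Suc k) = y)) = (\<Sum>k\<in>{k \<in> P. odd k}. of_bool (x k = y) :: nat)"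
    proof (rule sum.reindex_bij_witness [of _ "\<lambda>k. k - 1" Suc])
      fix k assume k: "k \<in> {k \<in> P. even k}"
      then have "Suc k < L" using evenL by (cases "Suc k = L") (auto simp: P_def)
      moreover have "Suc k mod 4 < 2" using k by (auto simp: P_def) presburger
      ultimately show "Suc k \<in> {k \<in> P. odd k}" using k by (auto simp: P_def)
    next
      fix k assume k: "k \<in> {k \<in> P. odd k}"
      then obtain k' where "k = Suc k'" by (cases k) auto
      moreover have "k' mod 4 < 2" if "Suc k' mod 4 < 2" "odd (Suc k')" for k' :: nat using that by presburger
      ultimately show "k - 1 \<in> {k \<in> P. even k}" using k by (auto simp: P_def)
    qed auto
    also have "(\<Sum>k\<in>{k \<in> P. even k}. of_bool (x k = y)) + (\<Sum>k\<in>{k \<in> P. odd k}. of_bool (x k = y) :: nat)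
        = (\<Sum>k\<in>P. of_bool (x k = y))"
    proof -
      have PU: "{k \<in> P. even k} \<union> {k \<in> P. odd k} = P" by blast
      have "(\<Sum>k\<in>{k \<in> P. even k} \<union> {k \<in> P. odd k}. of_bool (x k = y) :: nat)
          = (\<Sum>k\<in>{k \<in> P. even k}. of_bool (x k = y)) + (\<Sum>k\<in>{k \<in> P. odd k}. of_bool (x k = y))"
        by (rule sum.union_disjoint) (auto simp: P_def)
      then show ?thesis unfolding PU by simp
    qed
    also have "\<dots> = card {k \<in> P. x k = y}" by (simp add: P_def of_bool_def sum.If_cases Int_def)
    also have "\<dots> = of_bool (y \<in> x ` P)"
    proof (cases "y \<in> x ` P")
      case True
      then obtain a where a: "a \<in> P" "y = x a" by auto
      have "{k \<in> P. x k = y} = {a}" using inj_onD [OF inj] a by (auto simp: P_def)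
      then show ?thesis using True by simp
    next
      case False
      then have "{k \<in> P. x k = y} = {}" by auto
      then show ?thesis using False by (simp only: card.empty of_bool_eq)
    qed
    finally show ?thesis .
  qed
  have PL: "P \<subseteq> {..<L}" "finite P" by (auto simp: P_def)
  have us: "u = col x True P + col x True ({..<L} - P)"
    unfolding u_col using col_union [of P "{..<L} - P" x True] PL by (simp add: Un_absorb1)
  have "col x True ({..<L} - P) = 0 \<or> ?w1 = 0"
  proof (rule switch [where f = 0])
    show "fib (col x True P + col x True ({..<L} - P)) (?w1 + ?w2)"
      using w(1) us restrict_split [of w I] by simp
    show "\<not> conn (col x True P + col x True ({..<L} - P)) (?w1 + ?w2)"
      using w(2) us restrict_split [of w I] by simp
    show "vdeg (col x True P) = vdeg (?w1 + 0)" using vc vw1 by (simp add: fun_eq_iff)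
  qed simp
  moreover have "?w1 \<noteq> 0"
  proof
    assume "?w1 = 0"
    then have "vdeg ?w1 (x 0) = 0" by simp
    moreover have "x 0 \<in> x ` P" using posL by (auto simp: P_def)
    ultimately show False using vw1 by simp
  qed
  moreover have "col x True ({..<L} - P) \<noteq> 0"
  proof -
    \<comment> \<open>The edge of u at position 2 lies outside \<open>P\<close>, so the remaining
      factor of u is not trivial.\<close>
    have two: "2 \<in> {..<L} - P" using length_ge_4 by (simp add: P_def)
    show ?thesis
    proof
      assume "col x True ({..<L} - P) = 0"
      then have "\<forall>k\<in>{..<L} - P. even k \<noteq> True" by (subst (asm) col_eq_0) simp_all
      then show False using two by (metis even_numeral)
    qed
  qed
  ultimately show False by blast
qed

end

context fin_graph
begin

lemma sz_emon: "adjacent p q \<Longrightarrow> sz (emon p q) = 1"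
  using adj_eix [of p q] by (simp add: sz_def emon_def lookup_single when_def sum.delta)

lemma fib_sz1_eq:
  assumes "fib a b" "sz a = 1"
  shows "a = b"
proof -
  have m: "mon a" "mon b" and d: "vdeg a = vdeg b" and sb: "sz b = 1"
    using assms fib_sz [OF assms(1)] by (auto simp: fib_def)
  have "(\<Sum>y<n. vdeg a y) \<noteq> 0" using sum_vdeg [of a] assms(2) by simp
  then obtain y where y: "vdeg a y > 0" by (metis gr0I sum.neutral)
  obtain z a' where z: "adjacent y z" "a = a' + emon y z" using edge_through [OF y] by blast
  have "vdeg b y > 0" using y d by simp
  then obtain z' b' where z': "adjacent y z'" "b = b' + emon y z'" using edge_through by blast
  have "sz a' = 0" "sz b' = 0" using assms(2) sb z z' by (auto simp: sz_add sz_emon)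
  then have ab: "a' = 0" "b' = 0" using m z(2) z'(2) sz_eq_0 by auto
  have "vdeg a z > 0" using z by (simp add: vdeg_add vdeg_emon)
  then have "vdeg b z > 0" using d by simp
  then have "z = y \<or> z = z'" using z' ab by (auto simp: vdeg_emon split: if_splits)
  then have "z = z'" using adj_neq [OF z(1)] by auto
  then show ?thesis using z(2) z'(2) ab by simp
qed

text \<open>On four vertices a monomial of the fibre is determined by the partner of x 0, since what
  remains is a single edge. u, v and w use up the three possible partners.\<close>

lemma fibre_of_three:
  assumes sharp: "sharp_condition n m E" and f: "fib u v" "fib u w"
    and nc: "\<not> conn u v" "\<not> conn u w" "\<not> conn v w" and s: "single u" "single v" and t: "fib u t"
  shows "t \<in> {u, v, w}"
proof -
  obtain x L j where W: "crit_walk n m E x L u v" "shape x L j" using crit_shape [OF sharp f(1) nc(1)] by blast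
  interpret W: crit_walk n m E x L u v by (rule W(1))
  have j: "j = 0" using W.no_third_if_revisit [OF W(2) _ f(2) nc(2,3)] by auto
  then have inj: "inj_on x {..<L}" using W(2) by (auto simp: shape_def)
  have L: "L = 4" using W.third_forces_4 [OF inj f(2) nc(2,3) s] .
  define V where "V = x ` {..<L}"
  have cV: "card V = 4" "finite V" using inj L by (auto simp: V_def card_image)
  have dV: "vdeg u y = of_bool (y \<in> V)" for y using W.vdeg_shape [OF W(2), of y] j by (simp add: V_def)
  have x0: "x 0 \<in> V" using L by (auto simp: V_def)
  have Vn: "V \<subseteq> {..<n}"
  proof
    fix y assume "y \<in> V"
    then have "vdeg u y \<noteq> 0" using dV by simp
    then show "y \<in> {..<n}" using vdeg_out [of y u] by force
  qed
  have "2 * sz u = (\<Sum>y<n. of_bool (y \<in> V))" using sum_vdeg [of u] dV by simp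
  also have "\<dots> = card ({..<n} \<inter> V)" by (simp add: of_bool_def sum.If_cases)
  also have "{..<n} \<inter> V = V" using Vn by blast
  finally have su: "sz u = 2" using cV by simp
  define P where "P a z \<longleftrightarrow> adjacent (x 0) z \<and> (\<exists>a'. a = a' + emon (x 0) z)" for a z
  have Pex: "\<exists>z\<in>V - {x 0}. P a z" if "fib u a" for a
  proof -
    have da: "vdeg a = vdeg u" using that by (simp add: fib_def)
    then have "vdeg a (x 0) > 0" using dV x0 by simp
    then obtain z a' where z: "adjacent (x 0) z" "a = a' + emon (x 0) z" using edge_through by blast
    have "vdeg a z > 0" using z by (simp add: vdeg_add vdeg_emon)
    then have "z \<in> V" using da dV [of z] by (cases "z \<in> V") auto
    moreover have "z \<noteq> x 0" using adj_neq [OF z(1)] by simp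
    ultimately show ?thesis using z by (auto simp: P_def)
  qed
  have Peq: "a = b" if ab: "fib u a" "fib u b" "P a z" "P b z" for a b z
  proof -
    obtain a' b' where a': "a = a' + emon (x 0) z" "b = b' + emon (x 0) z" and ad: "adjacent (x 0) z"
      using ab by (auto simp: P_def)
    have "fib a b" using ab fib_sym fib_trans by blast
    then have "fib a' b'" using a' fib_cancel by simp
    moreover have "sz a' = 1" using fib_sz [OF ab(1)] su a'(1) sz_emon [OF ad] by (simp add: sz_add)
    ultimately show ?thesis using fib_sz1_eq a' by blast
  qed
  have fu: "fib u u" using f(1) by (auto simp: fib_def)
  obtain zu where zu: "zu \<in> V - {x 0}" "P u zu" using Pex [OF fu] by blast
  obtain zv where zv: "zv \<in> V - {x 0}" "P v zv" using Pex [OF f(1)] by blast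
  obtain zw where zw: "zw \<in> V - {x 0}" "P w zw" using Pex [OF f(2)] by blast
  obtain zt where zt: "zt \<in> V - {x 0}" "P t zt" using Pex [OF t] by blast
  have "u \<noteq> v" "u \<noteq> w" "v \<noteq> w" using nc by auto
  then have "zu \<noteq> zv" "zu \<noteq> zw" "zv \<noteq> zw" using Peq fu f zu(2) zv(2) zw(2) by metis+
  then have "card {zu, zv, zw} = 3" by simp
  moreover have "card (V - {x 0}) = 3" using cV x0 by simp
  ultimately have "{zu, zv, zw} = V - {x 0}" using zu zv zw cV by (intro card_subset_eq) auto
  then have "zt \<in> {zu, zv, zw}" using zt(1) by simp
  then show ?thesis using Peq [OF t fu] Peq [OF t f(1)] Peq [OF t f(2)] zt(2) zu(2) zv(2) zw(2) by auto
qed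

end

context crit_walk
begin

section \<open>The binomial of the walk is a circuit\<close>

definition ews :: "nat list" where "ews = map (\<lambda>k. eix (x k) (x (Suc k))) [0..<L]"

lemma even_closed_walk_ews: "even_closed_walk m E ews"
  unfolding even_closed_walk_def
proof (intro conjI exI [of _ "map x [0..<Suc L]"])
  show "ews \<noteq> []" "even (length ews)" using posL evenL by (auto simp: ews_def)
  show "set ews \<subseteq> {..<m}" using adj_step adj_eix by (auto simp: ews_def)
  show "length (map x [0..<Suc L]) = length ews + 1" by (simp add: ews_def)
  show "map x [0..<Suc L] ! 0 = map x [0..<Suc L] ! length ews"
    using xL by (simp add: ews_def nth_append del: upt_Suc)
  show "\<forall>k<length ews. E (ews ! k) = {map x [0..<Suc L] ! k, map x [0..<Suc L] ! (k + 1)}"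
    using adj_step adj_eix by (simp add: ews_def del: upt_Suc)
qed

lemma walk_plus_ews: "walk_plus ews = u"
proof -
  have "{k \<in> {..<L}. even k = True} = (\<lambda>k. 2 * k) ` {..<L div 2}"
    using evenL by (auto simp: image_iff elim!: evenE)
  then have "u = (\<Sum>k<L div 2. emon (x (2 * k)) (x (Suc (2 * k))))"
    unfolding u_col col_def by (simp add: sum.reindex inj_on_def)
  also have "\<dots> = walk_plus ews"
    unfolding walk_plus_def by (rule sum.cong) (auto simp: ews_def emon_def)
  finally show ?thesis by simp
qed

lemma walk_minus_ews: "walk_minus ews = v"
proof -
  have "{k \<in> {..<L}. even k = False} = (\<lambda>k. 2 * k + 1) ` {..<L div 2}"
  proof (rule set_eqI)
    fix k show "k \<in> {k \<in> {..<L}. even k = False} \<longleftrightarrow> k \<in> (\<lambda>k. 2 * k + 1) ` {..<L div 2}"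
    proof
      assume "k \<in> {k \<in> {..<L}. even k = False}"
      then show "k \<in> (\<lambda>k. 2 * k + 1) ` {..<L div 2}"
        using evenL by (intro image_eqI [of _ _ "k div 2"]) auto
    next
      assume "k \<in> (\<lambda>k. 2 * k + 1) ` {..<L div 2}"
      then show "k \<in> {k \<in> {..<L}. even k = False}" using evenL by auto
    qed
  qed
  then have "v = (\<Sum>k<L div 2. emon (x (2 * k + 1)) (x (Suc (2 * k + 1))))"
    unfolding v_col col_def by (simp add: sum.reindex inj_on_def)
  also have "\<dots> = walk_minus ews"
    unfolding walk_minus_def using evenL by (intro sum.cong) (auto simp: ews_def emon_def)
  finally show ?thesis by simp
qed

lemma keys_disjoint: "ks u \<inter> ks v = {}"
  using nc fuv step_conn unfolding step_def by blast

lemma lookup_col: "finite K \<Longrightarrow> lkp (col x c K) i = card {k \<in> K. even k = c \<and> eix (x k) (x (Suc k)) = i}"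
  unfolding col_def emon_def
  by (simp add: lookup_sum lookup_single when_def sum.If_cases Int_def conj_assoc)

text \<open>Equal edges have positions of equal parity because u and v are disjoint; squarefreeness
  excludes a repetition within one colour.\<close>

lemma eix_inj:
  assumes "\<And>i. lkp u i \<le> 1" "\<And>i. lkp v i \<le> 1"
  shows "inj_on (\<lambda>k. eix (x k) (x (Suc k))) {..<L}"
proof (rule inj_onI)
  let ?e = "\<lambda>k. eix (x k) (x (Suc k))"
  fix k l assume kl: "k \<in> {..<L}" "l \<in> {..<L}" and eq: "?e k = ?e l"
  have mem: "?e t \<in> ks (if even t then u else v)" if "t < L" for t
    unfolding u_col v_col using that by (auto simp: col_keys)
  have par: "even k = even l"
    using mem [of k] mem [of l] kl eq keys_disjoint by (auto split: if_splits)
  show "k = l"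
  proof (rule ccontr)
    assume "k \<noteq> l"
    have "2 = card {k, l}" using \<open>k \<noteq> l\<close> by simp
    also have "\<dots> \<le> card {t \<in> {..<L}. even t = even k \<and> ?e t = ?e k}"
      using kl eq par by (intro card_mono) auto
    also have "\<dots> = lkp (col x (even k) {..<L}) (?e k)" by (simp add: lookup_col)
    also have "\<dots> \<le> 1" using assms u_col v_col by (cases "even k") auto
    finally show False by simp
  qed
qed

lemma kernel_walk_sum:
  fixes z :: "nat \<Rightarrow> int"
  assumes inj: "inj_on (\<lambda>k. eix (x k) (x (Suc k))) {..<L}"
    and z: "in_int_kernel n m E z" "supp z \<subseteq> ks u \<union> ks v" and "p < n"
  shows "(\<Sum>k | k < L \<and> x k = p. z (eix (x k) (x (Suc k)))) + (\<Sum>k | k < L \<and> x (Suc k) = p. z (eix (x k) (x (Suc k)))) = 0"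
proof -
  let ?e = "\<lambda>k. eix (x k) (x (Suc k))"
  have keys: "ks u \<union> ks v = ?e ` {..<L}"
    unfolding u_col v_col by (auto simp: col_keys)
  have em: "?e k < m" "E (?e k) = {x k, x (Suc k)}" "x k \<noteq> x (Suc k)" "x (Suc k) \<noteq> x k" if "k < L" for k
    using adj_eix [OF adj_step [OF that]] adj_neq [OF adj_step [OF that]] by auto
  have "0 = (\<Sum>i<m. if p \<in> E i then z i else 0)" using z(1) \<open>p < n\<close> by (simp add: in_int_kernel_def)
  also have "\<dots> = (\<Sum>i\<in>?e ` {..<L}. if p \<in> E i then z i else 0)"
    using z(2) keys em(1) by (intro sum.mono_neutral_right) (auto simp: supp_def)
  also have "\<dots> = (\<Sum>k<L. if p \<in> E (?e k) then z (?e k) else 0)"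
    using inj by (simp add: sum.reindex)
  also have "\<dots> = (\<Sum>k<L. (if x k = p then z (?e k) else 0) + (if x (Suc k) = p then z (?e k) else 0))"
    using em by (intro sum.cong) auto
  also have "\<dots> = (\<Sum>k | k < L \<and> x k = p. z (?e k)) + (\<Sum>k | k < L \<and> x (Suc k) = p. z (?e k))"
    by (simp add: sum.distrib sum.If_cases Int_def)
  finally show ?thesis by simp
qed

text \<open>At a vertex visited once, the kernel equation makes the two walk edges opposite. The
  only other equation is at x 0, and it links the two loops.\<close>

lemma kernel_alternates:
  fixes z :: "nat \<Rightarrow> int"
  assumes sh: "shape x L j" and inj: "inj_on (\<lambda>k. eix (x k) (x (Suc k))) {..<L}"
    and z: "in_int_kernel n m E z" "supp z \<subseteq> ks u \<union> ks v" and "k < L"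
  shows "z (eix (x k) (x (Suc k))) = (-1) ^ k * z (eix (x 0) (x 1))"
proof -
  define Z where "Z k = z (eix (x k) (x (Suc k)))" for k
  have xn: "x t < n" if "t < L" for t
    using adj_step [OF that] adj_eix edge_subset by (metis insert_subset lessThan_iff)
  have node: "(\<Sum>k | k < L \<and> x k = x t. Z k) + (\<Sum>k | k < L \<and> x (Suc k) = x t. Z k) = 0" if "t < L" for t
    using kernel_walk_sum [OF inj z xn [OF that]] by (simp add: Z_def)
  have step: "Z (Suc t) = - Z t" if t: "Suc t < L" "Suc t \<noteq> j" for t
  proof -
    have only: "s = Suc t" if "s < L" "x s = x (Suc t)" for s
    proof (cases "j = 0")
      case True
      then show ?thesis using sh that t inj_onD [of x "{..<L}" s "Suc t"] by (auto simp: shape_def)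
    next
      case False
      then have j: "0 < j" "j < L" "x j = x 0" "inj_on x ({..<L} - {j})" using sh by (auto simp: shape_def)
      have "s \<noteq> j"
      proof
        assume "s = j"
        then have "x 0 = x (Suc t)" using that j by simp
        then show False using inj_onD [OF j(4), of 0 "Suc t"] j t posL by auto
      qed
      then show ?thesis using inj_onD [OF j(4), of s "Suc t"] that t by auto
    qed
    have "{s. s < L \<and> x s = x (Suc t)} = {Suc t}" using only t by auto
    moreover have "{s. s < L \<and> x (Suc s) = x (Suc t)} = {t}"
    proof -
      have "s = t" if s: "s < L" "x (Suc s) = x (Suc t)" for s
      proof (cases "Suc s < L")
        case True
        then show ?thesis using only [of "Suc s"] s by simp
      next
        case False
        then have "x 0 = x (Suc t)" using s xL by (metis Suc_lessI)
        then show ?thesis using only [of 0] posL by simp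
      qed
      then show ?thesis using t by auto
    qed
    ultimately show ?thesis using node [OF t(1)] by simp
  qed
  have low: "Z t = (-1) ^ t * Z 0" if "t < L" "t < j \<or> j = 0" for t
    using that
  proof (induction t)
    case (Suc t)
    have "Z (Suc t) = - Z t" by (rule step) (use Suc.prems in auto)
    moreover have "Z t = (-1) ^ t * Z 0" by (rule Suc.IH) (use Suc.prems in auto)
    ultimately show ?case by simp
  qed simp
  have "Z k = (-1) ^ k * Z 0"
  proof (cases "j = 0")
    case True
    then show ?thesis by (intro low \<open>k < L\<close>) simp
  next
    case False
    then have j: "0 < j" "j < L" "odd j" "x j = x 0" "inj_on x ({..<L} - {j})" using sh by (auto simp: shape_def)
    have high: "Z (j + t) = (-1) ^ t * Z j" if "j + t < L" for t
      using that
    proof (induction t)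
      case (Suc t)
      have "Z (Suc (j + t)) = - Z (j + t)" by (rule step) (use Suc.prems in auto)
      moreover have "Z (j + t) = (-1) ^ t * Z j" by (rule Suc.IH) (use Suc.prems in auto)
      ultimately show ?case by simp
    qed simp
    have only: "s = 0 \<or> s = j" if "s < L" "x s = x 0" for s
      using inj_onD [OF j(5), of s 0] that j posL by (cases "s = j") auto
    have "{s. s < L \<and> x s = x 0} = {0, j}" using only j posL by auto
    moreover have "{s. s < L \<and> x (Suc s) = x 0} = {j - 1, L - 1}"
    proof -
      have "s = j - 1 \<or> s = L - 1" if s: "s < L" "x (Suc s) = x 0" for s
      proof (cases "Suc s < L")
        case True
        then show ?thesis using only [of "Suc s"] s by auto
      qed (use s in auto)
      then show ?thesis using j xL posL by auto
    qed
    moreover have "j - 1 \<noteq> L - 1" using j by linarith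
    \<comment> \<open>As j is odd and L even, each loop begins and ends with the same value; the
      equation becomes 2 * (Z 0 + Z j) = 0.\<close>
    ultimately have "Z 0 + Z j + (Z (j - 1) + Z (L - 1)) = 0"
      using node [OF posL] j by simp
    moreover have "Z (j - 1) = Z 0" using low [of "j - 1"] j by auto
    moreover have "Z (L - 1) = Z j" using high [of "L - 1 - j"] j evenL posL by simp
    ultimately have Zj: "Z j = - Z 0" by simp
    show ?thesis
    proof (cases "k < j")
      case True
      then show ?thesis by (intro low \<open>k < L\<close>) simp
    next
      case False
      then have "Z k = (-1) ^ (k - j) * - Z 0" using high [of "k - j"] \<open>k < L\<close> Zj by simp
      moreover have "(-1 :: int) ^ k = (-1) ^ (k - j) * (-1) ^ j"
        using False by (simp flip: power_add)
      ultimately show ?thesis using j(3) by simp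
    qed
  qed
  then show ?thesis by (simp add: Z_def)
qed

lemma part_eq:
  assumes "mon a" "\<And>i. nat (g i) = lkp a i"
  shows "(\<Sum>i<m. sg i (nat (g i))) = a"
proof (rule poly_mapping_eqI)
  fix k
  have "lkp (\<Sum>i<m. sg i (nat (g i))) k = (\<Sum>i<m. if i = k then lkp a k else 0)"
    unfolding lookup_sum assms(2) by (rule sum.cong) (auto simp: lookup_single when_def)
  also have "\<dots> = lkp a k" using assms(1) by (auto simp: mon_def in_keys_iff)
  finally show "lkp (\<Sum>i<m. sg i (nat (g i))) k = lkp a k" .
qed

text \<open>A kernel vector supported on the walk is a multiple of the alternating vector by
  \<open>kernel_alternates\<close>, so a nonzero one has full support. An entry 1 makes the gcd
  1.\<close>

lemma is_circuit_diff:
  assumes sh: "shape x L j" and sq: "\<And>i. lkp u i \<le> 1" "\<And>i. lkp v i \<le> 1"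
  shows "is_circuit n m E (xmono u - xmono v :: 'k::field mpoly)"
proof -
  let ?e = "\<lambda>k. eix (x k) (x (Suc k))"
  define d where "d i = int (lkp u i) - int (lkp v i)" for i
  have mm: "mon u" "mon v" using fuv by (auto simp: fib_def)
  have dis: "lkp u i = 0 \<or> lkp v i = 0" for i using keys_disjoint by (auto simp: in_keys_iff disjoint_iff)
  have "pos_part m d = u" unfolding pos_part_def
  proof (rule part_eq [OF mm(1)])
    fix i show "nat (d i) = lkp u i" using dis [of i] by (auto simp: d_def)
  qed
  moreover have "neg_part m d = v" unfolding neg_part_def
  proof (rule part_eq [OF mm(2)])
    fix i show "nat (- d i) = lkp v i" using dis [of i] by (auto simp: d_def)
  qed
  moreover have "circuit_vector n m E d"
  proof -
    have out: "d i = 0" if "m \<le> i" for i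
    proof -
      have "i \<notin> ks u" "i \<notin> ks v" using mm that by (auto simp: mon_def)
      then show ?thesis by (simp add: d_def in_keys_iff)
    qed
    have "(\<Sum>i<m. if y \<in> E i then d i else 0) = 0" for y
    proof -
      have "(\<Sum>i<m. if y \<in> E i then d i else 0)
          = (\<Sum>i<m. int (if y \<in> E i then lkp u i else 0) - int (if y \<in> E i then lkp v i else 0))"
        by (rule sum.cong) (auto simp: d_def)
      also have "\<dots> = int (vdeg u y) - int (vdeg v y)" by (simp add: sum_subtractf vdeg_def)
      finally show ?thesis using fuv by (simp add: fib_def)
    qed
    then have ker: "in_int_kernel n m E d" using out by (simp add: in_int_kernel_def)
    have supp_d: "supp d = ks u \<union> ks v"
    proof (rule set_eqI)
      fix i show "i \<in> supp d \<longleftrightarrow> i \<in> ks u \<union> ks v"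
        using dis [of i] by (auto simp: supp_def d_def in_keys_iff)
    qed
    have keys: "ks u \<union> ks v = ?e ` {..<L}" unfolding u_col v_col by (auto simp: col_keys)
    have e0: "?e 0 \<in> ks u" unfolding u_col using posL by (auto simp: col_keys)
    have minimal: "\<not> (supp z \<noteq> {} \<and> supp z \<subset> supp d)" if z: "in_int_kernel n m E z" for z
    proof
      assume s: "supp z \<noteq> {} \<and> supp z \<subset> supp d"
      then have sub: "supp z \<subseteq> ks u \<union> ks v" using supp_d by auto
      have alt: "z (?e k) = (-1) ^ k * z (?e 0)" if "k < L" for k
        using kernel_alternates [OF sh eix_inj [OF sq] z sub that] by simp
      obtain i where i: "i \<in> supp z" using s by blast
      then have "i \<in> ?e ` {..<L}" using sub keys by auto
      then obtain k where k: "k < L" "i = ?e k" by auto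
      have "z (?e k) \<noteq> 0" using i k(2) by (simp add: supp_def)
      then have z0: "z (?e 0) \<noteq> 0" using alt [OF k(1)] by (metis mult_zero_right)
      have "z (?e k) \<noteq> 0" if "k < L" for k
        unfolding alt [OF that] using z0 by (metis mult_eq_0_iff power_not_zero zero_neq_neg_one)
      then have "?e ` {..<L} \<subseteq> supp z" by (auto simp: supp_def)
      then show False using s supp_d keys by blast
    qed
    have "lkp u (?e 0) = 1" using sq(1) [of "?e 0"] e0 by (simp add: in_keys_iff)
    then have "d (?e 0) = 1" using dis [of "?e 0"] by (simp add: d_def)
    moreover have "?e 0 < m" using adj_eix adj_step posL by blast
    ultimately have "1 \<in> d ` {..<m}" by (metis imageI lessThan_iff)
    then have "Gcd (d ` {..<m}) dvd 1" by (rule Gcd_dvd)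
    then have gcd: "Gcd (d ` {..<m}) = 1" using Gcd_int_greater_eq_0 [of "d ` {..<m}"] by (simp add: zdvd1_eq)
    have "supp d \<noteq> {}" using supp_d e0 by auto
    then show ?thesis using ker minimal gcd by (auto simp: circuit_vector_def)
  qed
  ultimately show ?thesis unfolding is_circuit_def by metis
qed

end

theorem theorem3p14:
  fixes n m :: nat and E :: "nat \<Rightarrow> nat set"
  assumes "simple_graph n m E"
    and "connected_graph n m E"
    and "sharp_condition n m E"
    and "\<not> (\<exists>ws. even_closed_walk m E ws \<and>
              minimal_binomial m (toric_ideal m E :: 'k::field mpoly set) (walk_binomial ws) \<and>
              is_circuit n m E (walk_binomial ws :: 'k mpoly) \<and>
              squarefree_mono (walk_plus ws) \<and> squarefree_mono (walk_minus ws) \<and>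
              \<not> indispensable_monomial m (toric_ideal m E :: 'k mpoly set) (walk_plus ws) \<and>
              \<not> indispensable_monomial m (toric_ideal m E :: 'k mpoly set) (walk_minus ws))"
  shows "bar m (toric_ideal m E :: 'k mpoly set) = mu m (toric_ideal m E :: 'k mpoly set)"
proof -
  interpret fin_graph n m E by unfold_locales (rule assms(1))
  note sharp = assms(3)
  have fin: "finite (Collect crit)" using finite_crit crit_squarefree [OF sharp] by blast
  \<comment> \<open>The excluded form of binomials is used here: x^u - x^v satisfies every other
    condition of it, so u or v must be indispensable.\<close>
  have one_single: "single u \<or> single v" if uv: "fib u v" "\<not> conn u v" for u v
  proof -
    obtain x L j where W: "crit_walk n m E x L u v" "shape x L j" using crit_shape [OF sharp uv] by blast
    interpret W: crit_walk n m E x L u v by (rule W(1))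
    have sq: "lkp u i \<le> 1" "lkp v i \<le> 1" for i
      using crit_squarefree [OF sharp] critI [OF uv] critI' [OF uv] by auto
    have wb: "walk_binomial W.ews = (xmono u - xmono v :: 'k mpoly)"
      by (simp add: walk_binomial_def W.walk_plus_ews W.walk_minus_ews)
    have "is_circuit n m E (walk_binomial W.ews :: 'k mpoly)"
      unfolding wb by (rule W.is_circuit_diff [OF W(2) sq])
    moreover have "minimal_binomial m (toric_ideal m E) (walk_binomial W.ews :: 'k mpoly)"
      unfolding wb by (rule minimal_binomial_crit [OF fin uv])
    ultimately have "indispensable_monomial m (toric_ideal m E :: 'k mpoly set) u \<or>
        indispensable_monomial m (toric_ideal m E :: 'k mpoly set) v"
      using assms(4) W.even_closed_walk_ews sq W.walk_plus_ews W.walk_minus_ews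
      unfolding squarefree_mono_def by metis
    then show ?thesis
    proof
      assume "indispensable_monomial m (toric_ideal m E :: 'k mpoly set) u"
      then show ?thesis using indispensable_single uv by blast
    next
      assume "indispensable_monomial m (toric_ideal m E :: 'k mpoly set) v"
      moreover have "fib v u" "\<not> conn v u" using uv fib_sym conn_sym by blast+
      ultimately show ?thesis using indispensable_single by blast
    qed
  qed
  show ?thesis
  proof (rule bar_eq_mu)
    show "lkp w i \<le> 1" if "crit w" for w i by (rule crit_squarefree [OF sharp that])
    show "fib u v" if "crit u" "crit v" "VS u = VS v" for u v by (rule VS_determines [OF sharp that])
    show "single u \<or> single v" if "fib u v" "\<not> conn u v" for u v by (rule one_single [OF that])
    show "t \<in> {u, v, w}"
      if f: "fib u v" "fib u w" and nc: "\<not> conn u v" "\<not> conn u w" "\<not> conn v w" and t: "fib u t" for u v w t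
    proof -
      have f': "fib v w" "fib v u" "fib v t" using f t fib_sym fib_trans by blast+
      have nc': "\<not> conn w v" "\<not> conn w u" "\<not> conn v u" using nc conn_sym by blast+
      \<comment> \<open>Hence two of the three are alone in their classes, as
        \<open>fibre_of_three\<close> requires; the cases only rename them.\<close>
      have "single u \<or> single v" "single u \<or> single w" "single v \<or> single w"
        using one_single f nc f'(1) by blast+
      then consider "single u" "single v" | "single u" "single w" | "single v" "single w" by blast
      then show ?thesis
      proof cases
        case 1
        then show ?thesis using fibre_of_three [OF sharp f nc 1 t] by simp
      next
        case 2
        then show ?thesis using fibre_of_three [OF sharp f(2,1) nc(2,1) nc'(1) 2 t] by auto
      next
        case 3
        then show ?thesis using fibre_of_three [OF sharp f'(1,2) nc(3) nc'(3) nc'(2) 3 f'(3)] by auto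
      qed
    qed
  qed
qed

end
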